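(* Let $\mathcal T$ be a $k$-linear triangulated category and $\lambda:\mathrm K(\mathcal T)\to\Lambda$ a lattice of finite rank. The forgetful map $$\mathrm{Forg}:\mathrm{Sb}_\Lambda(\mathcal T)\to\mathrm{Hom}_{\mathbb Z}(\Lambda,\mathbb R),\qquad \tilde\sigma\mapsto B_{\tilde\sigma}$$ is a local homeomorphism.
   Context: A slicing $\mathcal P$ on $\mathcal T$ is a family of full additive subcategories $\mathcal P(\theta)$ ($\theta\in\mathbb R$) with $\mathcal P(\theta)[1]=\mathcal P(\theta+1)$, $\mathrm{Hom}(F_1,F_2)=0$ whenever $F_i\in\mathcal P(\theta_i)$, $\theta_1>\theta_2$, and such that every nonzero object $E$ has a finite Harder--Narasimhan filtration with nonzero factors $A_i\in\mathcal P(\theta_i)$, $\theta_1>\dots>\theta_m$; put $\phi^+_{\mathcal P}(E)=\theta_1$, $\phi^-_{\mathcal P}(E)=\theta_m$. The distance of slicings is $d(\mathcal P,\mathcal P')=\sup_{0\ne E}\{|\phi^+_{\mathcal P}(E)-\phi^+_{\mathcal P'}(E)|,|\phi^-_{\mathcal P}(E)-\phi^-_{\mathcal P'}(E)|\}\in[0,+\infty]$. $\Lambda$ is a free abelian group of finite rank with a surjection $\lambda:\mathrm K(\mathcal T)\to\Lambda$. A stability condition is a pair $\sigma=(\mathcal P_\sigma,Z_\sigma)$ of a slicing and a homomorphism $Z_\sigma:\Lambda\to\mathbb C$ such that $Z_\sigma(\lambda([E]))\in\mathbb R_{>0}e^{i\pi\theta}$ for $0\ne E\in\mathcal P_\sigma(\theta)$,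 and the support property holds: there is a quadratic form $Q$ on $\Lambda\otimes\mathbb R$, negative definite on $\ker Z_\sigma$, with $Q(\lambda([E]))\ge0$ for every nonzero $E$ in any $\mathcal P_\sigma(\theta)$. $\mathrm{Stab}_\Lambda(\mathcal T)$ is the set of stability conditions with the topology of the generalized metric $\max\{d(\mathcal P_1,\mathcal P_2),\|Z_1-Z_2\|\}$. Define $\sigma\sim\tau$ iff $\mathrm{Im}\,Z_\sigma=\mathrm{Im}\,Z_\tau$ and $d(\mathcal P_\sigma,\mathcal P_\tau)<1$ (this is an equivalence relation; equivalently, $\mathrm{Im}\,Z_\sigma=\mathrm{Im}\,Z_\tau$ and $\sigma,\tau$ lie in the same path-connected component of the set of stability conditions with this imaginary part of the central charge). $\mathrm{Sb}_\Lambda(\mathcal T)=\mathrm{Stab}_\Lambda(\mathcal T)/\!\sim$ carries the quotient topology; for $\tilde\sigma\in\mathrm{Sb}_\Lambda(\mathcal T)$ represented by $\sigma$, $B_{\tilde\sigma}:=\mathrm{Im}\,Z_\sigma$, which is independent of the representative. *)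

theory Defs
  imports "HOL-Analysis.Analysis" "HOL-Algebra.Free_Abelian_Groups" "HOL-Algebra.Generated_Groups"
begin

section \<open>Linear triangulated categories\<close>

text \<open>
  The type \<open>'o\<close> is the set of objects.  All Hom-spaces are subspaces of one ambient vector space
  \<open>'m\<close>, so that addition and the zero morphism are those of \<open>'m\<close>; every small linear category has
  this form, with ambient space the direct sum of its Hom-spaces.  Different Hom-spaces
  may overlap, hence every notion below carries its source and target explicitly.
  \<open>Comp C g f\<close> is ``\<open>g\<close> after \<open>f\<close>'', and \<open>dtri C X Y Z f g h\<close> says that
  \<open>X \<rightarrow> Y \<rightarrow> Z \<rightarrow> X[1]\<close> with maps \<open>f, g, h\<close> is a distinguished triangle.
\<close>

record ('o, 'm, 'k) tricat =
  Hom :: "'o \<Rightarrow> 'o \<Rightarrow> 'm set"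
  Comp :: "'m \<Rightarrow> 'm \<Rightarrow> 'm"
  ident :: "'o \<Rightarrow> 'm"
  scale :: "'k \<Rightarrow> 'm \<Rightarrow> 'm"
  sh :: "'o \<Rightarrow> 'o"
  shm :: "'m \<Rightarrow> 'm"
  dtri :: "'o \<Rightarrow> 'o \<Rightarrow> 'o \<Rightarrow> 'm \<Rightarrow> 'm \<Rightarrow> 'm \<Rightarrow> bool"

locale linear_category =
  fixes C :: "('o, 'm::ab_group_add, 'k::field) tricat"
  assumes vector_space_scale: "vector_space (scale C)"
    and subspace_Hom: "Modules.module.subspace (scale C) (Hom C X Y)"
    and comp_in_Hom: "\<lbrakk>f \<in> Hom C X Y; g \<in> Hom C Y Z\<rbrakk> \<Longrightarrow> Comp C g f \<in> Hom C X Z"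
    and ident_in_Hom: "ident C X \<in> Hom C X X"
    and comp_ident_right: "f \<in> Hom C X Y \<Longrightarrow> Comp C f (ident C X) = f"
    and comp_ident_left: "f \<in> Hom C X Y \<Longrightarrow> Comp C (ident C Y) f = f"
    and comp_assoc: "\<lbrakk>f \<in> Hom C W X; g \<in> Hom C X Y; h \<in> Hom C Y Z\<rbrakk>
      \<Longrightarrow> Comp C h (Comp C g f) = Comp C (Comp C h g) f"
    and comp_add_right: "\<lbrakk>f \<in> Hom C X Y; f' \<in> Hom C X Y; g \<in> Hom C Y Z\<rbrakk>
      \<Longrightarrow> Comp C g (f + f') = Comp C g f + Comp C g f'"
    and comp_add_left: "\<lbrakk>f \<in> Hom C X Y; g \<in> Hom C Y Z; g' \<in> Hom C Y Z\<rbrakk>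
      \<Longrightarrow> Comp C (g + g') f = Comp C g f + Comp C g' f"
    and comp_scale_right: "\<lbrakk>f \<in> Hom C X Y; g \<in> Hom C Y Z\<rbrakk>
      \<Longrightarrow> Comp C g (scale C r f) = scale C r (Comp C g f)"
    and comp_scale_left: "\<lbrakk>f \<in> Hom C X Y; g \<in> Hom C Y Z\<rbrakk>
      \<Longrightarrow> Comp C (scale C r g) f = scale C r (Comp C g f)"

definition is_iso :: "('o, 'm, 'k) tricat \<Rightarrow> 'o \<Rightarrow> 'o \<Rightarrow> 'm \<Rightarrow> bool" where
  "is_iso C X Y f \<longleftrightarrow> f \<in> Hom C X Y \<and>
     (\<exists>g \<in> Hom C Y X. Comp C g f = ident C X \<and> Comp C f g = ident C Y)"

definition isomorphic :: "('o, 'm, 'k) tricat \<Rightarrow> 'o \<Rightarrow> 'o \<Rightarrow> bool" where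
  "isomorphic C X Y \<longleftrightarrow> (\<exists>f. is_iso C X Y f)"

definition is_zero_obj :: "('o, 'm::zero, 'k) tricat \<Rightarrow> 'o \<Rightarrow> bool" where
  "is_zero_obj C X \<longleftrightarrow> (\<forall>Y. Hom C X Y = {0} \<and> Hom C Y X = {0})"

definition is_biproduct :: "('o, 'm::ab_group_add, 'k) tricat \<Rightarrow> 'o \<Rightarrow> 'o \<Rightarrow> 'o \<Rightarrow> bool" where
  "is_biproduct C X Y S \<longleftrightarrow>
     (\<exists>i \<in> Hom C X S. \<exists>j \<in> Hom C Y S. \<exists>p \<in> Hom C S X. \<exists>q \<in> Hom C S Y.
        Comp C p i = ident C X \<and> Comp C q j = ident C Y \<and>
        Comp C p j = 0 \<and> Comp C q i = 0 \<and>
        Comp C i p + Comp C j q = ident C S)"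

text \<open>The shift is only required to be an autoequivalence, not an automorphism.\<close>

locale triangulated_category = linear_category C
  for C :: "('o, 'm::ab_group_add, 'k::field) tricat" +
  assumes ex_zero_obj: "\<exists>X. is_zero_obj C X"
    and ex_biproduct: "\<exists>S. is_biproduct C X Y S"
    and shm_bij: "bij_betw (shm C) (Hom C X Y) (Hom C (sh C X) (sh C Y))"
    and shm_ident: "shm C (ident C X) = ident C (sh C X)"
    and shm_comp: "\<lbrakk>f \<in> Hom C X Y; g \<in> Hom C Y Z\<rbrakk>
      \<Longrightarrow> shm C (Comp C g f) = Comp C (shm C g) (shm C f)"
    and shm_add: "\<lbrakk>f \<in> Hom C X Y; g \<in> Hom C X Y\<rbrakk> \<Longrightarrow> shm C (f + g) = shm C f + shm C g"
    and shm_scale: "f \<in> Hom C X Y \<Longrightarrow> shm C (scale C r f) = scale C r (shm C f)"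
    and sh_ess_surj: "\<exists>Y. isomorphic C X (sh C Y)"
    and dist_in_Hom: "dtri C X Y Z f g h
      \<Longrightarrow> f \<in> Hom C X Y \<and> g \<in> Hom C Y Z \<and> h \<in> Hom C Z (sh C X)"
    and TR1_ident: "is_zero_obj C Z \<Longrightarrow> dtri C X X Z (ident C X) 0 0"
    and TR1_iso: "\<lbrakk>dtri C X Y Z f g h;
        f' \<in> Hom C X' Y'; g' \<in> Hom C Y' Z'; h' \<in> Hom C Z' (sh C X');
        is_iso C X X' a; is_iso C Y Y' b; is_iso C Z Z' c;
        Comp C b f = Comp C f' a; Comp C c g = Comp C g' b; Comp C (shm C a) h = Comp C h' c\<rbrakk>
      \<Longrightarrow> dtri C X' Y' Z' f' g' h'"
    and TR1_cone: "f \<in> Hom C X Y \<Longrightarrow> \<exists>Z g h. dtri C X Y Z f g h"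
    and TR2: "\<lbrakk>f \<in> Hom C X Y; g \<in> Hom C Y Z; h \<in> Hom C Z (sh C X)\<rbrakk>
      \<Longrightarrow> dtri C X Y Z f g h \<longleftrightarrow> dtri C Y Z (sh C X) g h (- shm C f)"
    and TR3: "\<lbrakk>dtri C X Y Z f g h; dtri C X' Y' Z' f' g' h';
        a \<in> Hom C X X'; b \<in> Hom C Y Y'; Comp C b f = Comp C f' a\<rbrakk>
      \<Longrightarrow> \<exists>c \<in> Hom C Z Z'. Comp C c g = Comp C g' b \<and> Comp C (shm C a) h = Comp C h' c"
    and TR4: "\<lbrakk>dtri C X Y U f a b; dtri C Y Z W g c d; dtri C X Z V (Comp C g f) e h\<rbrakk>
      \<Longrightarrow> \<exists>u v. dtri C U V W u v (Comp C (shm C a) d) \<and>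
            Comp C u a = Comp C e g \<and> Comp C h u = b \<and>
            Comp C v e = c \<and> Comp C d v = Comp C (shm C f) h"


section \<open>The Grothendieck group and the lattice\<close>

definition K_relations :: "('o, 'm, 'k) tricat \<Rightarrow> ('o \<Rightarrow>\<^sub>0 int) set" where
  "K_relations C = {frag_of Y - frag_of X - frag_of Z | X Y Z. \<exists>f g h. dtri C X Y Z f g h}"

definition K_null :: "('o, 'm, 'k) tricat \<Rightarrow> ('o \<Rightarrow>\<^sub>0 int) set" where
  "K_null C = generate (free_Abelian_group UNIV) (K_relations C)"

definition K_group :: "('o, 'm, 'k) tricat \<Rightarrow> ('o \<Rightarrow>\<^sub>0 int) set monoid" where
  "K_group C = free_Abelian_group UNIV Mod K_null C"

definition K_class :: "('o, 'm, 'k) tricat \<Rightarrow> 'o \<Rightarrow> ('o \<Rightarrow>\<^sub>0 int) set" where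
  "K_class C E = K_null C #>\<^bsub>free_Abelian_group UNIV\<^esub> frag_of E"

text \<open>The lattice \<open>\<Lambda>\<close> is a type \<open>'l\<close>; this is its additive group as a \<open>monoid\<close> record.\<close>

definition type_group :: "'l::ab_group_add monoid" where
  "type_group = \<lparr>carrier = UNIV, monoid.mult = (+), one = 0\<rparr>"

definition finite_rank_lattice :: "'l::ab_group_add itself \<Rightarrow> bool" where
  "finite_rank_lattice _ \<longleftrightarrow>
     (\<exists>n::nat. (type_group :: 'l monoid) \<cong> free_Abelian_group {..<n})"

definition Hom_Z :: "('l::ab_group_add \<Rightarrow> 'b::ab_group_add) set" where
  "Hom_Z = {f. Modules.additive f}"

text \<open>Pointwise convergence; for \<open>\<Lambda>\<close> of finite rank this is the usual topology of the
  finite-dimensional real vector space \<open>Hom(\<Lambda>, \<real>)\<close>.\<close>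

definition Hom_Z_topology :: "('l::ab_group_add \<Rightarrow> real) topology" where
  "Hom_Z_topology = top_of_set Hom_Z"

definition is_norm_Hom :: "(('l::ab_group_add \<Rightarrow> complex) \<Rightarrow> real) \<Rightarrow> bool" where
  "is_norm_Hom N \<longleftrightarrow>
     (\<forall>Z \<in> Hom_Z. 0 \<le> N Z \<and> (N Z = 0 \<longleftrightarrow> Z = (\<lambda>_. 0)) \<and>
        (\<forall>r::real. N (\<lambda>x. r *\<^sub>R Z x) = \<bar>r\<bar> * N Z)) \<and>
     (\<forall>Z \<in> Hom_Z. \<forall>W \<in> Hom_Z. N (\<lambda>x. Z x + W x) \<le> N Z + N W)"


section \<open>The real vector space \<open>\<Lambda> \<otimes> \<real>\<close>\<close>

text \<open>A finitely supported \<open>p :: 'l \<Rightarrow>\<^sub>0 real\<close> stands for the sum of the \<open>x \<otimes> p(x)\<close>; it remains to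
  impose additivity in the first factor.\<close>

inductive_set tensor_null :: "('l::ab_group_add \<Rightarrow>\<^sub>0 real) set" where
  zero: "0 \<in> tensor_null"
| rel: "Poly_Mapping.single (x + y) r - Poly_Mapping.single x r - Poly_Mapping.single y r
        \<in> tensor_null"
| add: "p \<in> tensor_null \<Longrightarrow> q \<in> tensor_null \<Longrightarrow> p + q \<in> tensor_null"

abbreviation pm_scale :: "real \<Rightarrow> ('l \<Rightarrow>\<^sub>0 real) \<Rightarrow> ('l \<Rightarrow>\<^sub>0 real)" where
  "pm_scale r \<equiv> Poly_Mapping.map ((*) r)"

lemma lookup_pm_scale: "Poly_Mapping.lookup (pm_scale r p) x = r * Poly_Mapping.lookup p x"
  by (simp add: Poly_Mapping.map.rep_eq when_def)

lemma pm_scale_add: "pm_scale r (p + q) = pm_scale r p + pm_scale r q"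
  by (rule poly_mapping_eqI) (simp add: lookup_pm_scale lookup_add distrib_left)

lemma pm_scale_diff: "pm_scale r (p - q) = pm_scale r p - pm_scale r q"
  by (rule poly_mapping_eqI) (simp add: lookup_pm_scale lookup_minus right_diff_distrib)

lemma pm_scale_single: "pm_scale r (Poly_Mapping.single x s) = Poly_Mapping.single x (r * s)"
  by (rule poly_mapping_eqI) (simp add: lookup_pm_scale lookup_single when_def)

lemma pm_scale_zero: "pm_scale r 0 = 0"
  by (rule poly_mapping_eqI) (simp add: lookup_pm_scale)

lemma pm_scale_add_left: "pm_scale (r + s) p = pm_scale r p + pm_scale s p"
  by (rule poly_mapping_eqI) (simp add: lookup_pm_scale lookup_add distrib_right)

lemma pm_scale_pm_scale: "pm_scale r (pm_scale s p) = pm_scale (r * s) p"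
  by (rule poly_mapping_eqI) (simp add: lookup_pm_scale)

lemma pm_scale_one: "pm_scale 1 p = p"
  by (rule poly_mapping_eqI) (simp add: lookup_pm_scale)

lemma tensor_null_scale: "p \<in> tensor_null \<Longrightarrow> pm_scale r p \<in> tensor_null"
proof (induction rule: tensor_null.induct)
  case zero
  show ?case by (simp only: pm_scale_zero tensor_null.zero)
next
  case (rel x y s)
  show ?case by (simp only: pm_scale_diff pm_scale_single tensor_null.rel)
next
  case (add p q)
  then show ?case by (simp only: pm_scale_add tensor_null.add)
qed

lemma tensor_null_uminus:
  assumes "p \<in> tensor_null" shows "- p \<in> tensor_null"
proof -
  have "pm_scale (- 1) p = - p"
    by (rule poly_mapping_eqI) (simp add: lookup_pm_scale)
  with tensor_null_scale[OF assms, of "- 1"] show ?thesis by simp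
qed

definition tensor_rel :: "('l::ab_group_add \<Rightarrow>\<^sub>0 real) \<Rightarrow> ('l \<Rightarrow>\<^sub>0 real) \<Rightarrow> bool" where
  "tensor_rel p q \<longleftrightarrow> p - q \<in> tensor_null"

lemma tensor_rel_refl: "tensor_rel p p"
  by (simp add: tensor_rel_def tensor_null.zero)

lemma equivp_tensor_rel: "equivp tensor_rel"
proof (rule equivpI)
  show "reflp tensor_rel"
    by (simp add: reflp_def tensor_rel_def tensor_null.zero)
  show "symp tensor_rel"
    unfolding symp_def tensor_rel_def by (metis minus_diff_eq tensor_null_uminus)
  show "transp tensor_rel"
    unfolding transp_def tensor_rel_def by (metis diff_add_cancel add_diff_eq tensor_null.add)
qed

quotient_type (overloaded) 'l real_tensor = "'l::ab_group_add \<Rightarrow>\<^sub>0 real" / tensor_rel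
  by (rule equivp_tensor_rel)

instantiation real_tensor :: (ab_group_add) real_vector
begin

lift_definition zero_real_tensor :: "'a real_tensor" is 0 .

lift_definition plus_real_tensor :: "'a real_tensor \<Rightarrow> 'a real_tensor \<Rightarrow> 'a real_tensor" is "(+)"
proof -
  fix p p' q q' :: "'a \<Rightarrow>\<^sub>0 real"
  assume "tensor_rel p p'" "tensor_rel q q'"
  then have "(p - p') + (q - q') \<in> tensor_null"
    unfolding tensor_rel_def by (rule tensor_null.add)
  then show "tensor_rel (p + q) (p' + q')"
    by (simp only: tensor_rel_def add_diff_add)
qed

lift_definition uminus_real_tensor :: "'a real_tensor \<Rightarrow> 'a real_tensor" is uminus
proof -
  fix p p' :: "'a \<Rightarrow>\<^sub>0 real"
  assume "tensor_rel p p'"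
  then have "- (p - p') \<in> tensor_null"
    unfolding tensor_rel_def by (rule tensor_null_uminus)
  then show "tensor_rel (- p) (- p')"
    by (simp only: tensor_rel_def minus_diff_minus)
qed

lift_definition minus_real_tensor :: "'a real_tensor \<Rightarrow> 'a real_tensor \<Rightarrow> 'a real_tensor" is "(-)"
proof -
  fix p p' q q' :: "'a \<Rightarrow>\<^sub>0 real"
  assume "tensor_rel p p'" "tensor_rel q q'"
  then have "(p - p') + - (q - q') \<in> tensor_null"
    unfolding tensor_rel_def by (intro tensor_null.add tensor_null_uminus)
  moreover have "(p - p') + - (q - q') = (p - q) - (p' - q')"
    by (simp add: algebra_simps)
  ultimately show "tensor_rel (p - q) (p' - q')"
    by (simp only: tensor_rel_def)
qed

lift_definition scaleR_real_tensor :: "real \<Rightarrow> 'a real_tensor \<Rightarrow> 'a real_tensor" is pm_scale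
  by (simp only: tensor_rel_def flip: pm_scale_diff) (rule tensor_null_scale)

instance
proof
  fix a b c :: "'a real_tensor" and r s :: real
  show "a + b + c = a + (b + c)" by transfer (simp add: tensor_rel_refl add.assoc)
  show "a + b = b + a" by transfer (simp add: tensor_rel_refl add.commute)
  show "0 + a = a" by transfer (simp add: tensor_rel_refl)
  show "- a + a = 0" by transfer (simp add: tensor_rel_refl)
  show "a - b = a + - b" by transfer (simp add: tensor_rel_refl)
  show "r *\<^sub>R (a + b) = r *\<^sub>R a + r *\<^sub>R b"
    by transfer (simp add: tensor_rel_refl pm_scale_add)
  show "(r + s) *\<^sub>R a = r *\<^sub>R a + s *\<^sub>R a" by transfer (simp add: tensor_rel_refl pm_scale_add_left)
  show "r *\<^sub>R s *\<^sub>R a = (r * s) *\<^sub>R a" by transfer (simp add: tensor_rel_refl pm_scale_pm_scale)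
  show "1 *\<^sub>R a = a" by transfer (simp add: tensor_rel_refl pm_scale_one)
qed

end

text \<open>The canonical map \<open>x \<mapsto> x \<otimes> 1\<close>, and the real-linear extension of an additive map.\<close>

lift_definition tensor_one :: "'l::ab_group_add \<Rightarrow> 'l real_tensor"
  is "\<lambda>x. Poly_Mapping.single x 1" .

definition real_extension :: "('l::ab_group_add \<Rightarrow> complex) \<Rightarrow> 'l real_tensor \<Rightarrow> complex" where
  "real_extension Z = (THE L. linear L \<and> (\<forall>x. L (tensor_one x) = Z x))"

definition is_quadratic_form :: "('v::real_vector \<Rightarrow> real) \<Rightarrow> bool" where
  "is_quadratic_form Q \<longleftrightarrow>
     (\<exists>b. (\<forall>v. linear (b v)) \<and> (\<forall>w. linear (\<lambda>v. b v w)) \<and> (\<forall>v w. b v w = b w v) \<and>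
          (\<forall>v. Q v = b v v))"


section \<open>Slicings and stability conditions\<close>

text \<open>Subcategories are strictly full, that is, closed under isomorphism; in particular
  they are given by their objects.\<close>

definition additive_subcategory :: "('o, 'm::ab_group_add, 'k) tricat \<Rightarrow> 'o set \<Rightarrow> bool" where
  "additive_subcategory C S \<longleftrightarrow>
     (\<forall>X. is_zero_obj C X \<longrightarrow> X \<in> S) \<and>
     (\<forall>X Y. X \<in> S \<longrightarrow> isomorphic C X Y \<longrightarrow> Y \<in> S) \<and>
     (\<forall>X Y B. X \<in> S \<longrightarrow> Y \<in> S \<longrightarrow> is_biproduct C X Y B \<longrightarrow> B \<in> S)"

text \<open>A filtration \<open>0 = X 0 \<rightarrow> X 1 \<rightarrow> \<dots> \<rightarrow> X m = E\<close> whose \<open>i\<close>-th factor \<open>A i\<close>, the cone of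
  \<open>X i \<rightarrow> X (i + 1)\<close>, has phase \<open>t i\<close> for \<open>i < m\<close>: factors are indexed from 0, not from 1.\<close>

definition HN_filtration ::
  "('o, 'm::ab_group_add, 'k) tricat \<Rightarrow> (real \<Rightarrow> 'o set) \<Rightarrow> 'o \<Rightarrow> nat \<Rightarrow> (nat \<Rightarrow> real) \<Rightarrow> bool" where
  "HN_filtration C P E m t \<longleftrightarrow>
     0 < m \<and> (\<forall>i j. i < j \<longrightarrow> j < m \<longrightarrow> t j < t i) \<and>
     (\<exists>X A. is_zero_obj C (X 0) \<and> X m = E \<and>
        (\<forall>i<m. A i \<in> P (t i) \<and> \<not> is_zero_obj C (A i) \<and>
               (\<exists>f g h. dtri C (X i) (X (Suc i)) (A i) f g h)))"

text \<open>As the shift is an equivalence, \<open>P(\<theta>)[1]\<close> is read as an essential image.\<close>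

definition is_slicing :: "('o, 'm::ab_group_add, 'k) tricat \<Rightarrow> (real \<Rightarrow> 'o set) \<Rightarrow> bool" where
  "is_slicing C P \<longleftrightarrow>
     (\<forall>\<theta>. additive_subcategory C (P \<theta>)) \<and>
     (\<forall>\<theta>. {E. \<exists>F \<in> P \<theta>. isomorphic C E (sh C F)} = P (\<theta> + 1)) \<and>
     (\<forall>\<theta>1 \<theta>2 F1 F2. \<theta>1 > \<theta>2 \<longrightarrow> F1 \<in> P \<theta>1 \<longrightarrow> F2 \<in> P \<theta>2 \<longrightarrow> Hom C F1 F2 = {0}) \<and>
     (\<forall>E. \<not> is_zero_obj C E \<longrightarrow> (\<exists>m t. HN_filtration C P E m t))"

text \<open>Harder--Narasimhan filtrations are unique up to isomorphism, so the phases below are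
  well defined.\<close>

definition phi_plus :: "('o, 'm::ab_group_add, 'k) tricat \<Rightarrow> (real \<Rightarrow> 'o set) \<Rightarrow> 'o \<Rightarrow> real" where
  "phi_plus C P E = (THE \<phi>. \<exists>m t. HN_filtration C P E m t \<and> \<phi> = t 0)"

definition phi_minus :: "('o, 'm::ab_group_add, 'k) tricat \<Rightarrow> (real \<Rightarrow> 'o set) \<Rightarrow> 'o \<Rightarrow> real" where
  "phi_minus C P E = (THE \<phi>. \<exists>m t. HN_filtration C P E m t \<and> \<phi> = t (m - 1))"

definition slicing_dist ::
  "('o, 'm::ab_group_add, 'k) tricat \<Rightarrow> (real \<Rightarrow> 'o set) \<Rightarrow> (real \<Rightarrow> 'o set) \<Rightarrow> ennreal" where
  "slicing_dist C P P' =
     (SUP E \<in> {E. \<not> is_zero_obj C E}.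
        max (ennreal \<bar>phi_plus C P E - phi_plus C P' E\<bar>)
            (ennreal \<bar>phi_minus C P E - phi_minus C P' E\<bar>))"

type_synonym ('o, 'l) prestab = "(real \<Rightarrow> 'o set) \<times> ('l \<Rightarrow> complex)"

definition support_property ::
  "('o, 'm::ab_group_add, 'k) tricat \<Rightarrow> (('o \<Rightarrow>\<^sub>0 int) set \<Rightarrow> 'l::ab_group_add) \<Rightarrow>
     ('o, 'l) prestab \<Rightarrow> bool" where
  "support_property C lam \<sigma> \<longleftrightarrow>
     (\<exists>Q :: 'l real_tensor \<Rightarrow> real. is_quadratic_form Q \<and>
        (\<forall>v. real_extension (snd \<sigma>) v = 0 \<longrightarrow> v \<noteq> 0 \<longrightarrow> Q v < 0) \<and>
        (\<forall>\<theta>. \<forall>E \<in> fst \<sigma> \<theta>. \<not> is_zero_obj C E \<longrightarrow> 0 \<le> Q (tensor_one (lam (K_class C E)))))"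

definition Stab ::
  "('o, 'm::ab_group_add, 'k) tricat \<Rightarrow> (('o \<Rightarrow>\<^sub>0 int) set \<Rightarrow> 'l::ab_group_add) \<Rightarrow>
     ('o, 'l) prestab set" where
  "Stab C lam = {\<sigma>. is_slicing C (fst \<sigma>) \<and> snd \<sigma> \<in> Hom_Z \<and>
     (\<forall>\<theta>. \<forall>E \<in> fst \<sigma> \<theta>. \<not> is_zero_obj C E \<longrightarrow>
        (\<exists>r>0. snd \<sigma> (lam (K_class C E)) = of_real r * exp (\<i> * of_real (pi * \<theta>)))) \<and>
     support_property C lam \<sigma>}"

definition stab_dist ::
  "('o, 'm::ab_group_add, 'k) tricat \<Rightarrow> (('l::ab_group_add \<Rightarrow> complex) \<Rightarrow> real) \<Rightarrow>
     ('o, 'l) prestab \<Rightarrow> ('o, 'l) prestab \<Rightarrow> ennreal" where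
  "stab_dist C N \<sigma> \<tau> =
     max (slicing_dist C (fst \<sigma>) (fst \<tau>)) (ennreal (N (\<lambda>x. snd \<sigma> x - snd \<tau> x)))"

definition Stab_topology ::
  "('o, 'm::ab_group_add, 'k) tricat \<Rightarrow> (('o \<Rightarrow>\<^sub>0 int) set \<Rightarrow> 'l::ab_group_add) \<Rightarrow>
     (('l \<Rightarrow> complex) \<Rightarrow> real) \<Rightarrow> ('o, 'l) prestab topology" where
  "Stab_topology C lam N = topology (\<lambda>U. U \<subseteq> Stab C lam \<and>
     (\<forall>\<sigma>\<in>U. \<exists>e>0. \<forall>\<tau>\<in>Stab C lam. stab_dist C N \<sigma> \<tau> < e \<longrightarrow> \<tau> \<in> U))"

lemma openin_Stab_topology:
  "openin (Stab_topology C lam N) U \<longleftrightarrow> U \<subseteq> Stab C lam \<and>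
     (\<forall>\<sigma>\<in>U. \<exists>e>0. \<forall>\<tau>\<in>Stab C lam. stab_dist C N \<sigma> \<tau> < e \<longrightarrow> \<tau> \<in> U)"
proof -
  have "istopology (\<lambda>U. U \<subseteq> Stab C lam \<and>
     (\<forall>\<sigma>\<in>U. \<exists>e>0. \<forall>\<tau>\<in>Stab C lam. stab_dist C N \<sigma> \<tau> < e \<longrightarrow> \<tau> \<in> U))"
    unfolding istopology_def
  proof (intro conjI allI impI ballI)
    fix S T \<sigma>
    assume S: "S \<subseteq> Stab C lam \<and>
        (\<forall>\<sigma>\<in>S. \<exists>e>0. \<forall>\<tau>\<in>Stab C lam. stab_dist C N \<sigma> \<tau> < e \<longrightarrow> \<tau> \<in> S)"
      and T: "T \<subseteq> Stab C lam \<and>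
        (\<forall>\<sigma>\<in>T. \<exists>e>0. \<forall>\<tau>\<in>Stab C lam. stab_dist C N \<sigma> \<tau> < e \<longrightarrow> \<tau> \<in> T)"
    show "S \<inter> T \<subseteq> Stab C lam" using S by blast
    assume "\<sigma> \<in> S \<inter> T"
    then obtain d e where "d > 0" "\<forall>\<tau>\<in>Stab C lam. stab_dist C N \<sigma> \<tau> < d \<longrightarrow> \<tau> \<in> S"
      and "e > 0" "\<forall>\<tau>\<in>Stab C lam. stab_dist C N \<sigma> \<tau> < e \<longrightarrow> \<tau> \<in> T"
      using S T by (elim IntE conjE) meson
    then show "\<exists>e>0. \<forall>\<tau>\<in>Stab C lam. stab_dist C N \<sigma> \<tau> < e \<longrightarrow> \<tau> \<in> S \<inter> T"
      by (intro exI[of _ "min d e"]) auto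
  next
    fix \<K> \<sigma>
    assume K: "\<forall>K\<in>\<K>. K \<subseteq> Stab C lam \<and>
        (\<forall>\<sigma>\<in>K. \<exists>e>0. \<forall>\<tau>\<in>Stab C lam. stab_dist C N \<sigma> \<tau> < e \<longrightarrow> \<tau> \<in> K)"
    then show "\<Union>\<K> \<subseteq> Stab C lam" by blast
    assume "\<sigma> \<in> \<Union>\<K>"
    then obtain K where "K \<in> \<K>" "\<sigma> \<in> K" by blast
    moreover from this K obtain e where "e > 0"
        "\<forall>\<tau>\<in>Stab C lam. stab_dist C N \<sigma> \<tau> < e \<longrightarrow> \<tau> \<in> K"
      by meson
    ultimately show "\<exists>e>0. \<forall>\<tau>\<in>Stab C lam. stab_dist C N \<sigma> \<tau> < e \<longrightarrow> \<tau> \<in> \<Union>\<K>"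
      by blast
  qed
  then show ?thesis
    by (simp add: Stab_topology_def)
qed


section \<open>The quotient \<open>Sb\<close> and the forgetful map\<close>

definition stab_equiv ::
  "('o, 'm::ab_group_add, 'k) tricat \<Rightarrow> (('o \<Rightarrow>\<^sub>0 int) set \<Rightarrow> 'l::ab_group_add) \<Rightarrow>
     (('o, 'l) prestab \<times> ('o, 'l) prestab) set" where
  "stab_equiv C lam = {(\<sigma>, \<tau>). \<sigma> \<in> Stab C lam \<and> \<tau> \<in> Stab C lam \<and>
     (\<forall>x. Im (snd \<sigma> x) = Im (snd \<tau> x)) \<and> slicing_dist C (fst \<sigma>) (fst \<tau>) < 1}"

definition quotient_topology :: "'a topology \<Rightarrow> ('a \<Rightarrow> 'b) \<Rightarrow> 'b topology" where
  "quotient_topology X q =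
     topology (\<lambda>V. V \<subseteq> q ` topspace X \<and> openin X {x \<in> topspace X. q x \<in> V})"

lemma openin_quotient_topology:
  "openin (quotient_topology X q) V \<longleftrightarrow>
     V \<subseteq> q ` topspace X \<and> openin X {x \<in> topspace X. q x \<in> V}"
proof -
  have "istopology (\<lambda>V. V \<subseteq> q ` topspace X \<and> openin X {x \<in> topspace X. q x \<in> V})"
    unfolding istopology_def
  proof (intro conjI allI impI)
    fix S T
    assume S: "S \<subseteq> q ` topspace X \<and> openin X {x \<in> topspace X. q x \<in> S}"
      and T: "T \<subseteq> q ` topspace X \<and> openin X {x \<in> topspace X. q x \<in> T}"
    show "S \<inter> T \<subseteq> q ` topspace X" using S by blast
    have "{x \<in> topspace X. q x \<in> S \<inter> T} =
        {x \<in> topspace X. q x \<in> S} \<inter> {x \<in> topspace X. q x \<in> T}" by blast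
    with S T show "openin X {x \<in> topspace X. q x \<in> S \<inter> T}" by auto
  next
    fix \<K>
    assume K: "\<forall>K\<in>\<K>. K \<subseteq> q ` topspace X \<and> openin X {x \<in> topspace X. q x \<in> K}"
    then show "\<Union>\<K> \<subseteq> q ` topspace X" by blast
    have "{x \<in> topspace X. q x \<in> \<Union>\<K>} = (\<Union>K\<in>\<K>. {x \<in> topspace X. q x \<in> K})" by blast
    with K show "openin X {x \<in> topspace X. q x \<in> \<Union>\<K>}" by auto
  qed
  then show ?thesis by (simp add: quotient_topology_def)
qed

lemma topspace_quotient_topology: "topspace (quotient_topology X q) = q ` topspace X"
proof
  show "topspace (quotient_topology X q) \<subseteq> q ` topspace X"
    using openin_topspace[of "quotient_topology X q"] unfolding openin_quotient_topology ..
  have "{x \<in> topspace X. q x \<in> q ` topspace X} = topspace X" by blast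
  then have "openin (quotient_topology X q) (q ` topspace X)"
    by (simp add: openin_quotient_topology)
  then show "q ` topspace X \<subseteq> topspace (quotient_topology X q)"
    by (rule openin_subset)
qed

lemma quotient_map_quotient_topology: "quotient_map X (quotient_topology X q) q"
  by (simp add: quotient_map_def topspace_quotient_topology openin_quotient_topology)

definition Sb_topology ::
  "('o, 'm::ab_group_add, 'k) tricat \<Rightarrow> (('o \<Rightarrow>\<^sub>0 int) set \<Rightarrow> 'l::ab_group_add) \<Rightarrow>
     (('l \<Rightarrow> complex) \<Rightarrow> real) \<Rightarrow> ('o, 'l) prestab set topology" where
  "Sb_topology C lam N =
     quotient_topology (Stab_topology C lam N) (\<lambda>\<sigma>. stab_equiv C lam `` {\<sigma>})"

lemma topspace_Stab_topology: "topspace (Stab_topology C lam N) = Stab C lam"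
proof
  show "topspace (Stab_topology C lam N) \<subseteq> Stab C lam"
    using openin_topspace[of "Stab_topology C lam N"] unfolding openin_Stab_topology ..
  have "openin (Stab_topology C lam N) (Stab C lam)"
    unfolding openin_Stab_topology by (auto intro: exI[of _ 1])
  then show "Stab C lam \<subseteq> topspace (Stab_topology C lam N)"
    by (rule openin_subset)
qed

lemma topspace_Sb_topology: "topspace (Sb_topology C lam N) = Stab C lam // stab_equiv C lam"
  unfolding Sb_topology_def topspace_quotient_topology topspace_Stab_topology quotient_def
  by blast

text \<open>The value of \<open>Forg\<close> at a class is the common imaginary part of its representatives.\<close>

definition Forg :: "('o, 'l) prestab set \<Rightarrow> 'l \<Rightarrow> real" where
  "Forg c = the_elem ((\<lambda>\<sigma> x. Im (snd \<sigma> x)) ` c)"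

definition local_homeomorphism :: "'a topology \<Rightarrow> 'b topology \<Rightarrow> ('a \<Rightarrow> 'b) \<Rightarrow> bool" where
  "local_homeomorphism X Y f \<longleftrightarrow>
     (\<forall>x \<in> topspace X. \<exists>U. x \<in> U \<and> openin X U \<and> openin Y (f ` U) \<and>
        homeomorphic_map (subtopology X U) (subtopology Y (f ` U)) f)"

end

theory Submission
  imports Defs
begin

text \<open>
  Composed with the projection from \<open>Stab\<close> to \<open>Sb\<close>, the forgetful map sends a stability condition
  \<open>\<sigma> = (P, Z)\<close> to the imaginary part of \<open>Z\<close>.  It is therefore continuous.  It is injective near every
  class: two stability conditions in a ball of radius \<open>1/2\<close> have slicings of distance less than 1,
  so they are equivalent as soon as the imaginary parts of their central charges agree.  What remains
  is that the map is open and that the image of a ball is open in \<open>Sb\<close>.  Both follow from a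
  deformation statement (\<open>deform_imaginary_part\<close>): every homomorphism close to \<open>Im Z\<close> is the
  imaginary part of the central charge of a stability condition close to \<open>\<sigma>\<close>.

  The deformed charge \<open>W\<close> may be taken with the same real part as \<open>Z\<close>, and then the usual deformation
  argument simplifies.  After a rotation by a right angle \<open>W\<close> and \<open>Z\<close> have the same imaginary part,
  so both take values in the upper half plane on one and the same heart \<open>P((b, b + 1])\<close>, and only
  filtrations inside this heart have to be found.  On objects whose charges lie in one quadrant the
  support property bounds the size of the class linearly by the charge; this leaves
  only finitely many classes of subobjects with bounded real part of \<open>W\<close> (\<open>finite_sub_classes\<close>).
  Hence each object has a quotient of minimal \<open>W\<close>-phase that is maximal among those, and splitting it
  off repeatedly produces the Harder--Narasimhan filtration (\<open>heart_HN\<close>).  The first and last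
  \<open>P\<close>-factor of a \<open>W\<close>-semistable object have almost the same direction under \<open>Z\<close> and under \<open>W\<close>, so all
  its \<open>P\<close>-phases are close to its \<open>W\<close>-phase (\<open>semistable_close\<close>).  This bounds the distance of the
  two slicings and carries the support property over to \<open>W\<close>.

  That \<open>\<sim>\<close> is transitive needs an argument too (\<open>slicing_dist_less_1_trans\<close>).  Equivalent stability
  conditions have the same truncations at integers, since the sign of \<open>Im Z\<close> separates the
  strips between integers.  So the distance of two conditions linked by a third is at most 1, and
  it could only reach 1 through objects that have extreme phases in a unit strip for the outer
  conditions, while their phases for the middle one stay away from the integers.  For such
  objects the support property of the middle condition bounds the class, hence the real part of the
  charge, by the common imaginary part; this excludes extreme phases (\<open>no_extreme_object\<close>).

  A short exact sequence of a heart is a distinguished triangle with all three terms in the heart,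
  and the operations on subobjects (preimage, image) are instances of the octahedral axiom.
\<close>

section \<open>Distinguished triangles up to the choice of maps\<close>

text \<open>
  Below it almost always suffices that three objects fit into some distinguished triangle.
\<close>

definition tri :: "('o, 'm, 'k) tricat \<Rightarrow> 'o \<Rightarrow> 'o \<Rightarrow> 'o \<Rightarrow> bool" where
  "tri C X Y Z \<longleftrightarrow> (\<exists>f g h. dtri C X Y Z f g h)"

context linear_category
begin

lemma module_scale: "module (scale C)"
proof -
  interpret vector_space "scale C" by (rule vector_space_scale)
  show ?thesis by (rule module_axioms)
qed

lemma Hom_zero [simp]: "0 \<in> Hom C X Y"
  using module.subspace_0[OF module_scale subspace_Hom] .

lemma Hom_uminus: "f \<in> Hom C X Y \<Longrightarrow> - f \<in> Hom C X Y"
  using module.subspace_neg[OF module_scale subspace_Hom] .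

lemma Hom_uminus_iff [simp]: "- f \<in> Hom C X Y \<longleftrightarrow> f \<in> Hom C X Y"
  using Hom_uminus[of f] Hom_uminus[of "- f"] by auto

lemma Hom_diff: "f \<in> Hom C X Y \<Longrightarrow> g \<in> Hom C X Y \<Longrightarrow> f - g \<in> Hom C X Y"
  using module.subspace_diff[OF module_scale subspace_Hom] .

lemma comp_zero_right [simp]: assumes "g \<in> Hom C Y Z" shows "Comp C g 0 = 0"
  using comp_add_right[of 0 Y Y 0 g Z] assms by simp

lemma comp_zero_left [simp]: assumes "f \<in> Hom C X Y" shows "Comp C 0 f = 0"
  using comp_add_left[of f X Y 0 Y 0] assms by simp

lemma comp_uminus_right:
  assumes "f \<in> Hom C X Y" "g \<in> Hom C Y Z" shows "Comp C g (- f) = - Comp C g f"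
  using comp_add_right[of f X Y "- f" g Z] assms by (simp add: eq_neg_iff_add_eq_0 add.commute)

lemma comp_uminus_left:
  assumes "f \<in> Hom C X Y" "g \<in> Hom C Y Z" shows "Comp C (- g) f = - Comp C g f"
  using comp_add_left[of f X Y g Z "- g"] assms by (simp add: eq_neg_iff_add_eq_0 add.commute)

lemma comp_diff_right:
  assumes "f \<in> Hom C X Y" "f' \<in> Hom C X Y" "g \<in> Hom C Y Z"
  shows "Comp C g (f - f') = Comp C g f - Comp C g f'"
  using comp_add_right[of f X Y "- f'" g Z] assms by (simp add: comp_uminus_right)

lemma comp_diff_left:
  assumes "f \<in> Hom C X Y" "g \<in> Hom C Y Z" "g' \<in> Hom C Y Z"
  shows "Comp C (g - g') f = Comp C g f - Comp C g' f"
  using comp_add_left[of f X Y g Z "- g'"] assms by (simp add: comp_uminus_left)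

lemma is_zero_obj_iff_ident: "is_zero_obj C X \<longleftrightarrow> ident C X = 0"
proof
  assume "is_zero_obj C X"
  then show "ident C X = 0" using ident_in_Hom[of X] by (auto simp: is_zero_obj_def)
next
  assume i: "ident C X = 0"
  have "f = 0" if "f \<in> Hom C X Y" for f Y using comp_ident_right[OF that] that i by simp
  moreover have "f = 0" if "f \<in> Hom C Y X" for f Y using comp_ident_left[OF that] that i by simp
  ultimately show "is_zero_obj C X" unfolding is_zero_obj_def using Hom_zero by blast
qed

lemma is_zero_obj_iff_Hom: "is_zero_obj C X \<longleftrightarrow> Hom C X X = {0}"
  using is_zero_obj_iff_ident ident_in_Hom[of X] unfolding is_zero_obj_def by auto

lemma is_iso_ident: "is_iso C X X (ident C X)"
  unfolding is_iso_def using ident_in_Hom comp_ident_left by blast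

lemma isomorphic_refl: "isomorphic C X X"
  unfolding isomorphic_def using is_iso_ident by blast

lemma isomorphic_sym: "isomorphic C X Y \<Longrightarrow> isomorphic C Y X"
  unfolding isomorphic_def is_iso_def by blast

lemma isomorphic_Hom_zero_left:
  assumes "isomorphic C X X'" "Hom C X Y = {0}" shows "Hom C X' Y = {0}"
proof -
  obtain a b where ab: "a \<in> Hom C X X'" "b \<in> Hom C X' X" "Comp C a b = ident C X'"
    using assms(1) unfolding isomorphic_def is_iso_def by blast
  have "f = 0" if f: "f \<in> Hom C X' Y" for f
  proof -
    have "f = Comp C (Comp C f a) b" using comp_assoc[OF ab(2,1) f] ab(3) comp_ident_right[OF f] by simp
    moreover have "Comp C f a = 0" using comp_in_Hom[OF ab(1) f] assms(2) by auto
    ultimately show ?thesis using ab by simp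
  qed
  then show ?thesis using Hom_zero by blast
qed

lemma isomorphic_zero:
  assumes "isomorphic C X Y" "is_zero_obj C X" shows "is_zero_obj C Y"
  using isomorphic_Hom_zero_left[OF assms(1), of Y] assms(2)
  by (simp add: is_zero_obj_iff_Hom[of Y]) (simp add: is_zero_obj_def)

end

context triangulated_category
begin

lemma shm_in_Hom: "f \<in> Hom C X Y \<Longrightarrow> shm C f \<in> Hom C (sh C X) (sh C Y)"
  using shm_bij[of X Y] by (auto simp: bij_betw_def)

lemma shm_zero [simp]: "shm C 0 = 0"
  using shm_add[of 0 undefined undefined 0] by simp

lemma shm_inj: "f \<in> Hom C X Y \<Longrightarrow> g \<in> Hom C X Y \<Longrightarrow> shm C f = shm C g \<Longrightarrow> f = g"
  using shm_bij[of X Y] by (auto simp: bij_betw_def inj_on_def)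

lemma shm_surj: "h \<in> Hom C (sh C X) (sh C Y) \<Longrightarrow> \<exists>f\<in>Hom C X Y. h = shm C f"
  using shm_bij[of X Y] by (auto simp: bij_betw_def)

lemma Hom_sh_zero_iff: "Hom C (sh C X) (sh C Y) = {0} \<longleftrightarrow> Hom C X Y = {0}"
proof
  assume "Hom C X Y = {0}"
  then show "Hom C (sh C X) (sh C Y) = {0}" using shm_bij[of X Y] by (auto simp: bij_betw_def)
next
  assume h: "Hom C (sh C X) (sh C Y) = {0}"
  have "f = 0" if "f \<in> Hom C X Y" for f
    using shm_inj[OF that, of 0] shm_in_Hom[OF that] h by auto
  then show "Hom C X Y = {0}" using Hom_zero by blast
qed

lemma is_zero_sh_iff: "is_zero_obj C (sh C X) \<longleftrightarrow> is_zero_obj C X"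
  by (simp add: is_zero_obj_iff_Hom Hom_sh_zero_iff)

lemma dtri_rotate: "dtri C X Y Z f g h \<Longrightarrow> dtri C Y Z (sh C X) g h (- shm C f)"
  using TR2 dist_in_Hom by blast

lemma dtri_comp_zero: assumes d: "dtri C X Y Z f g h" shows "Comp C g f = 0"
proof -
  obtain O' where O: "is_zero_obj C O'" using ex_zero_obj by blast
  have in_Hom: "f \<in> Hom C X Y" using dist_in_Hom[OF d] by blast
  obtain c where c: "c \<in> Hom C O' Z" "Comp C c 0 = Comp C g f"
    using TR3[OF TR1_ident[OF O, of X] d ident_in_Hom in_Hom] by (auto simp: in_Hom)
  then show ?thesis by simp
qed

text \<open>
  Exactness of \<open>Hom(W, _)\<close> at the middle term: TR3 compares the rotated trivial triangle of \<open>W\<close>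
  with the rotated given one, and fullness of the shift undoes the rotation.
\<close>

lemma dtri_factor_left:
  assumes d: "dtri C X Y Z f g h" and u: "u \<in> Hom C W Y" and gu: "Comp C g u = 0"
  shows "\<exists>w \<in> Hom C W X. Comp C f w = u"
proof -
  obtain O' where O: "is_zero_obj C O'" using ex_zero_obj by blast
  note H = dist_in_Hom[OF d]
  have d1: "dtri C W O' (sh C W) 0 0 (- shm C (ident C W))"
    using dtri_rotate[OF TR1_ident[OF O, of W]] .
  obtain c where c: "c \<in> Hom C (sh C W) (sh C X)"
      "Comp C (shm C u) (- shm C (ident C W)) = Comp C (- shm C f) c"
    using TR3[OF d1 dtri_rotate[OF d] u Hom_zero] gu by auto
  obtain w where w: "w \<in> Hom C W X" "c = shm C w" using shm_surj[OF c(1)] by blast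
  have "Comp C (shm C u) (- shm C (ident C W)) = - shm C u"
    using comp_uminus_right[OF shm_in_Hom[OF ident_in_Hom] shm_in_Hom[OF u]]
      shm_comp[OF ident_in_Hom u] comp_ident_right[OF u] by simp
  moreover have "Comp C (- shm C f) c = - shm C (Comp C f w)"
    using comp_uminus_left[OF c(1), of "shm C f" "sh C Y"] H w shm_in_Hom shm_comp[OF w(1), of f Y]
    by simp
  ultimately have "shm C (Comp C f w) = shm C u" using c(2) by simp
  then have "Comp C f w = u" using shm_inj comp_in_Hom[OF w(1)] u H by blast
  then show ?thesis using w by blast
qed

text \<open>
  Exactness of \<open>Hom(_, W)\<close>, by TR3 for the map to the triangle \<open>0 \<rightarrow> W \<rightarrow> W\<close>.
\<close>

lemma dtri_factor_right:
  assumes d: "dtri C X Y Z f g h" and u: "u \<in> Hom C Y W" and uf: "Comp C u f = 0"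
  shows "\<exists>w \<in> Hom C Z W. Comp C w g = u"
proof -
  obtain O' where O: "is_zero_obj C O'" using ex_zero_obj by blast
  have "dtri C W W (sh C O') (ident C W) 0 (- shm C 0)"
    using TR1_ident[of "sh C O'" W] O by (simp add: is_zero_sh_iff)
  then have d1: "dtri C O' W W 0 (ident C W) 0"
    using TR2[of 0 O' W "ident C W" W 0] ident_in_Hom by simp
  have "Comp C u f = Comp C 0 (0::'m)" using uf comp_zero_left[OF Hom_zero] by simp
  then obtain c where "c \<in> Hom C Z W" "Comp C c g = Comp C (ident C W) u"
    using TR3[OF d d1 Hom_zero[of X O'] u] by auto
  then show ?thesis using comp_ident_left[OF u] by auto
qed

lemma tri_middle_Hom_zero_right:
  assumes "tri C X Y Z" "Hom C W X = {0}" "Hom C W Z = {0}" shows "Hom C W Y = {0}"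
proof -
  obtain f g h where d: "dtri C X Y Z f g h" using assms(1) by (auto simp: tri_def)
  note H = dist_in_Hom[OF d]
  have "u = 0" if u: "u \<in> Hom C W Y" for u
  proof -
    have "Comp C g u = 0" using comp_in_Hom[OF u] H assms(3) by blast
    then obtain w where "w \<in> Hom C W X" "Comp C f w = u" using dtri_factor_left[OF d u] by blast
    moreover from this have "w = 0" using assms(2) by simp
    ultimately show ?thesis using H comp_zero_right[of f X Y] by simp
  qed
  then show ?thesis using Hom_zero by blast
qed

lemma tri_middle_Hom_zero_left:
  assumes "tri C X Y Z" "Hom C X W = {0}" "Hom C Z W = {0}" shows "Hom C Y W = {0}"
proof -
  obtain f g h where d: "dtri C X Y Z f g h" using assms(1) by (auto simp: tri_def)
  note H = dist_in_Hom[OF d]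
  have "u = 0" if u: "u \<in> Hom C Y W" for u
  proof -
    have "Comp C u f = 0" using comp_in_Hom[OF _ u] H assms(2) by blast
    then obtain w where "w \<in> Hom C Z W" "Comp C w g = u" using dtri_factor_right[OF d u] by blast
    moreover from this have "w = 0" using assms(3) by simp
    ultimately show ?thesis using H comp_zero_left[of g Y Z] by simp
  qed
  then show ?thesis using Hom_zero by blast
qed

lemma tri_rotate: "tri C X Y Z \<Longrightarrow> tri C Y Z (sh C X)"
  unfolding tri_def using dtri_rotate by blast

text \<open>
  The maps of the new triangle are the old ones conjugated by the isomorphisms.
\<close>

lemma dtri_transport:
  assumes d: "dtri C X Y Z f g h" and "is_iso C X X' a" "is_iso C Y Y' b" "is_iso C Z Z' c"
  shows "tri C X' Y' Z'"
proof -
  note H = dist_in_Hom[OF d]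
  obtain a' where a: "a \<in> Hom C X X'" "a' \<in> Hom C X' X" "Comp C a' a = ident C X"
    using assms(2) unfolding is_iso_def by blast
  obtain b' where b: "b \<in> Hom C Y Y'" "b' \<in> Hom C Y' Y" "Comp C b' b = ident C Y"
    using assms(3) unfolding is_iso_def by blast
  obtain c' where c: "c \<in> Hom C Z Z'" "c' \<in> Hom C Z' Z" "Comp C c' c = ident C Z"
    using assms(4) unfolding is_iso_def by blast
  let ?f = "Comp C b (Comp C f a')" and ?g = "Comp C c (Comp C g b')"
  let ?h = "Comp C (shm C a) (Comp C h c')"
  have f: "?f \<in> Hom C X' Y'" and g: "?g \<in> Hom C Y' Z'" and h: "?h \<in> Hom C Z' (sh C X')"
    using a b c H comp_in_Hom shm_in_Hom by blast+
  have cancel: "Comp C (Comp C r (Comp C s t')) t = Comp C r s"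
    if "t \<in> Hom C U U'" "t' \<in> Hom C U' U" "Comp C t' t = ident C U" "s \<in> Hom C U V" "r \<in> Hom C V V'"
    for r s t t' U U' V V'
  proof -
    have "Comp C (Comp C s t') t = s"
      using comp_assoc[OF that(1,2,4)] that(3) comp_ident_right[OF that(4)] by simp
    then show ?thesis
      using comp_assoc[OF that(1) comp_in_Hom[OF that(2,4)] that(5)] by simp
  qed
  have "dtri C X' Y' Z' ?f ?g ?h"
    using H a b c shm_in_Hom[OF a(1)]
    by (intro TR1_iso[OF d f g h assms(2-4)] cancel[symmetric]) auto
  then show ?thesis unfolding tri_def by blast
qed

lemma tri_isomorphic:
  assumes "tri C X Y Z" "isomorphic C X X'" "isomorphic C Y Y'" "isomorphic C Z Z'"
  shows "tri C X' Y' Z'"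
  using assms dtri_transport unfolding tri_def[of _ X Y Z] isomorphic_def by blast

lemma tri_zero_right: "is_zero_obj C Z \<Longrightarrow> tri C X X Z"
  unfolding tri_def using TR1_ident by blast

lemma tri_zero_left: assumes "is_zero_obj C Z" shows "tri C Z X X"
proof -
  have "dtri C X X (sh C Z) (ident C X) 0 (- shm C 0)"
    using TR1_ident[of "sh C Z" X] assms by (simp add: is_zero_sh_iff)
  then have "dtri C Z X X 0 (ident C X) 0"
    using TR2[of 0 Z X "ident C X" X 0] ident_in_Hom by simp
  then show ?thesis unfolding tri_def by blast
qed

text \<open>
  Exactness first gives a right inverse \<open>s\<close> of \<open>g\<close>; then \<open>s g - 1\<close> is killed by \<open>g\<close>, so it factors
  through \<open>X = 0\<close>.
\<close>

lemma dtri_iso_of_zero_left: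
  assumes d: "dtri C X Y Z f g h" and "is_zero_obj C X" shows "is_iso C Y Z g"
proof -
  note H = dist_in_Hom[OF d]
  have f0: "f = 0" using assms(2) H by (auto simp: is_zero_obj_def)
  have h0: "h = 0" using is_zero_sh_iff[of X] assms(2) H by (auto simp: is_zero_obj_def)
  obtain s where s: "s \<in> Hom C Z Y" "Comp C g s = ident C Z"
    using dtri_factor_left[OF dtri_rotate[OF d] ident_in_Hom] h0 comp_zero_left[OF ident_in_Hom] by auto
  have sg: "Comp C s g \<in> Hom C Y Y" using s H comp_in_Hom by blast
  have "Comp C g (Comp C s g - ident C Y) = 0"
    using comp_diff_right[OF sg ident_in_Hom, of g Z] H s comp_assoc[of g Y Z s Y g Z]
      comp_ident_left[of g Y Z] comp_ident_right[of g Y Z] by simp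
  then obtain w where "w \<in> Hom C Y X" "Comp C f w = Comp C s g - ident C Y"
    using dtri_factor_left[OF d Hom_diff[OF sg ident_in_Hom]] by blast
  then have "Comp C s g = ident C Y" using f0 comp_zero_left by simp
  then show ?thesis unfolding is_iso_def using s H by blast
qed

lemma tri_iso_of_zero_left: "tri C X Y Z \<Longrightarrow> is_zero_obj C X \<Longrightarrow> isomorphic C Y Z"
  unfolding tri_def isomorphic_def using dtri_iso_of_zero_left by blast

lemma dtri_sh_iff:
  assumes "f \<in> Hom C X Y" "g \<in> Hom C Y Z" "h \<in> Hom C Z (sh C X)"
  shows "dtri C X Y Z f g h \<longleftrightarrow>
    dtri C (sh C X) (sh C Y) (sh C Z) (- shm C f) (- shm C g) (- shm C h)"
proof -
  have f: "- shm C f \<in> Hom C (sh C X) (sh C Y)" and g: "- shm C g \<in> Hom C (sh C Y) (sh C Z)"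
    using assms shm_in_Hom by simp_all
  show ?thesis using TR2[OF assms] TR2[OF assms(2,3) f] TR2[OF assms(3) f g] by simp
qed

text \<open>
  Three rotations shift a triangle, changing only signs.  The way back uses that the
  shift is full, since it is merely an autoequivalence.
\<close>

lemma tri_sh_iff: "tri C (sh C X) (sh C Y) (sh C Z) \<longleftrightarrow> tri C X Y Z"
proof
  assume "tri C X Y Z" then show "tri C (sh C X) (sh C Y) (sh C Z)"
    unfolding tri_def using dtri_sh_iff dist_in_Hom by blast
next
  assume "tri C (sh C X) (sh C Y) (sh C Z)"
  then obtain f g h where d: "dtri C (sh C X) (sh C Y) (sh C Z) f g h" by (auto simp: tri_def)
  have pre: "\<exists>f'\<in>Hom C U V. k = - shm C f'" if "k \<in> Hom C (sh C U) (sh C V)" for k U V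
    using shm_surj[of "- k" U V] that by (metis Hom_uminus_iff minus_minus)
  note H = dist_in_Hom[OF d]
  obtain f' g' h' where "f' \<in> Hom C X Y" "g' \<in> Hom C Y Z" "h' \<in> Hom C Z (sh C X)"
    "f = - shm C f'" "g = - shm C g'" "h = - shm C h'"
    using H pre by meson
  then show "tri C X Y Z" using d dtri_sh_iff unfolding tri_def by blast
qed

lemma tri_iso_of_zero_right:
  assumes "tri C X Y Z" "is_zero_obj C Z" shows "isomorphic C X Y"
proof -
  obtain f g h where d: "dtri C X Y Z f g h" using assms(1) by (auto simp: tri_def)
  have "isomorphic C (sh C X) (sh C Y)"
    using tri_iso_of_zero_left[OF tri_rotate[OF tri_rotate[OF assms(1)]] assms(2)] .
  then obtain a b where ab: "a \<in> Hom C (sh C X) (sh C Y)" "b \<in> Hom C (sh C Y) (sh C X)"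
    "Comp C b a = ident C (sh C X)" "Comp C a b = ident C (sh C Y)"
    unfolding isomorphic_def is_iso_def by blast
  obtain a' b' where a': "a' \<in> Hom C X Y" "b' \<in> Hom C Y X" "a = shm C a'" "b = shm C b'"
    using shm_surj ab by meson
  have "shm C (Comp C b' a') = shm C (ident C X)" "shm C (Comp C a' b') = shm C (ident C Y)"
    using ab a' shm_comp shm_ident by metis+
  then have "Comp C b' a' = ident C X" "Comp C a' b' = ident C Y"
    using shm_inj a' comp_in_Hom ident_in_Hom by meson+
  then show ?thesis unfolding isomorphic_def is_iso_def using a' by blast
qed

lemma tri_zero_middle: "tri C X Y Z \<Longrightarrow> is_zero_obj C Y \<Longrightarrow> isomorphic C Z (sh C X)"
  using tri_iso_of_zero_left tri_rotate by blast

text \<open>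
  The cone of \<open>g\<close> is isomorphic to some \<open>X[1]\<close>; once it is replaced by \<open>X[1]\<close>, the triangle can be
  rotated backwards.
\<close>

lemma dtri_fibre:
  assumes g: "g \<in> Hom C Y Z" shows "\<exists>X f h. dtri C X Y Z f g h"
proof -
  obtain T u v where d: "dtri C Y Z T g u v" using TR1_cone[OF g] by blast
  note H = dist_in_Hom[OF d]
  obtain X where "isomorphic C T (sh C X)" using sh_ess_surj by blast
  then obtain a where ia: "is_iso C T (sh C X) a" unfolding isomorphic_def by blast
  then obtain b where ab: "a \<in> Hom C T (sh C X)" "b \<in> Hom C (sh C X) T"
    "Comp C b a = ident C T" "Comp C a b = ident C (sh C X)"
    unfolding is_iso_def by blast
  have au: "Comp C a u \<in> Hom C Z (sh C X)" and vb: "Comp C v b \<in> Hom C (sh C X) (sh C Y)"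
    using ab H comp_in_Hom by blast+
  have v: "Comp C (shm C (ident C Y)) v = Comp C (Comp C v b) a"
    using comp_assoc[OF ab(1,2), of v "sh C Y"] H ab(3) shm_ident[of Y]
      comp_ident_left[of v T "sh C Y"] comp_ident_right[of v T "sh C Y"] by simp
  have "Comp C (ident C Z) g = Comp C g (ident C Y)"
    using g comp_ident_left comp_ident_right by metis
  moreover have "Comp C a u = Comp C (Comp C a u) (ident C Z)"
    using au comp_ident_right by metis
  ultimately have d2: "dtri C Y Z (sh C X) g (Comp C a u) (Comp C v b)"
    using TR1_iso[OF d g au vb is_iso_ident is_iso_ident ia _ _ v] by blast
  obtain f where f: "f \<in> Hom C X Y" "Comp C v b = - shm C f"
    using shm_surj[of "- Comp C v b" X Y] vb by (metis Hom_uminus_iff minus_minus)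
  show ?thesis using d2 TR2[OF f(1) g au] f(2) by auto
qed

text \<open>
  For \<open>X \<subseteq> Y \<subseteq> Z\<close> the quotient \<open>Z/X\<close> is an extension of \<open>Z/Y\<close> by \<open>Y/X\<close>.
\<close>

lemma tri_octahedral:
  assumes "tri C X Y U" "tri C Y Z W" shows "\<exists>V. tri C X Z V \<and> tri C U V W"
proof -
  obtain f a b where f: "dtri C X Y U f a b" using assms(1) by (auto simp: tri_def)
  obtain g c d where g: "dtri C Y Z W g c d" using assms(2) by (auto simp: tri_def)
  have "Comp C g f \<in> Hom C X Z" using dist_in_Hom[OF f] dist_in_Hom[OF g] comp_in_Hom by blast
  then obtain V e h where "dtri C X Z V (Comp C g f) e h" using TR1_cone by blast
  then show ?thesis using TR4[OF f g] unfolding tri_def by blast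
qed

text \<open>
  \<open>Y\<close> is the preimage in \<open>Z\<close> of the subobject \<open>U\<close> of \<open>V = Z/X\<close>.  It is the fibre of the composite
  \<open>Z \<rightarrow> V \<rightarrow> W\<close>, and TR4 for this composite compares the shifts of \<open>X\<close>, \<open>Y\<close> and \<open>U\<close>.
\<close>

lemma tri_octahedral_preimage:
  assumes "tri C X Z V" "tri C U V W" shows "\<exists>Y. tri C X Y U \<and> tri C Y Z W"
proof -
  obtain f g h where f: "dtri C X Z V f g h" using assms(1) by (auto simp: tri_def)
  obtain j k l where k: "dtri C U V W j k l" using assms(2) by (auto simp: tri_def)
  have kg: "Comp C k g \<in> Hom C Z W" using dist_in_Hom[OF f] dist_in_Hom[OF k] comp_in_Hom by blast
  obtain Y y m where y: "dtri C Y Z W y (Comp C k g) m" using dtri_fibre[OF kg] by blast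
  have "tri C (sh C X) (sh C Y) (sh C U)"
    using TR4[OF dtri_rotate[OF f] dtri_rotate[OF k] dtri_rotate[OF y]] unfolding tri_def by blast
  then show ?thesis using tri_sh_iff y unfolding tri_def by blast
qed

text \<open>
  A subobject \<open>F\<close> of \<open>E\<close> that has no maps to \<open>E/E1\<close> lies in \<open>E1\<close>, and \<open>E1/F\<close> lies in \<open>E/F\<close>.
\<close>

lemma tri_octahedral_factor:
  assumes "tri C F E R" "tri C E1 E E2" "Hom C F E2 = {0}"
  shows "\<exists>D. tri C F E1 D \<and> tri C D R E2"
proof -
  obtain f a b where f: "dtri C F E R f a b" using assms(1) by (auto simp: tri_def)
  obtain g c d where g: "dtri C E1 E E2 g c d" using assms(2) by (auto simp: tri_def)
  have "f \<in> Hom C F E" using dist_in_Hom[OF f] by blast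
  moreover from this have "Comp C c f = 0"
    using dist_in_Hom[OF g] assms(3) comp_in_Hom by blast
  ultimately obtain u where u: "u \<in> Hom C F E1" "Comp C g u = f" using dtri_factor_left[OF g] by blast
  obtain D e h where D: "dtri C F E1 D u e h" using TR1_cone[OF u(1)] by blast
  show ?thesis using TR4[OF D g, of R a b] f u(2) D unfolding tri_def by blast
qed

text \<open>
  If \<open>K0\<close> is the cokernel of \<open>f\<close> and \<open>K1\<close> the shift of its kernel, then \<open>I\<close> is the image of \<open>f\<close>.
  If \<open>I = 0\<close>, then \<open>Y \<rightarrow> K \<rightarrow> K0\<close> is an isomorphism, so that \<open>Y \<rightarrow> K\<close> is a split monomorphism;
  it kills \<open>f\<close>.
\<close>

lemma tri_octahedral_image:
  assumes f: "dtri C X Y K f g h" and "tri C K1 K K0"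
  shows "\<exists>I. tri C I Y K0 \<and> tri C X I K1 \<and> (is_zero_obj C I \<longrightarrow> f = 0)"
proof -
  obtain j k l where k: "dtri C K1 K K0 j k l" using assms(2) by (auto simp: tri_def)
  note Hf = dist_in_Hom[OF f] and Hk = dist_in_Hom[OF k]
  have kg: "Comp C k g \<in> Hom C Y K0" using Hf Hk comp_in_Hom by blast
  obtain I i m where i: "dtri C I Y K0 i (Comp C k g) m" using dtri_fibre[OF kg] by blast
  have "tri C (sh C X) (sh C I) (sh C K1)"
    using TR4[OF dtri_rotate[OF f] dtri_rotate[OF k] dtri_rotate[OF i]] unfolding tri_def by blast
  moreover have "f = 0" if "is_zero_obj C I"
  proof -
    have "is_iso C Y K0 (Comp C k g)" using dtri_iso_of_zero_left[OF i that] .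
    then obtain s where s: "s \<in> Hom C K0 Y" "Comp C s (Comp C k g) = ident C Y"
      unfolding is_iso_def by blast
    have "Comp C (Comp C k g) f = 0"
      using comp_assoc[of f X Y g K k K0] Hf Hk dtri_comp_zero[OF f]
        comp_zero_right[of k K K0] by simp
    then have "Comp C (Comp C s (Comp C k g)) f = 0"
      using comp_assoc[of f X Y "Comp C k g" K0 s Y] Hf kg s
        comp_zero_right[of s K0 Y] by simp
    then show ?thesis using s(2) comp_ident_left[of f X Y] Hf by simp
  qed
  ultimately show ?thesis using tri_sh_iff i unfolding tri_def by blast
qed

text \<open>
  The projection to \<open>Y\<close> factors through the cone of the inclusion \<open>i\<close> of \<open>X\<close>; the inclusion of \<open>Y\<close>
  gives the inverse of this factor, because the third map of the triangle vanishes.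
\<close>

lemma tri_of_biproduct:
  assumes "is_biproduct C X Y S" shows "tri C X S Y"
proof -
  obtain i j p q where ij: "i \<in> Hom C X S" "j \<in> Hom C Y S" "p \<in> Hom C S X" "q \<in> Hom C S Y"
    "Comp C p i = ident C X" "Comp C q j = ident C Y" "Comp C p j = 0" "Comp C q i = 0"
    and sum: "Comp C i p + Comp C j q = ident C S"
    using assms unfolding is_biproduct_def by blast
  obtain V c d where d: "dtri C X S V i c d" using TR1_cone[OF ij(1)] by blast
  note H = dist_in_Hom[OF d]
  have cj: "Comp C c j \<in> Hom C Y V" and jq: "Comp C j q \<in> Hom C S S" and ip: "Comp C i p \<in> Hom C S S"
    using H ij comp_in_Hom by blast+
  \<comment> \<open>the third map is killed by the split monomorphism \<open>i[1]\<close>\<close>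
  have "dtri C S V (sh C X) c d (- shm C i)" using dtri_rotate[OF d] .
  then have "Comp C (- shm C i) d = 0" using dtri_rotate dtri_comp_zero by blast
  then have "Comp C (shm C i) d = 0"
    using comp_uminus_left[of d V "sh C X" "shm C i" "sh C S"] H shm_in_Hom[OF ij(1)] by simp
  then have "Comp C (shm C (Comp C p i)) d = 0"
    using comp_assoc[of d V "sh C X" "shm C i" "sh C S" "shm C p" "sh C X"] H ij shm_comp[of i X S p X]
      shm_in_Hom comp_zero_right[of "shm C p" "sh C S" "sh C X"] by simp
  then have d0: "d = 0" using ij H shm_ident comp_ident_left[of d V "sh C X"] by simp
  obtain w where w: "w \<in> Hom C V Y" "Comp C w c = q" using dtri_factor_right[OF d ij(4,8)] by blast
  have wcj: "Comp C w (Comp C c j) = ident C Y"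
    using comp_assoc[of j Y S c V w Y] ij H w by simp
  have cjw: "Comp C (Comp C c j) w \<in> Hom C V V" using cj w comp_in_Hom by blast
  have "Comp C (Comp C (Comp C c j) w) c = Comp C c (Comp C j q)"
    using comp_assoc[of c S V w Y "Comp C c j" V] comp_assoc[of q S Y j S c V] H w ij cj by simp
  also have "Comp C j q = ident C S - Comp C i p" using sum by (simp add: eq_diff_eq add.commute)
  also have "Comp C c (ident C S - Comp C i p) = Comp C c (ident C S) - Comp C (Comp C c i) p"
    using comp_diff_right[OF ident_in_Hom ip, of c V] comp_assoc[of p S X i S c V] H ij by simp
  also have "\<dots> = c" using dtri_comp_zero[OF d] H ij comp_ident_right[of c S V] comp_zero_left[of p S X] by simp
  finally have "Comp C (Comp C (Comp C c j) w - ident C V) c = 0"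
    using comp_diff_left[of c S V _ V "ident C V"] cjw ident_in_Hom H comp_ident_left[of c S V] by simp
  then obtain s where "s \<in> Hom C (sh C X) V" "Comp C s d = Comp C (Comp C c j) w - ident C V"
    using dtri_factor_right[OF dtri_rotate[OF d] Hom_diff[OF cjw ident_in_Hom]] by blast
  then have "Comp C (Comp C c j) w = ident C V" using d0 comp_zero_right[of s "sh C X" V] by simp
  then have "isomorphic C V Y" unfolding isomorphic_def is_iso_def using w cj wcj by blast
  then show ?thesis using tri_isomorphic isomorphic_refl d unfolding tri_def by blast
qed

end

section \<open>Truncation with respect to a slicing\<close>

text \<open>
  Extensions by objects of \<open>S\<close> on the right only, which is the shape of a Harder--Narasimhan
  filtration.
\<close>

inductive_set ext_closure :: "('o, 'm::zero, 'k) tricat \<Rightarrow> 'o set \<Rightarrow> 'o set"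
  for C :: "('o, 'm, 'k) tricat" and S :: "'o set" where
  zero: "is_zero_obj C X \<Longrightarrow> X \<in> ext_closure C S"
| step: "X \<in> ext_closure C S \<Longrightarrow> A \<in> S \<Longrightarrow> tri C X E A \<Longrightarrow> E \<in> ext_closure C S"

lemma ext_closure_mono: assumes "X \<in> ext_closure C S" "S \<subseteq> T" shows "X \<in> ext_closure C T"
  using assms(1) by induction (use assms(2) in \<open>auto intro: ext_closure.intros\<close>)

text \<open>
  A Harder--Narasimhan filtration with its witnesses, where length 0 is allowed: zero
  objects then need no special treatment when filtrations are glued.
\<close>

definition HN_chain ::
  "('o, 'm::ab_group_add, 'k) tricat \<Rightarrow> (real \<Rightarrow> 'o set) \<Rightarrow> 'o \<Rightarrow> nat \<Rightarrow> (nat \<Rightarrow> real)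
    \<Rightarrow> (nat \<Rightarrow> 'o) \<Rightarrow> (nat \<Rightarrow> 'o) \<Rightarrow> bool" where
  "HN_chain C P E m t X A \<longleftrightarrow>
     (\<forall>i j. i < j \<longrightarrow> j < m \<longrightarrow> t j < t i) \<and> is_zero_obj C (X 0) \<and> X m = E \<and>
     (\<forall>i<m. A i \<in> P (t i) \<and> \<not> is_zero_obj C (A i) \<and> tri C (X i) (X (Suc i)) (A i))"

lemma HN_filtration_iff_chain:
  "HN_filtration C P E m t \<longleftrightarrow> 0 < m \<and> (\<exists>X A. HN_chain C P E m t X A)"
  unfolding HN_filtration_def HN_chain_def tri_def by blast

definition HN_in ::
  "('o, 'm::ab_group_add, 'k) tricat \<Rightarrow> (real \<Rightarrow> 'o set) \<Rightarrow> real set \<Rightarrow> 'o \<Rightarrow> bool" where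
  "HN_in C P I E \<longleftrightarrow> (\<exists>m t X A. HN_chain C P E m t X A \<and> (\<forall>i<m. t i \<in> I))"

lemma HN_in_mono: "HN_in C P I E \<Longrightarrow> I \<subseteq> J \<Longrightarrow> HN_in C P J E"
  unfolding HN_in_def by (meson subsetD)

lemma HN_in_zero: "is_zero_obj C E \<Longrightarrow> HN_in C P I E"
  unfolding HN_in_def HN_chain_def
  by (intro exI[of _ 0] exI[of _ "\<lambda>_. E"] exI[of _ "\<lambda>_. 0"]) auto

lemma HN_in_imp_filtration:
  assumes "HN_in C P I E" "\<not> is_zero_obj C E" shows "\<exists>m t. HN_filtration C P E m t"
proof -
  obtain m t X A where "HN_chain C P E m t X A" using assms(1) unfolding HN_in_def by blast
  moreover from this assms(2) have "0 < m" unfolding HN_chain_def by (cases m) auto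
  ultimately show ?thesis unfolding HN_filtration_iff_chain by blast
qed

context triangulated_category
begin

lemma ext_closure_iso:
  assumes "X \<in> ext_closure C S" "isomorphic C X Y" shows "Y \<in> ext_closure C S"
  using assms(1)
proof (cases rule: ext_closure.cases)
  case zero
  then show ?thesis using ext_closure.zero[OF isomorphic_zero[OF assms(2)]] by simp
next
  case (step X' A)
  show ?thesis
    by (rule ext_closure.step[OF step(1,2)
          tri_isomorphic[OF step(3) isomorphic_refl assms(2) isomorphic_refl]])
qed

lemma ext_closure_base: assumes "A \<in> S" shows "A \<in> ext_closure C S"
proof -
  obtain O' where "is_zero_obj C O'" using ex_zero_obj by blast
  then show ?thesis using ext_closure.step[OF ext_closure.zero assms tri_zero_left] by blast
qed

lemma HN_chain_iso:
  assumes "HN_chain C P E m t X A" "isomorphic C E E'"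
  shows "\<exists>X. HN_chain C P E' m t X A"
proof (rule exI)
  show "HN_chain C P E' m t (X(m := E')) A"
    unfolding HN_chain_def
  proof (intro conjI allI impI)
    fix i assume i: "i < m"
    show "tri C ((X(m := E')) i) ((X(m := E')) (Suc i)) (A i)"
    proof (cases "Suc i = m")
      case True
      have "tri C (X i) E (A i)" using assms(1) i True unfolding HN_chain_def by force
      then have "tri C (X i) E' (A i)" using tri_isomorphic isomorphic_refl assms(2) by blast
      then show ?thesis using i True by auto
    next
      case False then show ?thesis using assms(1) i unfolding HN_chain_def by simp
    qed
  qed (use assms isomorphic_zero in \<open>auto simp: HN_chain_def\<close>)
qed

lemma HN_in_iso:
  assumes "HN_in C P I E" "isomorphic C E E'" shows "HN_in C P I E'"
proof -
  obtain m t X A where c: "HN_chain C P E m t X A" "\<forall>i<m. t i \<in> I"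
    using assms(1) unfolding HN_in_def by blast
  show ?thesis using HN_chain_iso[OF c(1) assms(2)] c(2) unfolding HN_in_def by blast
qed

lemma HN_in_append:
  assumes "HN_in C P I E'" "tri C E' E B" "B \<in> P s" "\<not> is_zero_obj C B" "\<And>x. x \<in> I \<Longrightarrow> s < x"
  shows "HN_in C P (insert s I) E"
proof -
  obtain m t X A where c: "HN_chain C P E' m t X A" "\<forall>i<m. t i \<in> I"
    using assms(1) unfolding HN_in_def by blast
  have "HN_chain C P E (Suc m) (t(m := s)) (X(Suc m := E)) (A(m := B))"
    using c assms(2-5) unfolding HN_chain_def by (auto simp: less_Suc_eq)
  moreover have "\<forall>i<Suc m. (t(m := s)) i \<in> insert s I" using c(2) by (auto simp: less_Suc_eq)
  ultimately show ?thesis unfolding HN_in_def by blast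
qed

text \<open>
  The preimages in \<open>E\<close> of the steps of a filtration of \<open>E''\<close> continue a filtration of \<open>E'\<close>.
\<close>

lemma HN_in_glue:
  assumes "HN_in C P I E'" "HN_in C P J E''" "tri C E' E E''" "\<And>x y. x \<in> I \<Longrightarrow> y \<in> J \<Longrightarrow> y < x"
  shows "HN_in C P (I \<union> J) E"
proof -
  obtain m t X A where "HN_chain C P E'' m t X A" "\<forall>i<m. t i \<in> J"
    using assms(2) unfolding HN_in_def by blast
  then show ?thesis using assms(3,4)
  proof (induction m arbitrary: E'' E J)
    case 0
    then have "isomorphic C E' E" using tri_iso_of_zero_right unfolding HN_chain_def by blast
    then have "HN_in C P I E" by (rule HN_in_iso[OF assms(1)])
    then show ?case by (rule HN_in_mono) simp
  next
    case (Suc m)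
    have last: "tri C (X m) E'' (A m)" "A m \<in> P (t m)" "\<not> is_zero_obj C (A m)"
      using Suc.prems(1) unfolding HN_chain_def by force+
    obtain E1 where E1: "tri C E' E1 (X m)" "tri C E1 E (A m)"
      using tri_octahedral_preimage[OF Suc.prems(3) last(1)] by blast
    have "HN_chain C P (X m) m t X A" using Suc.prems(1) unfolding HN_chain_def by auto
    moreover have "\<forall>i<m. t i \<in> {x \<in> J. t m < x}"
      using Suc.prems(1,2) unfolding HN_chain_def by auto
    ultimately have "HN_in C P (I \<union> {x \<in> J. t m < x}) E1"
      using Suc.IH[of "X m" "{x \<in> J. t m < x}" E1] E1(1) Suc.prems(4) by blast
    moreover have "t m < x" if "x \<in> I \<union> {x \<in> J. t m < x}" for x
      using that Suc.prems(2,4) by blast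
    ultimately have "HN_in C P (insert (t m) (I \<union> {x \<in> J. t m < x})) E"
      by (rule HN_in_append[of P _ E1 E "A m" "t m", OF _ E1(2) last(2,3)])
    then show ?case by (rule HN_in_mono) (use Suc.prems(2) in auto)
  qed
qed

end

text \<open>
  Upward closed sets of phases treat the cuts \<open>(a, \<infinity>)\<close> and \<open>[a, \<infinity>)\<close> at once.
\<close>

definition up_closed :: "real set \<Rightarrow> bool" where
  "up_closed H \<longleftrightarrow> (\<forall>x\<in>H. \<forall>y\<ge>x. y \<in> H)"

lemma up_closed_simps [simp]: "up_closed {a..}" "up_closed {a<..}"
  by (auto simp: up_closed_def)

lemma Compl_atLeast_real [simp]: "- {a..} = {..<(a::real)}" by auto
lemma Compl_greaterThan_real [simp]: "- {a<..} = {..(a::real)}" by auto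

text \<open>
  The defining properties of a slicing except closure under biproducts.  The latter is a
  consequence (\<open>slicing\<close> below), which saves verifying it for a deformed slicing.
\<close>

locale phase_family = triangulated_category C
  for C :: "('o, 'm::ab_group_add, 'k::field) tricat" +
  fixes P :: "real \<Rightarrow> 'o set"
  assumes P_zero: "is_zero_obj C X \<Longrightarrow> X \<in> P \<theta>"
    and P_iso: "X \<in> P \<theta> \<Longrightarrow> isomorphic C X Y \<Longrightarrow> Y \<in> P \<theta>"
    and P_shift: "{E. \<exists>F \<in> P \<theta>. isomorphic C E (sh C F)} = P (\<theta> + 1)"
    and P_Hom: "\<theta>1 > \<theta>2 \<Longrightarrow> F1 \<in> P \<theta>1 \<Longrightarrow> F2 \<in> P \<theta>2 \<Longrightarrow> Hom C F1 F2 = {0}"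
    and P_HN: "\<not> is_zero_obj C E \<Longrightarrow> \<exists>m t. HN_filtration C P E m t"
begin

text \<open>
  For an interval \<open>I\<close> this is the subcategory \<open>P(I)\<close> of objects with all phases in \<open>I\<close>.
\<close>

definition ph :: "real set \<Rightarrow> 'o set" where
  "ph I = ext_closure C (\<Union>\<theta>\<in>I. P \<theta>)"

lemma ph_mono: "X \<in> ph I \<Longrightarrow> I \<subseteq> J \<Longrightarrow> X \<in> ph J"
  unfolding ph_def by (erule ext_closure_mono) auto

lemma ph_zero: "is_zero_obj C X \<Longrightarrow> X \<in> ph I"
  unfolding ph_def by (rule ext_closure.zero)

lemma ph_iso: "X \<in> ph I \<Longrightarrow> isomorphic C X Y \<Longrightarrow> Y \<in> ph I"
  unfolding ph_def by (rule ext_closure_iso)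

lemma ph_base: "X \<in> P \<theta> \<Longrightarrow> \<theta> \<in> I \<Longrightarrow> X \<in> ph I"
  unfolding ph_def by (rule ext_closure_base) auto

lemma ph_step: "X \<in> ph I \<Longrightarrow> A \<in> P \<theta> \<Longrightarrow> \<theta> \<in> I \<Longrightarrow> tri C X E A \<Longrightarrow> E \<in> ph I"
  unfolding ph_def by (rule ext_closure.step) auto

lemma ph_induct [consumes 1, case_names zero step]:
  assumes "X \<in> ph I" "\<And>X. is_zero_obj C X \<Longrightarrow> R X"
    "\<And>X E A \<theta>. X \<in> ph I \<Longrightarrow> R X \<Longrightarrow> A \<in> P \<theta> \<Longrightarrow> \<theta> \<in> I \<Longrightarrow> tri C X E A \<Longrightarrow> R E"
  shows "R X"
  using assms(1) unfolding ph_def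
  by induction (use assms(2,3) in \<open>auto simp: ph_def\<close>)

lemma ph_Hom_zero:
  assumes X: "X \<in> ph I" and Y: "Y \<in> ph J" and IJ: "\<And>s t. s \<in> I \<Longrightarrow> t \<in> J \<Longrightarrow> t < s"
  shows "Hom C X Y = {0}"
  using X
proof (induction rule: ph_induct)
  case (zero X) then show ?case by (simp add: is_zero_obj_def)
next
  case (step X E A \<theta>)
  have "Hom C A Y = {0}"
    using Y
  proof (induction rule: ph_induct)
    case (zero X) then show ?case by (simp add: is_zero_obj_def)
  next
    case (step X' E' A' \<theta>')
    have "Hom C A A' = {0}"
      using P_Hom[OF IJ \<open>A \<in> P \<theta>\<close> \<open>A' \<in> P \<theta>'\<close>] \<open>\<theta> \<in> I\<close> \<open>\<theta>' \<in> J\<close> by simp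
    with tri_middle_Hom_zero_right[OF \<open>tri C X' E' A'\<close> \<open>Hom C A X' = {0}\<close>] show ?case by simp
  qed
  with tri_middle_Hom_zero_left[OF \<open>tri C X E A\<close> \<open>Hom C X Y = {0}\<close>] show ?case by simp
qed

lemma ph_orth: "up_closed H \<Longrightarrow> X \<in> ph H \<Longrightarrow> Y \<in> ph (- H) \<Longrightarrow> Hom C X Y = {0}"
  by (rule ph_Hom_zero) (auto simp: up_closed_def not_le[symmetric])

lemma ph_sh:
  assumes "X \<in> ph I" "\<And>x. x \<in> I \<Longrightarrow> x + 1 \<in> J" shows "sh C X \<in> ph J"
  using assms(1)
proof (induction rule: ph_induct)
  case (zero X) then show ?case using ph_zero is_zero_sh_iff by simp
next
  case (step X E A \<theta>)
  have "sh C A \<in> P (\<theta> + 1)" using \<open>A \<in> P \<theta>\<close> P_shift isomorphic_refl by blast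
  moreover have "tri C (sh C X) (sh C E) (sh C A)" using \<open>tri C X E A\<close> tri_sh_iff by simp
  ultimately show ?case using ph_step[OF \<open>sh C X \<in> ph J\<close>] \<open>\<theta> \<in> I\<close> assms(2) by simp
qed

lemma ph_sh_up: assumes "up_closed H" "X \<in> ph H" shows "sh C X \<in> ph H"
  using assms by (auto intro!: ph_sh[OF assms(2)] simp: up_closed_def)

lemma HN_chain_ph:
  assumes "HN_chain C P E m t X A" "k \<le> m" shows "X k \<in> ph (t ` {..<k})"
  using assms(2)
proof (induction k)
  case 0 then show ?case using assms(1) ph_zero unfolding HN_chain_def by simp
next
  case (Suc k)
  then have "X k \<in> ph (t ` {..<Suc k})" by (auto intro: ph_mono)
  then show ?case using assms(1) Suc.prems unfolding HN_chain_def
    by (auto intro!: ph_step[of "X k" _ "A k" "t k"])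
qed

lemma HN_chain_quotient_ph:
  assumes "HN_chain C P E m t X A" "k \<le> j" "j \<le> m"
  shows "\<exists>Y \<in> ph (t ` {k..<j}). tri C (X k) (X j) Y"
  using assms(2,3)
proof (induction j rule: dec_induct)
  case base
  obtain O' where "is_zero_obj C O'" using ex_zero_obj by blast
  then show ?case using ph_zero tri_zero_right by blast
next
  case (step j)
  then obtain Y where Y: "Y \<in> ph (t ` {k..<j})" "tri C (X k) (X j) Y" by auto
  have A: "A j \<in> P (t j)" "tri C (X j) (X (Suc j)) (A j)"
    using assms(1) step unfolding HN_chain_def by auto
  obtain V where V: "tri C (X k) (X (Suc j)) V" "tri C Y V (A j)"
    using tri_octahedral[OF Y(2) A(2)] by blast
  have "Y \<in> ph (t ` {k..<Suc j})" using Y(1) by (auto intro: ph_mono)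
  then have "V \<in> ph (t ` {k..<Suc j})" using A(1) V(2) step by (auto intro: ph_step)
  then show ?case using V(1) by blast
qed

text \<open>
  Cut the filtration of \<open>E\<close> before the first phase outside \<open>H\<close>; the quotient is an iterated
  extension of the remaining factors.
\<close>

lemma truncation:
  assumes "up_closed H" shows "\<exists>X Y. tri C X E Y \<and> X \<in> ph H \<and> Y \<in> ph (- H)"
proof (cases "is_zero_obj C E")
  case True then show ?thesis using tri_zero_left ph_zero by blast
next
  case False
  then obtain m t X A where c: "HN_chain C P E m t X A"
    using P_HN HN_filtration_iff_chain by metis
  define k where "k = (LEAST k. k = m \<or> t k \<notin> H)"
  have k: "k = m \<or> t k \<notin> H" unfolding k_def by (rule LeastI) blast
  have below: "t i \<in> H" if "i < k" for i using not_less_Least[of i] that unfolding k_def by blast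
  have km: "k \<le> m" unfolding k_def by (rule Least_le) blast
  have above: "t i \<notin> H" if "k \<le> i" "i < m" for i
  proof (cases "i = k")
    case True then show ?thesis using k that by auto
  next
    case False
    then have "t i < t k" "t k \<notin> H" using c that k unfolding HN_chain_def by auto
    then show ?thesis using assms unfolding up_closed_def by (meson less_imp_le)
  qed
  have "X k \<in> ph H" using HN_chain_ph[OF c km] below by (auto intro: ph_mono)
  moreover obtain Y where Y: "Y \<in> ph (t ` {k..<m})" "tri C (X k) (X m) Y"
    using HN_chain_quotient_ph[OF c km] by blast
  moreover have "Y \<in> ph (- H)" using Y(1) above by (auto intro: ph_mono)
  moreover have "X m = E" using c unfolding HN_chain_def by blast
  ultimately show ?thesis by blast
qed

text \<open>
  The truncation \<open>X \<rightarrow> E \<rightarrow> Y\<close> has \<open>Y = 0\<close>, because \<open>Hom(E, Y)\<close> and \<open>Hom(X[1], Y)\<close> both vanish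
  and hence so does \<open>Hom(Y, Y)\<close>.
\<close>

lemma ph_upI:
  assumes H: "up_closed H" and orth: "\<And>Y. Y \<in> ph (- H) \<Longrightarrow> Hom C E Y = {0}" shows "E \<in> ph H"
proof -
  obtain X Y where XY: "tri C X E Y" "X \<in> ph H" "Y \<in> ph (- H)" using truncation[OF H] by blast
  have "Hom C (sh C X) Y = {0}"
    using ph_orth[OF H ph_sh_up[OF H XY(2)] XY(3)] .
  then have "is_zero_obj C Y"
    unfolding is_zero_obj_iff_Hom
    using tri_middle_Hom_zero_left[OF tri_rotate[OF XY(1)] orth[OF XY(3)]] by simp
  then show ?thesis using ph_iso[OF XY(2) tri_iso_of_zero_right[OF XY(1)]] by simp
qed

text \<open>
  Exactness at \<open>X\<close> would involve \<open>Hom(T, Y[-1])\<close>; this form avoids the inverse shift.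
\<close>

lemma Hom_zero_fibre:
  assumes "tri C X E Y" "Hom C T E = {0}" "Hom C (sh C T) Y = {0}" shows "Hom C T X = {0}"
proof -
  have "tri C Y (sh C X) (sh C E)" using tri_rotate[OF tri_rotate[OF assms(1)]] .
  then have "Hom C (sh C T) (sh C X) = {0}"
    by (rule tri_middle_Hom_zero_right[OF _ assms(3)]) (simp add: Hom_sh_zero_iff assms(2))
  then show ?thesis by (simp add: Hom_sh_zero_iff)
qed

lemma ph_downI:
  assumes H: "up_closed H" and orth: "\<And>X. X \<in> ph H \<Longrightarrow> Hom C X E = {0}" shows "E \<in> ph (- H)"
proof -
  obtain X Y where XY: "tri C X E Y" "X \<in> ph H" "Y \<in> ph (- H)" using truncation[OF H] by blast
  have "Hom C (sh C X) Y = {0}"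
    using ph_orth[OF H ph_sh_up[OF H XY(2)] XY(3)] .
  then have "is_zero_obj C X"
    unfolding is_zero_obj_iff_Hom using Hom_zero_fibre[OF XY(1) orth[OF XY(2)]] by simp
  then show ?thesis using ph_iso[OF XY(3) isomorphic_sym[OF tri_iso_of_zero_left[OF XY(1)]]] by simp
qed

lemma ph_up_ext:
  "up_closed H \<Longrightarrow> tri C X E Y \<Longrightarrow> X \<in> ph H \<Longrightarrow> Y \<in> ph H \<Longrightarrow> E \<in> ph H"
  by (rule ph_upI, assumption, rule tri_middle_Hom_zero_left, assumption) (rule ph_orth; assumption)+

lemma ph_down_ext:
  "up_closed H \<Longrightarrow> tri C X E Y \<Longrightarrow> X \<in> ph (- H) \<Longrightarrow> Y \<in> ph (- H) \<Longrightarrow> E \<in> ph (- H)"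
  by (rule ph_downI, assumption, rule tri_middle_Hom_zero_right, assumption) (rule ph_orth; assumption)+

lemma ph_up_quotient:
  assumes "up_closed H" "tri C X E Y" "E \<in> ph H" "sh C X \<in> ph H" shows "Y \<in> ph H"
  using ph_up_ext[OF assms(1) tri_rotate[OF assms(2)] assms(3,4)] .

text \<open>
  \<open>X\<close> is an extension of \<open>E\<close> by \<open>Y[-1]\<close>, whose phases are those of \<open>Y\<close> lowered by one.
\<close>

lemma ph_down_sub:
  assumes H: "up_closed H" and t: "tri C X E Y" and E: "E \<in> ph (- H)" and Y: "Y \<in> ph J"
    and J: "\<And>y. y \<in> J \<Longrightarrow> y - 1 \<notin> H"
  shows "X \<in> ph (- H)"
proof (rule ph_downI[OF H])
  fix T assume T: "T \<in> ph H"
  have "sh C T \<in> ph ((+) 1 ` H)" by (rule ph_sh[OF T]) auto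
  then have "Hom C (sh C T) Y = {0}"
  proof (rule ph_Hom_zero[OF _ Y])
    fix s y assume "s \<in> (+) 1 ` H" "y \<in> J"
    then have "s - 1 \<in> H" "y - 1 \<notin> H" using J by auto
    then show "y < s" using H unfolding up_closed_def by (meson diff_right_mono not_less)
  qed
  then show "Hom C T X = {0}" using Hom_zero_fibre[OF t ph_orth[OF H T E]] by simp
qed

lemma HN_chain_mono: "HN_chain C P E m t X A \<Longrightarrow> i \<le> j \<Longrightarrow> j < m \<Longrightarrow> t j \<le> t i"
  unfolding HN_chain_def by (cases "i = j") (auto intro: less_imp_le)

text \<open>
  If \<open>E\<close> has all phases outside \<open>H\<close> although \<open>t 0 \<in> H\<close>, there are no nonzero maps from \<open>X 1\<close> to \<open>E\<close>,
  and none from its shift to the quotient \<open>E/X 1\<close>, so \<open>X 1\<close>, which is isomorphic to \<open>A 0\<close>, would be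
  zero.
\<close>

lemma HN_chain_down_iff:
  assumes c: "HN_chain C P E m t X A" and m: "0 < m" and H: "up_closed H"
  shows "E \<in> ph (- H) \<longleftrightarrow> t 0 \<notin> H"
proof
  assume t0: "t 0 \<notin> H"
  have "t i \<notin> H" if "i < m" for i
    using HN_chain_mono[OF c, of 0 i] that t0 H unfolding up_closed_def by auto
  moreover have "E \<in> ph (t ` {..<m})" using HN_chain_ph[OF c, of m] c unfolding HN_chain_def by auto
  ultimately show "E \<in> ph (- H)" by (auto intro: ph_mono)
next
  assume E: "E \<in> ph (- H)"
  show "t 0 \<notin> H"
  proof
    assume t0: "t 0 \<in> H"
    have X1: "X 1 \<in> ph {t 0}" using HN_chain_ph[OF c, of 1] m by (simp add: lessThan_Suc)
    obtain Y where Y: "Y \<in> ph (t ` {1..<m})" "tri C (X 1) (X m) Y"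
      using HN_chain_quotient_ph[OF c, of 1 m] m by auto
    have Xm: "X m = E" using c unfolding HN_chain_def by simp
    have "Hom C (X 1) E = {0}" using ph_orth[OF H ph_mono[OF X1] E] t0 by simp
    moreover have "Hom C (sh C (X 1)) Y = {0}"
    proof (rule ph_Hom_zero[OF ph_sh[OF X1, of "{t 0 + 1}"] Y(1)])
      fix s y assume "s \<in> {t 0 + 1}" "y \<in> t ` {1..<m}"
      then obtain i where "i < m" "s = t 0 + 1" "y = t i" by auto
      then show "y < s" using HN_chain_mono[OF c, of 0 i] by simp
    qed auto
    ultimately have "is_zero_obj C (X 1)"
      using Hom_zero_fibre[OF Y(2)] Xm by (simp add: is_zero_obj_iff_Hom)
    moreover have "tri C (X 0) (X 1) (A 0)" "is_zero_obj C (X 0)" "\<not> is_zero_obj C (A 0)"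
      using c m unfolding HN_chain_def by auto
    ultimately show False using isomorphic_zero[OF tri_iso_of_zero_left] by simp
  qed
qed

text \<open>
  Dually, if \<open>E\<close> has all phases in \<open>H\<close> but the last factor has not, this factor receives no maps
  from \<open>E\<close> and none from the shift of the previous step, so it would be zero.
\<close>

lemma HN_chain_up_iff:
  assumes c: "HN_chain C P E m t X A" and m: "0 < m" and H: "up_closed H"
  shows "E \<in> ph H \<longleftrightarrow> t (m - 1) \<in> H"
proof
  assume t0: "t (m - 1) \<in> H"
  have "t i \<in> H" if "i < m" for i
    using HN_chain_mono[OF c, of i "m - 1"] that t0 H unfolding up_closed_def by auto
  moreover have "E \<in> ph (t ` {..<m})" using HN_chain_ph[OF c, of m] c unfolding HN_chain_def by auto
  ultimately show "E \<in> ph H" by (auto intro: ph_mono)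
next
  assume E: "E \<in> ph H"
  show "t (m - 1) \<in> H"
  proof (rule ccontr)
    assume tm: "t (m - 1) \<notin> H"
    have last: "tri C (X (m - 1)) E (A (m - 1))" "A (m - 1) \<in> P (t (m - 1))" "\<not> is_zero_obj C (A (m - 1))"
      using c m unfolding HN_chain_def by (force dest: spec[of _ "m - 1"])+
    have A: "A (m - 1) \<in> ph {t (m - 1)}" using ph_base last(2) by blast
    have X': "X (m - 1) \<in> ph (t ` {..<m - 1})" using HN_chain_ph[OF c, of "m - 1"] by simp
    have "Hom C E (A (m - 1)) = {0}" using ph_orth[OF H E ph_mono[OF A]] tm by simp
    moreover have "Hom C (sh C (X (m - 1))) (A (m - 1)) = {0}"
    proof (rule ph_Hom_zero[OF ph_sh[OF X', of "(+) 1 ` t ` {..<m - 1}"] A])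
      fix s y assume "s \<in> (+) 1 ` t ` {..<m - 1}" "y \<in> {t (m - 1)}"
      then obtain i where "i < m - 1" "s = 1 + t i" "y = t (m - 1)" by blast
      then show "y < s" using HN_chain_mono[OF c, of i "m - 1"] m by simp
    qed auto
    ultimately have "Hom C (A (m - 1)) (A (m - 1)) = {0}"
      using tri_middle_Hom_zero_left[OF tri_rotate[OF last(1)]] by simp
    then show False using last(3) by (simp add: is_zero_obj_iff_Hom)
  qed
qed

text \<open>
  Membership in the truncations determines the two extreme phases, so they are the same for all
  filtrations of \<open>E\<close>; this is what \<open>phi_plus\<close> and \<open>phi_minus\<close> rely on.
\<close>

lemma obtain_HN_chain:
  assumes "\<not> is_zero_obj C E"
  obtains m t X A where "HN_chain C P E m t X A" "0 < m"
    "phi_plus C P E = t 0" "phi_minus C P E = t (m - 1)"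
proof -
  obtain m t X A where c: "HN_chain C P E m t X A" "0 < m"
    using P_HN[OF assms] HN_filtration_iff_chain by metis
  have u: "t' 0 = t 0 \<and> t' (m' - 1) = t (m - 1)" if "HN_filtration C P E m' t'" for m' t'
  proof -
    obtain X' A' where c': "HN_chain C P E m' t' X' A'" "0 < m'"
      using \<open>HN_filtration C P E m' t'\<close> HN_filtration_iff_chain by metis
    have "t' 0 \<le> s \<longleftrightarrow> t 0 \<le> s" for s
      using HN_chain_down_iff[OF c, of "{s<..}"] HN_chain_down_iff[OF c', of "{s<..}"] by auto
    moreover have "s \<le> t' (m' - 1) \<longleftrightarrow> s \<le> t (m - 1)" for s
      using HN_chain_up_iff[OF c, of "{s..}"] HN_chain_up_iff[OF c', of "{s..}"] by auto
    ultimately show ?thesis by (meson order_antisym order_refl)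
  qed
  have f: "HN_filtration C P E m t" using c HN_filtration_iff_chain by metis
  show thesis
    by (rule that[OF c]; unfold phi_plus_def phi_minus_def; rule the_equality; use f u in blast)
qed

lemma ph_down_iff: "\<not> is_zero_obj C E \<Longrightarrow> up_closed H \<Longrightarrow> E \<in> ph (- H) \<longleftrightarrow> phi_plus C P E \<notin> H"
  using HN_chain_down_iff by (metis obtain_HN_chain)

lemma ph_up_iff: "\<not> is_zero_obj C E \<Longrightarrow> up_closed H \<Longrightarrow> E \<in> ph H \<longleftrightarrow> phi_minus C P E \<in> H"
  using HN_chain_up_iff by (metis obtain_HN_chain)

lemma phi_minus_le_plus: assumes "\<not> is_zero_obj C E" shows "phi_minus C P E \<le> phi_plus C P E"
proof -
  obtain m t X A where c: "HN_chain C P E m t X A" "0 < m"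
    "phi_plus C P E = t 0" "phi_minus C P E = t (m - 1)"
    using obtain_HN_chain[OF assms] .
  then show ?thesis using HN_chain_mono[OF c(1), of 0 "m - 1"] by simp
qed

lemma ph_Int:
  assumes "up_closed H" "up_closed K"
  shows "E \<in> ph (H \<inter> - K) \<longleftrightarrow> E \<in> ph H \<and> E \<in> ph (- K)"
proof (cases "is_zero_obj C E")
  case True then show ?thesis using ph_zero by blast
next
  case False
  show ?thesis
  proof
    assume R: "E \<in> ph H \<and> E \<in> ph (- K)"
    obtain m t X A where c: "HN_chain C P E m t X A" "0 < m"
      "phi_plus C P E = t 0" "phi_minus C P E = t (m - 1)"
      using obtain_HN_chain[OF False] .
    have "t (m - 1) \<in> H" "t 0 \<notin> K"
      using R HN_chain_up_iff[OF c(1,2)] HN_chain_down_iff[OF c(1,2)] assms by auto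
    then have "t i \<in> H \<inter> - K" if "i < m" for i
      using HN_chain_mono[OF c(1), of 0 i] HN_chain_mono[OF c(1), of i "m - 1"] that assms
      unfolding up_closed_def by auto
    moreover have "E \<in> ph (t ` {..<m})"
      using HN_chain_ph[OF c(1), of m] c unfolding HN_chain_def by auto
    ultimately show "E \<in> ph (H \<inter> - K)" by (auto intro: ph_mono)
  qed (auto intro: ph_mono)
qed

lemma ph_interval:
  "E \<in> ph {a<..b} \<longleftrightarrow> E \<in> ph {a<..} \<and> E \<in> ph {..b}"
  "E \<in> ph {a..b} \<longleftrightarrow> E \<in> ph {a..} \<and> E \<in> ph {..b}"
  "E \<in> ph {a<..<b} \<longleftrightarrow> E \<in> ph {a<..} \<and> E \<in> ph {..<b}"
  "E \<in> ph {a..<b} \<longleftrightarrow> E \<in> ph {a..} \<and> E \<in> ph {..<b}"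
proof -
  have *: "{a<..b} = {a<..} \<inter> - {b<..}" "{a..b} = {a..} \<inter> - {b<..}"
    "{a<..<b} = {a<..} \<inter> - {b..}" "{a..<b} = {a..} \<inter> - {b..}" by auto
  show "E \<in> ph {a<..b} \<longleftrightarrow> E \<in> ph {a<..} \<and> E \<in> ph {..b}"
    using ph_Int[of "{a<..}" "{b<..}" E] unfolding * by simp
  show "E \<in> ph {a..b} \<longleftrightarrow> E \<in> ph {a..} \<and> E \<in> ph {..b}"
    using ph_Int[of "{a..}" "{b<..}" E] unfolding * by simp
  show "E \<in> ph {a<..<b} \<longleftrightarrow> E \<in> ph {a<..} \<and> E \<in> ph {..<b}"
    using ph_Int[of "{a<..}" "{b..}" E] unfolding * by simp
  show "E \<in> ph {a..<b} \<longleftrightarrow> E \<in> ph {a..} \<and> E \<in> ph {..<b}"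
    using ph_Int[of "{a..}" "{b..}" E] unfolding * by simp
qed

lemma phi_iff:
  assumes "\<not> is_zero_obj C E"
  shows "E \<in> ph {..a} \<longleftrightarrow> phi_plus C P E \<le> a" "E \<in> ph {..<a} \<longleftrightarrow> phi_plus C P E < a"
    "E \<in> ph {a..} \<longleftrightarrow> a \<le> phi_minus C P E" "E \<in> ph {a<..} \<longleftrightarrow> a < phi_minus C P E"
  using ph_down_iff[OF assms, of "{a<..}"] ph_down_iff[OF assms, of "{a..}"]
    ph_up_iff[OF assms, of "{a<..}"] ph_up_iff[OF assms, of "{a..}"] by auto

text \<open>
  A filtration with equal extreme phases has a single step.
\<close>

lemma ph_singleton: "ph {\<theta>} = P \<theta>"
proof (rule subset_antisym; rule subsetI)
  fix E assume E: "E \<in> ph {\<theta>}"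
  show "E \<in> P \<theta>"
  proof (cases "is_zero_obj C E")
    case False
    obtain m t X A where c: "HN_chain C P E m t X A" "0 < m"
      "phi_plus C P E = t 0" "phi_minus C P E = t (m - 1)"
      using obtain_HN_chain[OF False] .
    have "E \<in> ph {..\<theta>}" "E \<in> ph {\<theta>..}" using E by (auto intro: ph_mono)
    then have t: "t 0 \<le> \<theta>" "\<theta> \<le> t (m - 1)" using phi_iff[OF False] c by auto
    have "m = 1"
    proof (rule ccontr)
      assume "m \<noteq> 1"
      then have "t (m - 1) < t 0" using c(1,2) unfolding HN_chain_def by auto
      then show False using t by simp
    qed
    then have "tri C (X 0) E (A 0)" "is_zero_obj C (X 0)" "A 0 \<in> P (t 0)" "t 0 = \<theta>"
      using c(1) t unfolding HN_chain_def by auto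
    then show ?thesis using P_iso[OF _ isomorphic_sym[OF tri_iso_of_zero_left]] by simp
  qed (rule P_zero)
qed (auto intro: ph_base)

lemma ph_sing_iff: "E \<in> P \<theta> \<longleftrightarrow> E \<in> ph {\<theta>..} \<and> E \<in> ph {..\<theta>}"
  using ph_interval(2)[of E \<theta> \<theta>] ph_singleton by simp

lemma top_factor:
  assumes "\<not> is_zero_obj C E"
  obtains A R where "tri C A E R" "A \<in> P (phi_plus C P E)" "\<not> is_zero_obj C A"
    "R \<in> ph {..<phi_plus C P E}"
proof -
  obtain m t X A where c: "HN_chain C P E m t X A" "0 < m"
    "phi_plus C P E = t 0" "phi_minus C P E = t (m - 1)"
    using obtain_HN_chain[OF assms] .
  obtain Y where Y: "Y \<in> ph (t ` {1..<m})" "tri C (X 1) (X m) Y"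
    using HN_chain_quotient_ph[OF c(1), of 1 m] c by auto
  have X0: "tri C (X 0) (X 1) (A 0)" "is_zero_obj C (X 0)" "\<not> is_zero_obj C (A 0)" "A 0 \<in> P (t 0)"
    and Xm: "X m = E" using c unfolding HN_chain_def by auto
  have iso: "isomorphic C (X 1) (A 0)" using tri_iso_of_zero_left[OF X0(1,2)] .
  have "t i < t 0" if "1 \<le> i" "i < m" for i using c(1) that unfolding HN_chain_def by auto
  then have "Y \<in> ph {..<t 0}" using Y(1) by (auto intro: ph_mono)
  moreover have "X 1 \<in> P (t 0)" "\<not> is_zero_obj C (X 1)"
    using P_iso[OF X0(4) isomorphic_sym[OF iso]] isomorphic_zero[OF iso] X0(3) by auto
  ultimately show thesis using that[of "X 1" Y] Y(2) Xm c(3) by auto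
qed

lemma bottom_factor:
  assumes "\<not> is_zero_obj C E"
  obtains K B where "tri C K E B" "B \<in> P (phi_minus C P E)" "\<not> is_zero_obj C B"
    "K \<in> ph {phi_minus C P E<..}"
proof -
  obtain m t X A where c: "HN_chain C P E m t X A" "0 < m"
    "phi_plus C P E = t 0" "phi_minus C P E = t (m - 1)"
    using obtain_HN_chain[OF assms] .
  have last: "tri C (X (m - 1)) E (A (m - 1))" "A (m - 1) \<in> P (t (m - 1))" "\<not> is_zero_obj C (A (m - 1))"
    using c unfolding HN_chain_def by (force dest: spec[of _ "m - 1"])+
  have "X (m - 1) \<in> ph (t ` {..<m - 1})" using HN_chain_ph[OF c(1), of "m - 1"] by simp
  moreover have "t (m - 1) < t i" if "i < m - 1" for i using c(1,2) that unfolding HN_chain_def by auto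
  ultimately have "X (m - 1) \<in> ph {t (m - 1)<..}" by (auto intro: ph_mono)
  then show thesis using that last c(4) by auto
qed

text \<open>
  \<open>P \<theta>\<close> is closed under extensions, being the intersection of two subcategories defined
  by orthogonality, and a biproduct is an extension.
\<close>

lemma slicing: "is_slicing C P"
proof -
  have "B \<in> P \<theta>" if "X \<in> P \<theta>" "Y \<in> P \<theta>" "is_biproduct C X Y B" for X Y B \<theta>
    using ph_up_ext[of "{\<theta>..}" X B Y] ph_down_ext[of "{\<theta><..}" X B Y] that tri_of_biproduct
    by (simp add: ph_sing_iff)
  then have "additive_subcategory C (P \<theta>)" for \<theta>
    unfolding additive_subcategory_def using P_zero P_iso by blast
  then show ?thesis
    unfolding is_slicing_def using P_shift P_Hom P_HN by blast
qed

end

lemma phase_family_of_slicing: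
  assumes "triangulated_category C" "is_slicing C P" shows "phase_family C P"
proof -
  interpret triangulated_category C by (rule assms(1))
  have additive: "\<And>\<theta>. additive_subcategory C (P \<theta>)"
    and "\<And>\<theta>. {E. \<exists>F \<in> P \<theta>. isomorphic C E (sh C F)} = P (\<theta> + 1)"
    and "\<And>\<theta>1 \<theta>2 F1 F2. \<theta>1 > \<theta>2 \<Longrightarrow> F1 \<in> P \<theta>1 \<Longrightarrow> F2 \<in> P \<theta>2 \<Longrightarrow> Hom C F1 F2 = {0}"
    and "\<And>E. \<not> is_zero_obj C E \<Longrightarrow> \<exists>m t. HN_filtration C P E m t"
    using assms(2) unfolding is_slicing_def by meson+
  moreover have "\<And>X \<theta>. is_zero_obj C X \<Longrightarrow> X \<in> P \<theta>"
    "\<And>X Y \<theta>. X \<in> P \<theta> \<Longrightarrow> isomorphic C X Y \<Longrightarrow> Y \<in> P \<theta>"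
    using additive unfolding additive_subcategory_def by meson+
  ultimately show ?thesis by unfold_locales
qed

section \<open>Arguments in the upper half plane\<close>

text \<open>
  The values with argument in \<open>(0, \<pi>]\<close>, taken by a central charge on the objects of a heart.
\<close>

definition upper :: "complex set" where
  "upper = {u. 0 < Im u \<or> (Im u = 0 \<and> Re u < 0)}"

lemma upper_polar:
  assumes "u \<in> upper" shows "0 < cmod u" "0 < Arg u" "Arg u \<le> pi" "u = of_real (cmod u) * cis (Arg u)"
proof -
  have u0: "u \<noteq> 0" using assms by (auto simp: upper_def)
  then show "0 < cmod u" by simp
  show "u = of_real (cmod u) * cis (Arg u)" using rcis_cmod_Arg[of u] by (simp add: rcis_def)
  show "Arg u \<le> pi" by (rule Arg_le_pi)
  show "0 < Arg u"
  proof (cases "0 < Im u")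
    case True then show ?thesis using Arg_lt_pi[of u] by (simp add: Arg_eq_Im_Ln u0 Im_Ln_pos_lt_imp) 
  next
    case False
    then have "Im u = 0" "Re u < 0" using assms by (auto simp: upper_def)
    then have "Arg u = pi" using Arg_eq_pi_iff[of u] by (simp add: complex_is_Real_iff Arg_eq_pi)
    then show ?thesis by simp
  qed
qed

lemma rcis_upper:
  assumes "0 < r" "0 < t" "t \<le> pi" shows "of_real r * cis t \<in> upper" "Arg (of_real r * cis t) = t"
proof -
  show "Arg (of_real r * cis t) = t" using assms by (intro Arg_unique) (auto simp: cis_conv_exp mult.commute)
  show "of_real r * cis t \<in> upper"
  proof (cases "t = pi")
    case True then show ?thesis using assms by (simp add: upper_def)
  next
    case False then show ?thesis using assms sin_gt_zero[of t] by (simp add: upper_def)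
  qed
qed

lemma sin_diff_pos_iff:
  assumes "0 < s" "s \<le> pi" "0 < t" "t \<le> (pi::real)"
  shows "0 \<le> sin (s - t) \<longleftrightarrow> t \<le> s"
proof
  assume "t \<le> s" then show "0 \<le> sin (s - t)" using assms by (intro sin_ge_zero) auto
next
  assume s: "0 \<le> sin (s - t)"
  show "t \<le> s"
  proof (rule ccontr)
    assume "\<not> t \<le> s"
    then have "0 < sin (t - s)" using assms by (intro sin_gt_zero) auto
    moreover have "sin (t - s) = - sin (s - t)" by (metis minus_diff_eq sin_minus)
    ultimately show False using s by simp
  qed
qed

lemma Im_cis_mult_nonneg_iff:
  assumes "u \<in> upper" "0 < t" "t \<le> pi" shows "0 \<le> Im (cis (- t) * u) \<longleftrightarrow> t \<le> Arg u"
proof -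
  note p = upper_polar[OF assms(1)]
  have "cis (- t) * u = of_real (cmod u) * (cis (- t) * cis (Arg u))"
    by (subst p(4)) (simp only: mult.left_commute)
  then have "Im (cis (- t) * u) = cmod u * sin (Arg u - t)" by (simp add: cis_mult)
  then show ?thesis using sin_diff_pos_iff[of "Arg u" t] p assms by (simp add: zero_le_mult_iff)
qed

lemma Im_cis_mult_nonpos_iff:
  assumes "u \<in> upper" "0 < t" "t \<le> pi" shows "Im (cis (- t) * u) \<le> 0 \<longleftrightarrow> Arg u \<le> t"
proof -
  note p = upper_polar[OF assms(1)]
  have "cis (- t) * u = of_real (cmod u) * (cis (- t) * cis (Arg u))"
    by (subst p(4)) (simp only: mult.left_commute)
  then have "Im (cis (- t) * u) = cmod u * sin (Arg u - t)" by (simp add: cis_mult)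
  moreover have "sin (Arg u - t) = - sin (t - Arg u)" by (metis minus_diff_eq sin_minus)
  ultimately show ?thesis using sin_diff_pos_iff[of t "Arg u"] p assms
    by (simp add: zero_le_mult_iff)
qed

text \<open>
  The left side is a positive multiple of the sine of the difference of the arguments, and this
  difference lies strictly between \<open>-\<pi>\<close> and \<open>\<pi>\<close>.
\<close>

lemma cross_nonneg_iff:
  assumes "u \<in> upper" "u' \<in> upper" shows "0 \<le> Im (u * cnj u') \<longleftrightarrow> Arg u' \<le> Arg u"
proof -
  note p = upper_polar[OF assms(2)]
  have "u * cnj u' = of_real (cmod u') * (cis (- Arg u') * u)"
  proof -
    have "cnj u' = of_real (cmod u') * cis (- Arg u')" by (subst p(4)) (simp add: cis_cnj)
    then show ?thesis by (simp only: mult_ac)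
  qed
  moreover have "Im (of_real r * z) = r * Im z" for r z by simp
  ultimately have "Im (u * cnj u') = cmod u' * Im (cis (- Arg u') * u)" by (simp only:)
  then show ?thesis using Im_cis_mult_nonneg_iff[OF assms(1), of "Arg u'"] p by (simp add: zero_le_mult_iff)
qed

lemma upper_add: "u \<in> upper \<Longrightarrow> u' \<in> upper \<Longrightarrow> u + u' \<in> upper"
  by (auto simp: upper_def)

lemma Arg_add_le_iff:
  assumes "u \<in> upper" "u' \<in> upper"
  shows "Arg u' \<le> Arg (u + u') \<longleftrightarrow> Arg u' \<le> Arg u" "Arg (u + u') \<le> Arg u' \<longleftrightarrow> Arg u \<le> Arg u'"
  using cross_nonneg_iff[OF upper_add[OF assms] assms(2)] cross_nonneg_iff[OF assms]
    cross_nonneg_iff[OF assms(2) upper_add[OF assms]] cross_nonneg_iff[OF assms(2,1)]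
  by (simp_all add: algebra_simps)

lemma not_upper_scale: "u \<in> upper \<Longrightarrow> t \<le> 0 \<Longrightarrow> of_real t * u \<notin> upper"
  by (auto simp: upper_def mult_le_0_iff zero_less_mult_iff mult_less_0_iff)

lemma Re_le_of_Arg_ge:
  assumes u: "u \<in> upper" "u' \<in> upper" and A: "Arg u' \<le> Arg u" and I: "Im u \<le> Im u'"
  shows "Re u \<le> \<bar>Re u'\<bar>"
proof (cases "0 < Im u'")
  case True
  have "0 \<le> Im (u * cnj u')" using cross_nonneg_iff[OF u] A by blast
  then have 1: "Re u * Im u' \<le> Im u * Re u'" by (simp add: mult.commute)
  have "Im u * Re u' \<le> Im u * \<bar>Re u'\<bar>" using u(1) by (intro mult_left_mono) (auto simp: upper_def)
  also have "\<dots> \<le> Im u' * \<bar>Re u'\<bar>" using I by (intro mult_right_mono) auto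
  finally have "Re u * Im u' \<le> \<bar>Re u'\<bar> * Im u'" using 1 by (simp add: mult.commute)
  then show ?thesis using True by simp
next
  case False
  then have "Im u = 0" "Re u < 0" using u I by (auto simp: upper_def)
  then show ?thesis by simp
qed

text \<open>
  The product of \<open>u'\<close> with the conjugate of \<open>u\<close> differs from \<open>|u|\<^sup>2\<close> by at most \<open>k |u|\<^sup>2\<close>.  So the
  angle between \<open>u\<close> and \<open>u'\<close> has positive cosine and a sine of modulus at most \<open>2 k\<close>.
\<close>

lemma Arg_close:
  assumes u: "u \<in> upper" "u' \<in> upper" and d: "cmod (u' - u) \<le> k * cmod u"
    and k: "2 * k \<le> sin (pi * \<eta>)" and \<eta>: "0 < \<eta>" "\<eta> < 1 / 2"
  shows "\<bar>Arg u' - Arg u\<bar> \<le> pi * \<eta>"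
proof -
  note p = upper_polar[OF u(1)] and p' = upper_polar[OF u(2)]
  define t where "t = Arg u' - Arg u"
  have t: "- pi < t" "t < pi" using p p' by (auto simp: t_def)
  have sin1: "sin (pi * \<eta>) \<le> 1" by simp
  have k2: "k \<le> 1 / 2" using k sin1 by linarith
  have e: "u' * cnj u = of_real (cmod u' * cmod u) * cis t"
    by (subst p(4), subst p'(4)) (simp add: cis_cnj cis_mult t_def mult_ac)
  have uu: "u' * cnj u = of_real ((cmod u)\<^sup>2) + (u' - u) * cnj u"
    by (simp add: algebra_simps complex_norm_square del: of_real_power)
  have small: "cmod ((u' - u) * cnj u) \<le> k * (cmod u)\<^sup>2"
    using mult_right_mono[OF d, of "cmod u"] by (simp add: norm_mult power2_eq_square)
  have re: "cmod u' * cmod u * cos t \<ge> (1 - k) * (cmod u)\<^sup>2"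
  proof -
    have "cmod u' * cmod u * cos t = Re (u' * cnj u)" using e by simp
    also have "\<dots> = (cmod u)\<^sup>2 + Re ((u' - u) * cnj u)" by (subst uu) simp
    also have "\<dots> \<ge> (cmod u)\<^sup>2 - k * (cmod u)\<^sup>2" using abs_Re_le_cmod[of "(u' - u) * cnj u"] small by linarith
    finally show ?thesis by (simp add: algebra_simps)
  qed
  have im: "\<bar>cmod u' * cmod u * sin t\<bar> \<le> k * (cmod u)\<^sup>2"
  proof -
    have "cmod u' * cmod u * sin t = Im (u' * cnj u)" using e by simp
    also have "\<dots> = Im ((u' - u) * cnj u)" by (subst uu) simp
    finally show ?thesis using abs_Im_le_cmod[of "(u' - u) * cnj u"] small by linarith
  qed
  have pos: "0 < cmod u' * cmod u" using p p' by simp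
  have "0 < (1 - k) * (cmod u)\<^sup>2" using k2 p by simp
  then have "0 < cmod u' * cmod u * cos t" using re by linarith
  then have "0 < cos t" using pos zero_less_mult_pos by blast
  have tt: "\<bar>t\<bar> < pi / 2"
  proof (rule ccontr)
    assume "\<not> \<bar>t\<bar> < pi / 2"
    then have "cos \<bar>t\<bar> \<le> 0" using t cos_monotone_0_pi_le[of "pi / 2" "\<bar>t\<bar>"] by simp
    then show False using \<open>0 < cos t\<close> by simp
  qed
  have low: "(1 - k) * cmod u \<le> cmod u'"
    using norm_triangle_ineq3[of u' u] d by (simp add: algebra_simps)
  have "\<bar>sin t\<bar> * (cmod u' * cmod u) \<le> k * (cmod u)\<^sup>2" using im pos by (simp add: abs_mult mult_ac)
  moreover have "(cmod u)\<^sup>2 / 2 \<le> cmod u' * cmod u"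
  proof -
    have "cmod u / 2 \<le> cmod u'" using low mult_right_mono[of "1/2" "1 - k" "cmod u"] k2 by simp
    then show ?thesis using mult_right_mono[of "cmod u / 2" "cmod u'" "cmod u"] by (simp add: power2_eq_square)
  qed
  ultimately have "\<bar>sin t\<bar> * ((cmod u)\<^sup>2 / 2) \<le> k * (cmod u)\<^sup>2"
    by (meson abs_ge_zero mult_left_mono order_trans)
  then have "\<bar>sin t\<bar> \<le> 2 * k" using p by (simp add: field_simps)
  then have s: "\<bar>sin t\<bar> \<le> sin (pi * \<eta>)" using k by linarith
  have "sin \<bar>t\<bar> = \<bar>sin t\<bar>" using tt sin_ge_zero[of t] sin_ge_zero[of "- t"] by (auto simp: abs_if)
  then have "sin \<bar>t\<bar> \<le> sin (pi * \<eta>)" using s by simp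
  moreover have "0 \<le> pi * \<eta>" "pi * \<eta> \<le> pi / 2" using \<eta> by simp_all
  ultimately have "\<bar>t\<bar> \<le> pi * \<eta>" using sin_mono_le_eq[of "\<bar>t\<bar>" "pi * \<eta>"] tt by linarith
  then show ?thesis by (simp add: t_def)
qed

text \<open>
  Selects the quotient to be split off: minimal phase first, and then maximal size.
\<close>

lemma lexicographic_minimum:
  assumes "finite D" "D \<noteq> {}"
  shows "\<exists>u\<in>D. \<forall>u'\<in>D. Arg u < Arg u' \<or> (Arg u' = Arg u \<and> cmod u' \<le> cmod u)"
proof -
  define D' where "D' = {u \<in> D. Arg u = Min (Arg ` D)}"
  have "Min (Arg ` D) \<in> Arg ` D" using assms by (intro Min_in) auto
  then obtain x where "x \<in> D" "Arg x = Min (Arg ` D)" by (metis imageE)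
  then have D': "finite D'" "D' \<noteq> {}" using assms(1) unfolding D'_def by (simp, blast)
  then have "Max (cmod ` D') \<in> cmod ` D'" by (intro Max_in) auto
  then obtain u where u: "u \<in> D'" "cmod u = Max (cmod ` D')" by auto
  have "Arg u < Arg u' \<or> (Arg u' = Arg u \<and> cmod u' \<le> cmod u)" if u': "u' \<in> D" for u'
  proof (cases "Arg u' = Arg u")
    case True
    then have "u' \<in> D'" using u u' unfolding D'_def by auto
    then show ?thesis using True u D' by simp
  next
    case False
    moreover have "Arg u \<le> Arg u'" using u(1) u' assms unfolding D'_def by simp
    ultimately show ?thesis by simp
  qed
  then show ?thesis using u(1) unfolding D'_def by blast
qed

section \<open>Hearts and central charges\<close>

text \<open>
  The instance below is the sum of the moduli of the coordinates.  The finiteness of balls is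
  what makes the filtrations for a deformed charge finite.
\<close>

locale lattice_seminorm =
  fixes nrm :: "'l::ab_group_add \<Rightarrow> real"
  assumes nrm_zero [simp]: "nrm 0 = 0"
    and nrm_nonneg: "0 \<le> nrm x"
    and nrm_add: "nrm (x + y) \<le> nrm x + nrm y"
    and nrm_uminus: "nrm (- x) = nrm x"
    and finite_nrm_ball: "finite {x. nrm x \<le> r}"

context phase_family
begin

lemma ph_shiftD_up:
  assumes "up_closed H" "sh C X \<in> ph ((\<lambda>x. x + 1) ` H)" shows "X \<in> ph H"
proof (rule ph_upI[OF assms(1)])
  fix Y assume "Y \<in> ph (- H)"
  then have "sh C Y \<in> ph ((\<lambda>x. x + 1) ` (- H))" by (rule ph_sh) auto
  then have "Hom C (sh C X) (sh C Y) = {0}"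
    using assms(1) by (intro ph_Hom_zero[OF assms(2)]) (auto simp: up_closed_def not_le[symmetric])
  then show "Hom C X Y = {0}" by (simp add: Hom_sh_zero_iff)
qed

lemma ph_shiftD_down:
  assumes "up_closed H" "sh C Y \<in> ph ((\<lambda>x. x + 1) ` (- H))" shows "Y \<in> ph (- H)"
proof (rule ph_downI[OF assms(1)])
  fix X assume "X \<in> ph H"
  then have "sh C X \<in> ph ((\<lambda>x. x + 1) ` H)" by (rule ph_sh) auto
  then have "Hom C (sh C X) (sh C Y) = {0}"
    using assms(1) by (intro ph_Hom_zero[OF _ assms(2)]) (auto simp: up_closed_def not_le[symmetric])
  then show "Hom C X Y = {0}" by (simp add: Hom_sh_zero_iff)
qed

definition heart :: "real \<Rightarrow> 'o set" where "heart b = ph {b<..b + 1}"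

lemma heart_iff: "E \<in> heart b \<longleftrightarrow> E \<in> ph {b<..} \<and> E \<in> ph {..b + 1}"
  unfolding heart_def by (rule ph_interval)

lemma heart_sh_iff: "sh C E \<in> heart (b + 1) \<longleftrightarrow> E \<in> heart b"
proof
  assume "E \<in> heart b"
  then show "sh C E \<in> heart (b + 1)" unfolding heart_def by (rule ph_sh) auto
next
  assume *: "sh C E \<in> heart (b + 1)"
  have "x \<in> (\<lambda>x. x + 1) ` S" if "x - 1 \<in> S" for x and S :: "real set"
    using that by (rule rev_image_eqI) simp
  then have i: "(\<lambda>x. x + 1) ` {b<..} = {b + 1<..}" "(\<lambda>x. x + 1) ` {..b + 1} = {..b + 1 + 1}"
    by auto
  show "E \<in> heart b"
    using ph_shiftD_up[of "{b<..}" E] ph_shiftD_down[of "{b + 1<..}" E] * unfolding heart_iff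
    by (simp add: i)
qed

lemma heart_zero: "is_zero_obj C E \<Longrightarrow> E \<in> heart b"
  unfolding heart_def by (rule ph_zero)

lemma heart_iso: "E \<in> heart b \<Longrightarrow> isomorphic C E E' \<Longrightarrow> E' \<in> heart b"
  unfolding heart_def by (rule ph_iso)

lemma heart_ext: "tri C X E Y \<Longrightarrow> X \<in> heart b \<Longrightarrow> Y \<in> heart b \<Longrightarrow> E \<in> heart b"
  using ph_up_ext[of "{b<..}" X E Y] ph_down_ext[of "{b + 1<..}" X E Y] by (auto simp: heart_iff)

text \<open>
  The exact structure of the heart: \<open>X\<close> is a subobject of \<open>E\<close> with quotient \<open>Y\<close>.
\<close>

definition ses :: "real \<Rightarrow> 'o \<Rightarrow> 'o \<Rightarrow> 'o \<Rightarrow> bool" where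
  "ses b X E Y \<longleftrightarrow> tri C X E Y \<and> X \<in> heart b \<and> Y \<in> heart b"

lemma ses_sub_trans:
  assumes "ses b X Y U" "ses b Y E W" shows "\<exists>V. ses b X E V \<and> ses b U V W"
  using tri_octahedral[of X Y U E W] assms heart_ext unfolding ses_def by blast

lemma ses_quotient_trans:
  assumes "ses b X E V" "ses b U V W" shows "\<exists>Y. ses b X Y U \<and> ses b Y E W"
  using tri_octahedral_preimage[of X E V U W] assms heart_ext unfolding ses_def by blast

lemma ses_sh_iff: "ses (b + 1) (sh C X) (sh C E) (sh C Y) \<longleftrightarrow> ses b X E Y"
  unfolding ses_def by (simp add: tri_sh_iff heart_sh_iff)

lemma ses_iso:
  "ses b X E Y \<Longrightarrow> isomorphic C X X' \<Longrightarrow> isomorphic C E E' \<Longrightarrow> isomorphic C Y Y' \<Longrightarrow> ses b X' E' Y'"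
  unfolding ses_def using tri_isomorphic heart_iso by blast

lemma heart_truncation:
  assumes E: "E \<in> heart b" and s: "b \<le> s" "s \<le> b + 1"
  obtains X Y where "ses b X E Y" "X \<in> ph {s<..b + 1}" "Y \<in> ph {b<..s}"
proof -
  obtain X Y where XY: "tri C X E Y" "X \<in> ph {s<..}" "Y \<in> ph {..s}"
    using truncation[of "{s<..}" E] by auto
  have "X \<in> ph (- {b + 1<..})"
    using ph_down_sub[of "{b + 1<..}" X E Y "{..s}"] XY E s by (auto simp: heart_iff)
  then have X: "X \<in> ph {s<..b + 1}" using XY ph_interval by simp
  have "sh C X \<in> ph {b<..}" using ph_sh[OF X, of "{b<..}"] s by auto
  then have "Y \<in> ph {b<..}" using ph_up_quotient[of "{b<..}" X E Y] XY E by (simp add: heart_iff)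
  then have Y: "Y \<in> ph {b<..s}" using XY ph_interval by simp
  have "X \<in> heart b" "Y \<in> heart b" using X Y s unfolding heart_def by (auto intro: ph_mono)
  then show thesis using that X Y XY unfolding ses_def by blast
qed

lemma heart_top_truncation:
  assumes E: "E \<in> heart b"
  obtains X Y where "ses b X E Y" "X \<in> P (b + 1)" "Y \<in> ph {b<..<b + 1}"
proof -
  obtain X Y where XY: "tri C X E Y" "X \<in> ph {b + 1..}" "Y \<in> ph {..<b + 1}"
    using truncation[of "{b + 1..}" E] by auto
  have "X \<in> ph (- {b + 1<..})"
    using ph_down_sub[of "{b + 1<..}" X E Y "{..<b + 1}"] XY E by (auto simp: heart_iff)
  then have X: "X \<in> P (b + 1)" using XY by (simp add: ph_sing_iff)
  have "sh C X \<in> ph {b<..}" using ph_sh[OF XY(2), of "{b<..}"] by auto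
  then have "Y \<in> ph {b<..}" using ph_up_quotient[of "{b<..}" X E Y] XY E by (simp add: heart_iff)
  then have Y: "Y \<in> ph {b<..<b + 1}" using XY ph_interval by simp
  have "X \<in> heart b" "Y \<in> heart b" using X Y unfolding heart_def by (auto intro: ph_mono ph_base)
  then show thesis using that X Y XY unfolding ses_def by blast
qed

lemma heart_phases:
  assumes "E \<in> heart b" "\<not> is_zero_obj C E"
  shows "b < phi_minus C P E" "phi_plus C P E \<le> b + 1" "b < phi_plus C P E" "phi_minus C P E \<le> b + 1"
  using assms(1) phi_iff[OF assms(2)] phi_minus_le_plus[OF assms(2)] unfolding heart_iff by auto

lemma heart_top_factor:
  assumes E: "E \<in> heart b" "\<not> is_zero_obj C E"
  obtains A R where "ses b A E R" "A \<in> P (phi_plus C P E)" "\<not> is_zero_obj C A"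
proof -
  obtain A R where AR: "tri C A E R" "A \<in> P (phi_plus C P E)" "\<not> is_zero_obj C A"
    "R \<in> ph {..<phi_plus C P E}" using top_factor[OF E(2)] .
  note p = heart_phases[OF E]
  have A: "A \<in> heart b" using ph_base[OF AR(2)] p unfolding heart_def by simp
  have "sh C A \<in> ph {b<..}" using A by (auto simp: heart_def intro: ph_sh)
  then have "R \<in> ph {b<..}" using ph_up_quotient[of "{b<..}" A E R] AR E by (simp add: heart_iff)
  moreover have "R \<in> ph {..b + 1}" by (rule ph_mono[OF AR(4)]) (use p in auto)
  ultimately show thesis using that[of A R] A AR unfolding ses_def heart_iff by blast
qed

lemma heart_bottom_factor:
  assumes E: "E \<in> heart b" "\<not> is_zero_obj C E"
  obtains K B where "ses b K E B" "B \<in> P (phi_minus C P E)" "\<not> is_zero_obj C B"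
proof -
  obtain K B where KB: "tri C K E B" "B \<in> P (phi_minus C P E)" "\<not> is_zero_obj C B"
    "K \<in> ph {phi_minus C P E<..}" using bottom_factor[OF E(2)] .
  note p = heart_phases[OF E]
  have B: "B \<in> ph {phi_minus C P E}" "B \<in> heart b" using ph_base[OF KB(2)] p unfolding heart_def by simp_all
  have "K \<in> ph (- {b + 1<..})"
    using ph_down_sub[of "{b + 1<..}" K E B "{phi_minus C P E}"] KB E B p by (auto simp: heart_iff)
  moreover have "K \<in> ph {b<..}" by (rule ph_mono[OF KB(4)]) (use p in auto)
  ultimately show thesis using that[of K B] B KB unfolding ses_def heart_iff by simp
qed

text \<open>
  Truncating the cone \<open>N\<close> of \<open>f\<close> at \<open>b + 1\<close> splits it into the cokernel and the shifted kernel of \<open>f\<close>.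
\<close>

lemma heart_image:
  assumes f: "f \<in> Hom C F1 F2" "f \<noteq> 0" and F: "F1 \<in> heart b" "F2 \<in> heart b"
  obtains K I R where "ses b K F1 I" "ses b I F2 R" "\<not> is_zero_obj C I"
proof -
  obtain N g h where N: "dtri C F1 F2 N f g h" using TR1_cone[OF f(1)] by blast
  then have tN: "tri C F2 N (sh C F1)" unfolding tri_def using dtri_rotate by blast
  obtain K1 K0 where K: "tri C K1 N K0" "K1 \<in> ph {b + 1<..}" "K0 \<in> ph {..b + 1}"
    using truncation[of "{b + 1<..}" N] by auto
  obtain I where I: "tri C I F2 K0" "tri C F1 I K1" "is_zero_obj C I \<longrightarrow> f = 0"
    using tri_octahedral_image[OF N K(1)] by blast
  have sF: "sh C F1 \<in> heart (b + 1)" using F by (simp add: heart_sh_iff)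
  have "F2 \<in> ph {b<..}" "F2 \<in> ph {..b + 2}" "sh C F1 \<in> ph {b<..}" "sh C F1 \<in> ph {..b + 2}"
    using F sF unfolding heart_def by (auto intro: ph_mono)
  then have N2: "N \<in> ph {b<..}" "N \<in> ph {..b + 2}"
    using ph_up_ext[of "{b<..}", OF _ tN] ph_down_ext[of "{b + 2<..}", OF _ tN] by auto
  have "sh C K1 \<in> ph {b<..}" using ph_sh[OF K(2), of "{b<..}"] by auto
  then have K0: "K0 \<in> heart b" using ph_up_quotient[of "{b<..}", OF _ K(1)] N2 K by (simp add: heart_iff)
  have "K1 \<in> ph (- {b + 2<..})"
    using ph_down_sub[of "{b + 2<..}", OF _ K(1) _ K(3)] N2 by auto
  then have K1: "K1 \<in> heart (b + 1)" using K by (simp add: heart_iff add.commute)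
  obtain K' where K': "isomorphic C K1 (sh C K')" using sh_ess_surj by blast
  then have K'h: "K' \<in> heart b" using heart_iso[OF K1 K'] by (simp add: heart_sh_iff)
  have "tri C K1 (sh C F1) (sh C I)" using I(2) tri_rotate by blast
  then have t: "tri C K' F1 I"
    using tri_isomorphic[OF _ K' isomorphic_refl isomorphic_refl] tri_sh_iff by blast
  have "F1 \<in> ph {b<..}" "K1 \<in> ph {b<..}" using F K unfolding heart_iff by (auto intro: ph_mono)
  then have "I \<in> ph {b<..}" using ph_up_ext[of "{b<..}", OF _ I(2)] by simp
  moreover have "I \<in> ph (- {b + 1<..})"
    using ph_down_sub[of "{b + 1<..}", OF _ I(1) _ K(3)] F by (auto simp: heart_iff)
  ultimately have "I \<in> heart b" by (simp add: heart_iff)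
  then show thesis using that[of K' I K0] t K'h I K0 f(2) unfolding ses_def by blast
qed

end

text \<open>
  A stability condition with the support property in the form of the constant \<open>c\<close>.
  Here \<open>v\<close> is the class of an object in the lattice.
\<close>

locale stability = phase_family C P + lattice_seminorm nrm
  for C :: "('o, 'm::ab_group_add, 'k::field) tricat" and P
    and nrm :: "'l::ab_group_add \<Rightarrow> real" +
  fixes v :: "'o \<Rightarrow> 'l" and Z :: "'l \<Rightarrow> complex" and c :: real
  assumes v_tri: "tri C X Y W \<Longrightarrow> v Y = v X + v W"
    and Z_add: "Z (x + y) = Z x + Z y"
    and Z_phase: "E \<in> P \<theta> \<Longrightarrow> \<not> is_zero_obj C E \<Longrightarrow>
      \<exists>r>0. Z (v E) = of_real r * cis (pi * \<theta>)"
    and c_pos: "0 < c"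
    and support: "E \<in> P \<theta> \<Longrightarrow> c * nrm (v E) \<le> cmod (Z (v E))"
begin

lemma v_zero: "is_zero_obj C X \<Longrightarrow> v X = 0"
  using v_tri[OF tri_zero_left[of X X]] by simp

lemma v_iso: assumes "isomorphic C X Y" shows "v X = v Y"
proof -
  obtain O' where O: "is_zero_obj C O'" using ex_zero_obj by blast
  have "tri C X Y O'" using tri_isomorphic[OF tri_zero_right[OF O] isomorphic_refl assms isomorphic_refl] .
  then show ?thesis using v_tri v_zero[OF O] by fastforce
qed

lemma v_sh: "v (sh C X) = - v X"
proof -
  obtain O' where O: "is_zero_obj C O'" using ex_zero_obj by blast
  have "v O' = v X + v (sh C X)" using v_tri[OF tri_rotate[OF tri_zero_right[OF O]]] .
  then show ?thesis using v_zero[OF O] by (simp add: eq_neg_iff_add_eq_0 add.commute)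
qed

lemma Z_zero [simp]: "Z 0 = 0" using Z_add[of 0 0] by simp

text \<open>
  Inequalities for semistable objects pass to extensions.  Together with \<open>ph_support\<close> this
  replaces the use of the mass of an object.
\<close>

lemma ph_superadditive:
  assumes "E \<in> ph I" "\<And>\<theta> A. \<theta> \<in> I \<Longrightarrow> A \<in> P \<theta> \<Longrightarrow> 0 \<le> h (v A)"
    "\<And>x y. h x + h y \<le> h (x + y)" "0 \<le> (h 0 :: real)"
  shows "0 \<le> h (v E)"
  using assms(1)
proof (induction rule: ph_induct)
  case (zero X) then show ?case using assms(4) v_zero by simp
next
  case (step X E A \<theta>)
  show ?case
    using assms(2)[OF \<open>\<theta> \<in> I\<close> \<open>A \<in> P \<theta>\<close>] assms(3)[of "v X" "v A"] \<open>0 \<le> h (v X)\<close>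
    unfolding v_tri[OF \<open>tri C X E A\<close>] by linarith
qed

lemma ph_positive:
  assumes "E \<in> ph I" "\<not> is_zero_obj C E"
    "\<And>\<theta> A. \<theta> \<in> I \<Longrightarrow> A \<in> P \<theta> \<Longrightarrow> \<not> is_zero_obj C A \<Longrightarrow> 0 < h (v A)"
    "\<And>x y. h (x + y) = h x + (h y :: real)"
  shows "0 < h (v E)"
proof -
  have h0: "h 0 = 0" using assms(4)[of 0 0] by simp
  have "is_zero_obj C E \<or> 0 < h (v E)"
    using assms(1)
  proof (induction rule: ph_induct)
    case (step X E A \<theta>)
    have A: "is_zero_obj C A \<or> 0 < h (v A)" using assms(3)[OF \<open>\<theta> \<in> I\<close> \<open>A \<in> P \<theta>\<close>] by blast
    have s: "h (v E) = h (v X) + h (v A)" using v_tri[OF \<open>tri C X E A\<close>] assms(4) by simp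
    have "is_zero_obj C E" if "is_zero_obj C X" "is_zero_obj C A"
      using tri_iso_of_zero_left[OF \<open>tri C X E A\<close> that(1)] isomorphic_sym isomorphic_zero that(2) by blast
    then show ?case using A s step.IH v_zero h0 by fastforce
  qed simp
  then show ?thesis using assms(2) by blast
qed

text \<open>
  If the modulus of the charge is bounded by an additive function \<open>g\<close> on the semistable objects in
  question, the support inequality persists for all their extensions, because \<open>k g - c nrm\<close> is
  superadditive.
\<close>

lemma ph_support:
  assumes E: "E \<in> ph I" and k: "0 < k" and g: "\<And>x y. g (x + y) = g x + g y"
    and pos: "\<And>\<theta> A. \<theta> \<in> I \<Longrightarrow> A \<in> P \<theta> \<Longrightarrow> \<not> is_zero_obj C A \<Longrightarrow> cmod (Z (v A)) \<le> k * g (v A)"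
  shows "c * nrm (v E) \<le> k * (g (v E) :: real)"
proof -
  have g0: "g 0 = 0" using g[of 0 0] by simp
  have "0 \<le> (\<lambda>x. k * g x - c * nrm x) (v E)"
  proof (rule ph_superadditive[OF E])
    fix \<theta> A assume A: "\<theta> \<in> I" "A \<in> P \<theta>"
    show "0 \<le> k * g (v A) - c * nrm (v A)"
      using pos[OF A] support[OF A(2)] v_zero[of A] g0 by fastforce
  next
    fix x y
    show "k * g x - c * nrm x + (k * g y - c * nrm y) \<le> k * g (x + y) - c * nrm (x + y)"
      using mult_left_mono[OF nrm_add[of x y], of c] c_pos g[of x y] by (simp add: algebra_simps)
  qed (simp add: g0)
  then show ?thesis by simp
qed

lemma Z_rotated:
  assumes "E \<in> P \<theta>" "\<not> is_zero_obj C E"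
  obtains r where "0 < r" "r = cmod (Z (v E))" "cis (- (pi * b)) * Z (v E) = of_real r * cis (pi * (\<theta> - b))"
proof -
  obtain r where r: "0 < r" "Z (v E) = of_real r * cis (pi * \<theta>)" using Z_phase[OF assms] by blast
  have "cis (- (pi * b)) * cis (pi * \<theta>) = cis (pi * (\<theta> - b))" by (simp add: cis_mult algebra_simps)
  then have "cis (- (pi * b)) * Z (v E) = of_real r * cis (pi * (\<theta> - b))"
    unfolding r(2) by (simp only: mult.left_commute)
  moreover have "r = cmod (Z (v E))" using r by (simp add: norm_mult)
  ultimately show thesis using that r(1) by blast
qed

end

section \<open>A deformed central charge on a heart\<close>

context stability
begin

text \<open>
  On a half plane, phase at most \<open>\<theta>\<close> is the linear condition \<open>Im (e\<^sup>-\<^sup>i\<^sup>\<pi>\<^sup>\<theta> W) \<le> 0\<close>.  In this form it needs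
  no exception for zero objects, and it is invariant under the shift.
\<close>

definition semistable :: "('l \<Rightarrow> complex) \<Rightarrow> real \<Rightarrow> real \<Rightarrow> 'o set" where
  "semistable W b \<theta> = {E \<in> heart b. Im (cis (- (pi * \<theta>)) * W (v E)) = 0 \<and>
     (\<forall>F R. ses b F E R \<longrightarrow> Im (cis (- (pi * \<theta>)) * W (v F)) \<le> 0)}"

end

text \<open>
  \<open>Z\<close> and \<open>W\<close> have equal components orthogonal to the direction \<open>e\<^sup>i\<^sup>\<pi>\<^sup>b\<close> bounding the heart.  Rotated
  by \<open>-\<pi> b\<close> they become \<open>z\<close> and \<open>w\<close>, with equal imaginary parts.
\<close>

locale deformation = stability C P nrm v Z c
  for C :: "('o, 'm::ab_group_add, 'k::field) tricat" and P
    and nrm :: "'l::ab_group_add \<Rightarrow> real" and v Z c +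
  fixes W :: "'l \<Rightarrow> complex" and b \<epsilon> :: real
  assumes W_add: "W (x + y) = W x + W y"
    and W_Im: "Im (cis (- (pi * b)) * W x) = Im (cis (- (pi * b)) * Z x)"
    and W_close: "cmod (W x - Z x) \<le> \<epsilon> * nrm x"
    and \<epsilon>_nonneg: "0 \<le> \<epsilon>" and \<epsilon>_less: "\<epsilon> < c"
begin

definition w :: "'l \<Rightarrow> complex" where "w x = cis (- (pi * b)) * W x"
definition z :: "'l \<Rightarrow> complex" where "z x = cis (- (pi * b)) * Z x"

lemma w_add: "w (x + y) = w x + w y" and z_add: "z (x + y) = z x + z y"
  by (simp_all add: w_def z_def W_add Z_add ring_distribs)

lemma w_zero [simp]: "w 0 = 0" and z_zero [simp]: "z 0 = 0"
  using w_add[of 0 0] z_add[of 0 0] by simp_all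

lemma Im_w: "Im (w x) = Im (z x)" unfolding w_def z_def by (rule W_Im)

lemma w_close: "cmod (w x - z x) \<le> \<epsilon> * nrm x"
proof -
  have "w x - z x = cis (- (pi * b)) * (W x - Z x)" by (simp add: w_def z_def right_diff_distrib)
  then show ?thesis using W_close[of x] by (simp only: norm_mult norm_cis mult_1_left)
qed

lemma cis_W: "cis (- (pi * \<theta>)) * W x = cis (- (pi * (\<theta> - b))) * w x"
proof -
  have "cis (- (pi * \<theta>)) = cis (- (pi * (\<theta> - b))) * cis (- (pi * b))"
    by (simp add: cis_mult algebra_simps)
  then show ?thesis by (simp add: w_def mult.assoc)
qed

lemma z_stable:
  assumes "E \<in> P \<theta>" "\<not> is_zero_obj C E"
  obtains r where "0 < r" "c * nrm (v E) \<le> r" "z (v E) = of_real r * cis (pi * (\<theta> - b))"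
  using Z_rotated[OF assms, of b] support[OF assms(1)] unfolding z_def by metis

lemma v_ses: "ses b F E R \<Longrightarrow> v E = v F + v R"
  unfolding ses_def using v_tri by blast

lemma Im_z_nonneg: assumes "E \<in> heart b" shows "0 \<le> Im (z (v E))"
proof (rule ph_superadditive[where h = "\<lambda>x. Im (z x)"])
  show "E \<in> ph {b<..b + 1}" using assms by (simp add: heart_def)
next
  fix \<theta> A assume \<theta>: "\<theta> \<in> {b<..b + 1}" and A: "A \<in> P \<theta>"
  show "0 \<le> Im (z (v A))"
  proof (cases "is_zero_obj C A")
    case False
    obtain r where "0 < r" "z (v A) = of_real r * cis (pi * (\<theta> - b))" using z_stable[OF A False] by metis
    moreover have "0 \<le> sin (pi * (\<theta> - b))"
      using \<theta> mult_left_mono[of "\<theta> - b" 1 pi] by (intro sin_ge_zero) auto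
    ultimately show ?thesis by simp
  qed (simp add: v_zero)
qed (simp_all add: z_add)

text \<open>
  If \<open>Im z\<close> vanishes on \<open>E\<close>, all phases of \<open>E\<close> are \<open>b + 1\<close>; then \<open>z\<close> is negative, and \<open>w\<close> too because
  \<open>\<epsilon> < c\<close>.
\<close>

lemma w_upper: assumes E: "E \<in> heart b" "\<not> is_zero_obj C E" shows "w (v E) \<in> upper"
proof (cases "Im (z (v E)) = 0")
  case False then show ?thesis using Im_z_nonneg[OF E(1)] by (simp add: upper_def Im_w)
next
  case True
  obtain X Y where XY: "ses b X E Y" "X \<in> P (b + 1)" "Y \<in> ph {b<..<b + 1}"
    using heart_top_truncation[OF E(1)] .
  have X: "X \<in> heart b" and Y: "Y \<in> heart b" and t: "tri C X E Y" using XY(1) unfolding ses_def by auto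
  have "Im (z (v E)) = Im (z (v X)) + Im (z (v Y))" using v_ses[OF XY(1)] by (simp add: z_add)
  then have imY: "Im (z (v Y)) = 0" using True Im_z_nonneg[OF X] Im_z_nonneg[OF Y] by linarith
  have Y0: "is_zero_obj C Y"
  proof (rule ccontr)
    assume "\<not> is_zero_obj C Y"
    then have "0 < Im (z (v Y))"
    proof (rule ph_positive[OF XY(3), where h = "\<lambda>x. Im (z x)"])
      fix \<theta> A assume \<theta>: "\<theta> \<in> {b<..<b + 1}" and A: "A \<in> P \<theta>" "\<not> is_zero_obj C A"
      obtain r where "0 < r" "z (v A) = of_real r * cis (pi * (\<theta> - b))" using z_stable[OF A] by metis
      moreover have "0 < sin (pi * (\<theta> - b))" using \<theta> by (intro sin_gt_zero) auto
      ultimately show "0 < Im (z (v A))" by simp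
    qed (simp add: z_add)
    then show False using imY by simp
  qed
  have "isomorphic C X E" using tri_iso_of_zero_right[OF t Y0] .
  then have vX: "v X = v E" and X0: "\<not> is_zero_obj C X" using v_iso isomorphic_zero E(2) by blast+
  obtain r where r: "0 < r" "c * nrm (v X) \<le> r" "z (v X) = of_real r * cis (pi * (b + 1 - b))"
    using z_stable[OF XY(2) X0] .
  have z: "z (v E) = - of_real r" using r vX by simp
  have "Re (w (v E)) \<le> Re (z (v E)) + \<epsilon> * nrm (v E)"
    using w_close[of "v E"] complex_Re_le_cmod[of "w (v E) - z (v E)"] by simp
  moreover have "\<epsilon> * nrm (v E) < r"
  proof (cases "nrm (v E) = 0")
    case False
    then have "\<epsilon> * nrm (v E) < c * nrm (v E)"
      using \<epsilon>_less nrm_nonneg[of "v E"] by (intro mult_strict_right_mono) auto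
    then show ?thesis using r vX by simp
  qed (simp add: r)
  ultimately show ?thesis using True z by (simp add: upper_def Im_w)
qed

lemma w_nonneg: assumes "E \<in> heart b" shows "0 \<le> Im (w (v E))"
  using Im_z_nonneg[OF assms] by (simp add: Im_w)

definition psi :: "'o \<Rightarrow> real" where "psi E = Arg (w (v E))"

lemma psi_bounds: "E \<in> heart b \<Longrightarrow> \<not> is_zero_obj C E \<Longrightarrow> 0 < psi E \<and> psi E \<le> pi"
  unfolding psi_def using upper_polar w_upper by blast

lemma ses_nonzero:
  assumes s: "ses b F E R" and F: "\<not> is_zero_obj C F" shows "\<not> is_zero_obj C E"
proof
  assume "is_zero_obj C E"
  then have "w (v F) + w (v R) = 0" using v_zero v_ses[OF s] w_add[of "v F" "v R"] by simp
  moreover have "w (v F) \<in> upper" using w_upper F s unfolding ses_def by blast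
  moreover have "w (v R) \<in> upper \<or> w (v R) = 0"
    using w_upper[of R] v_zero[of R] s unfolding ses_def by fastforce
  ultimately show False using upper_add[of "w (v F)" "w (v R)"] by (auto simp: upper_def)
qed

lemma psi_le_iff:
  assumes "E \<in> heart b" "\<not> is_zero_obj C E" "b < \<theta>" "\<theta> \<le> b + 1"
  shows "Im (cis (- (pi * \<theta>)) * W (v E)) \<le> 0 \<longleftrightarrow> psi E \<le> pi * (\<theta> - b)"
    "0 \<le> Im (cis (- (pi * \<theta>)) * W (v E)) \<longleftrightarrow> pi * (\<theta> - b) \<le> psi E"
proof -
  have *: "0 < pi * (\<theta> - b)" "pi * (\<theta> - b) \<le> pi"
    using assms mult_left_mono[of "\<theta> - b" 1 pi] by auto
  show "Im (cis (- (pi * \<theta>)) * W (v E)) \<le> 0 \<longleftrightarrow> psi E \<le> pi * (\<theta> - b)"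
    "0 \<le> Im (cis (- (pi * \<theta>)) * W (v E)) \<longleftrightarrow> pi * (\<theta> - b) \<le> psi E"
    unfolding cis_W psi_def
    using Im_cis_mult_nonpos_iff[OF w_upper[OF assms(1,2)] *] Im_cis_mult_nonneg_iff[OF w_upper[OF assms(1,2)] *]
    by blast+
qed

lemma semistable_psi:
  assumes E: "E \<in> semistable W b \<theta>" "\<not> is_zero_obj C E" and \<theta>: "b < \<theta>" "\<theta> \<le> b + 1"
  shows "psi E = pi * (\<theta> - b)"
  using psi_le_iff[OF _ E(2) \<theta>] E(1) unfolding semistable_def by fastforce

lemma semistable_sub:
  assumes E: "E \<in> semistable W b \<theta>" and \<theta>: "b < \<theta>" "\<theta> \<le> b + 1" and s: "ses b F E R" "\<not> is_zero_obj C F"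
  shows "psi F \<le> pi * (\<theta> - b)"
  using psi_le_iff(1)[OF _ s(2) \<theta>] E s(1) unfolding semistable_def by (auto simp: ses_def)

lemma semistable_quotient:
  assumes E: "E \<in> semistable W b \<theta>" and \<theta>: "b < \<theta>" "\<theta> \<le> b + 1" and s: "ses b F E R" "\<not> is_zero_obj C R"
  shows "pi * (\<theta> - b) \<le> psi R"
proof -
  have "R \<in> heart b" using s unfolding ses_def by blast
  moreover have "Im (cis (- (pi * \<theta>)) * W (v E)) =
      Im (cis (- (pi * \<theta>)) * W (v F)) + Im (cis (- (pi * \<theta>)) * W (v R))"
    unfolding v_ses[OF s(1)] W_add by (simp only: distrib_left plus_complex.simps)
  then have "0 \<le> Im (cis (- (pi * \<theta>)) * W (v R))"
    using E s(1) unfolding semistable_def by fastforce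
  ultimately show ?thesis using psi_le_iff(2)[OF _ s(2) \<theta>] by blast
qed

text \<open>
  Sub- and quotient objects are interchangeable in the definition, as the defining functional is
  additive and vanishes on \<open>E\<close>.
\<close>

lemma semistableI:
  assumes E: "E \<in> heart b" "\<not> is_zero_obj C E"
    and q: "\<And>F R. ses b F E R \<Longrightarrow> \<not> is_zero_obj C R \<Longrightarrow> psi E \<le> psi R"
  shows "E \<in> semistable W b (b + psi E / pi)"
proof -
  define \<theta> where "\<theta> = b + psi E / pi"
  have p: "pi * (\<theta> - b) = psi E" by (simp add: \<theta>_def)
  have \<theta>: "b < \<theta>" "\<theta> \<le> b + 1" using psi_bounds[OF E] by (simp_all add: \<theta>_def field_simps)
  have ImE: "Im (cis (- (pi * \<theta>)) * W (v E)) = 0"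
    using psi_le_iff[OF E \<theta>] p by simp
  have "Im (cis (- (pi * \<theta>)) * W (v F)) \<le> 0" if s: "ses b F E R" for F R
  proof -
    have R: "R \<in> heart b" using s unfolding ses_def by blast
    have "0 \<le> Im (cis (- (pi * \<theta>)) * W (v R))"
    proof (cases "is_zero_obj C R")
      case True then show ?thesis using W_add[of 0 0] by (simp add: v_zero)
    next
      case False then show ?thesis using psi_le_iff(2)[OF R False \<theta>] q[OF s False] p by simp
    qed
    moreover have "Im (cis (- (pi * \<theta>)) * W (v E)) =
        Im (cis (- (pi * \<theta>)) * W (v F)) + Im (cis (- (pi * \<theta>)) * W (v R))"
      unfolding v_ses[OF s] W_add by (simp only: distrib_left plus_complex.simps)
    ultimately show ?thesis using ImE by linarith
  qed
  then show ?thesis using E(1) ImE unfolding semistable_def \<theta>_def by blast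
qed

text \<open>
  In a quadrant \<open>|Re z| + |Im z|\<close> is additive and dominates the modulus.
\<close>

lemma nrm_right_half:
  assumes "E \<in> ph {b<..b + 1 / 2}" shows "c * nrm (v E) \<le> Re (z (v E)) + Im (z (v E))"
proof -
  have "c * nrm (v E) \<le> 1 * (Re (z (v E)) + Im (z (v E)))"
  proof (rule ph_support[OF assms, where g = "\<lambda>x. Re (z x) + Im (z x)"])
    fix \<theta> A assume \<theta>: "\<theta> \<in> {b<..b + 1 / 2}" and A: "A \<in> P \<theta>" "\<not> is_zero_obj C A"
    obtain r where r: "0 < r" "z (v A) = of_real r * cis (pi * (\<theta> - b))" using z_stable[OF A] by metis
    have t: "0 \<le> pi * (\<theta> - b)" "pi * (\<theta> - b) \<le> pi / 2" using \<theta> mult_left_mono[of "\<theta> - b" "1/2" pi] by auto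
    have "0 \<le> Re (z (v A))" "0 \<le> Im (z (v A))"
      using r t cos_ge_zero[of "pi * (\<theta> - b)"] sin_ge_zero[of "pi * (\<theta> - b)"] by simp_all
    then have "cmod (z (v A)) \<le> Re (z (v A)) + Im (z (v A))" using cmod_le[of "z (v A)"] by simp
    then show "cmod (Z (v A)) \<le> 1 * (Re (z (v A)) + Im (z (v A)))" by (simp add: z_def norm_mult)
  qed (simp_all add: z_add)
  then show ?thesis by simp
qed

lemma nrm_left_half:
  assumes "E \<in> ph {b + 1 / 2<..b + 1}"
  shows "c * nrm (v E) \<le> - Re (z (v E)) + Im (z (v E))" "Re (z (v E)) \<le> 0"
proof -
  have A': "Re (z (v A)) \<le> 0 \<and> 0 \<le> Im (z (v A))"
    if \<theta>: "\<theta> \<in> {b + 1 / 2<..b + 1}" and A: "A \<in> P \<theta>" for \<theta> A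
  proof (cases "is_zero_obj C A")
    case False
    obtain r where r: "0 < r" "z (v A) = of_real r * cis (pi * (\<theta> - b))" using z_stable[OF A False] by metis
    have t: "pi / 2 \<le> pi * (\<theta> - b)" "pi * (\<theta> - b) \<le> pi"
      using \<theta> mult_left_mono[of "\<theta> - b" 1 pi] mult_left_mono[of "1/2" "\<theta> - b" pi] by auto
    then have "cos (pi * (\<theta> - b)) \<le> 0" using cos_monotone_0_pi_le[of "pi / 2" "pi * (\<theta> - b)"] by simp
    then show ?thesis using r t sin_ge_zero[of "pi * (\<theta> - b)"] by (simp add: mult_nonneg_nonpos)
  qed (simp add: v_zero)
  have "c * nrm (v E) \<le> 1 * (- Re (z (v E)) + Im (z (v E)))"
  proof (rule ph_support[OF assms, where g = "\<lambda>x. - Re (z x) + Im (z x)"])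
    fix \<theta> A assume \<theta>: "\<theta> \<in> {b + 1 / 2<..b + 1}" and A: "A \<in> P \<theta>"
    have "cmod (z (v A)) \<le> - Re (z (v A)) + Im (z (v A))" using cmod_le[of "z (v A)"] A'[OF \<theta> A] by simp
    then show "cmod (Z (v A)) \<le> 1 * (- Re (z (v A)) + Im (z (v A)))" by (simp add: z_def norm_mult)
  qed (simp_all add: z_add)
  then show "c * nrm (v E) \<le> - Re (z (v E)) + Im (z (v E))" by simp
  have "0 \<le> - Re (z (v E))"
    by (rule ph_superadditive[OF assms, where h = "\<lambda>x. - Re (z x)"]) (use A' in \<open>auto simp: z_add\<close>)
  then show "Re (z (v E)) \<le> 0" by simp
qed

text \<open>
  Let \<open>E1\<close> and \<open>F1\<close> be the parts of \<open>E\<close> and of a subobject \<open>F\<close> with phases in the left quadrant.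
  Then \<open>F1\<close> is contained in \<open>E1\<close>, and the quotient is again in the left quadrant, so that
  \<open>Re z\<close> of \<open>F1\<close> is at least that of \<open>E1\<close>.  With both quadrant estimates, the norm of the class of \<open>F\<close>
  is bounded by \<open>Re z\<close> of \<open>F\<close> and constants of \<open>E\<close>.  Replacing \<open>z\<close> by \<open>w\<close> costs a multiple \<open>\<epsilon> < c\<close> of
  the same norm, which is absorbed on the left.
\<close>

lemma finite_sub_classes:
  assumes E: "E \<in> heart b"
  shows "finite {v F | F R. ses b F E R \<and> Re (w (v F)) \<le> K}"
proof -
  obtain E1 E2 where E12: "ses b E1 E E2" "E1 \<in> ph {b + 1 / 2<..b + 1}" "E2 \<in> ph {b<..b + 1 / 2}"
    using heart_truncation[OF E, of "b + 1 / 2"] by auto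
  define M where "M = Re (z (v E1))"
  have "nrm (v F) \<le> (K - 2 * M + Im (z (v E))) / (c - \<epsilon>)" if F: "ses b F E R" "Re (w (v F)) \<le> K" for F R
  proof -
    have FR: "F \<in> heart b" "R \<in> heart b" using F(1) unfolding ses_def by auto
    obtain F1 F2 where F12: "ses b F1 F F2" "F1 \<in> ph {b + 1 / 2<..b + 1}" "F2 \<in> ph {b<..b + 1 / 2}"
      using heart_truncation[OF FR(1), of "b + 1 / 2"] by auto
    obtain V where V: "ses b F1 E V" using ses_sub_trans[OF F12(1) F(1)] by blast
    have h: "Hom C F1 E2 = {0}" by (rule ph_Hom_zero[OF F12(2) E12(3)]) auto
    have t: "tri C F1 E V" "tri C E1 E E2" using V E12(1) unfolding ses_def by simp_all
    obtain D where D: "tri C F1 E1 D" "tri C D V E2" using tri_octahedral_factor[OF t h] by (elim exE conjE)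
    have "V \<in> ph {..b + 1}" "E2 \<in> ph {..b + 1}" using V E12(1) unfolding ses_def heart_iff by auto
    then have "D \<in> ph (- {b + 1<..})"
      using ph_down_sub[of "{b + 1<..}", OF _ D(2), of "{..b + 1}"] by auto
    moreover have "sh C F1 \<in> ph {b + 1 / 2<..}" by (rule ph_sh[OF F12(2)]) auto
    then have "D \<in> ph {b + 1 / 2<..}"
      using ph_up_quotient[of "{b + 1 / 2<..}", OF _ D(1)] E12(2) ph_interval(1) by simp
    ultimately have "D \<in> ph {b + 1 / 2<..b + 1}" by (simp add: ph_interval)
    then have "Re (z (v D)) \<le> 0" by (rule nrm_left_half)
    then have M: "M \<le> Re (z (v F1))" using v_tri[OF D(1)] unfolding M_def by (simp add: z_add)
    have vF: "v F = v F1 + v F2" using v_ses[OF F12(1)] .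
    have "c * nrm (v F) \<le> c * nrm (v F1) + c * nrm (v F2)"
      unfolding vF using mult_left_mono[OF nrm_add[of "v F1" "v F2"], of c] c_pos
      by (simp add: distrib_left)
    also have "\<dots> \<le> Re (z (v F)) - 2 * Re (z (v F1)) + Im (z (v F))"
      using nrm_left_half(1)[OF F12(2)] nrm_right_half[OF F12(3)] by (simp add: vF z_add)
    also have "\<dots> \<le> K + \<epsilon> * nrm (v F) - 2 * M + Im (z (v E))"
    proof -
      have "Re (z (v F)) \<le> Re (w (v F)) + \<epsilon> * nrm (v F)"
        using w_close[of "v F"] abs_Re_le_cmod[of "w (v F) - z (v F)"] by simp
      moreover have "Im (z (v F)) \<le> Im (z (v E))"
        using v_ses[OF F(1)] Im_z_nonneg[OF FR(2)] by (simp add: z_add)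
      ultimately show ?thesis using F(2) M by linarith
    qed
    finally have "(c - \<epsilon>) * nrm (v F) \<le> K - 2 * M + Im (z (v E))" by (simp add: algebra_simps)
    then show ?thesis using \<epsilon>_less by (simp add: field_simps)
  qed
  then show ?thesis
    by (intro finite_subset[OF _ finite_nrm_ball[of "(K - 2 * M + Im (z (v E))) / (c - \<epsilon>)"]]) blast
qed

end

section \<open>Harder--Narasimhan filtrations for the deformed charge\<close>

context deformation
begin

text \<open>
  Quotients of phase at most that of \<open>E\<close> correspond to subobjects \<open>F\<close> of phase at least that of \<open>E\<close>, for
  which \<open>Re w\<close> is bounded; so their charges form a finite set.
\<close>

lemma minimal_quotient:
  assumes E: "E \<in> heart b" "\<not> is_zero_obj C E"
  obtains F R where "ses b F E R" "\<not> is_zero_obj C R" "psi R \<le> psi E"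
    "\<And>F' R'. ses b F' E R' \<Longrightarrow> \<not> is_zero_obj C R' \<Longrightarrow>
       psi R < psi R' \<or> (psi R' = psi R \<and> cmod (w (v R')) \<le> cmod (w (v R)))"
proof -
  define S where "S = {v F | F R. ses b F E R \<and> \<not> is_zero_obj C R \<and> psi R \<le> psi E}"
  have bound: "Re (w (v F)) \<le> \<bar>Re (w (v E))\<bar>" if s: "ses b F E R" "\<not> is_zero_obj C R" "psi R \<le> psi E" for F R
  proof (cases "is_zero_obj C F")
    case True then show ?thesis by (simp add: v_zero)
  next
    case False
    have FR: "F \<in> heart b" "R \<in> heart b" using s(1) unfolding ses_def by auto
    have wE: "w (v E) = w (v R) + w (v F)" using v_ses[OF s(1)] by (simp add: w_add)
    have "psi R \<le> psi F"
      using s(3) Arg_add_le_iff(1)[OF w_upper[OF FR(1) False] w_upper[OF FR(2) s(2)]]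
      unfolding psi_def wE by (simp add: add.commute)
    then have "psi E \<le> psi F"
      using Arg_add_le_iff(2)[OF w_upper[OF FR(2) s(2)] w_upper[OF FR(1) False]]
      unfolding psi_def wE by simp
    moreover have "Im (w (v F)) \<le> Im (w (v E))" using w_nonneg[OF FR(2)] unfolding wE by simp
    ultimately show ?thesis
      using Re_le_of_Arg_ge[OF w_upper[OF FR(1) False] w_upper[OF E]] unfolding psi_def by blast
  qed
  have "finite S"
    by (rule finite_subset[OF _ finite_sub_classes[OF E(1), of "\<bar>Re (w (v E))\<bar>"]])
      (use bound in \<open>auto simp: S_def\<close>)
  then have fin: "finite ((\<lambda>x. w (v E) - w x) ` S)" by simp
  obtain O' where O: "is_zero_obj C O'" using ex_zero_obj by blast
  have "ses b O' E E" unfolding ses_def using tri_zero_left[OF O] heart_zero[OF O] E(1) by blast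
  then have "v O' \<in> S" unfolding S_def using E(2) by blast
  then have ne: "(\<lambda>x. w (v E) - w x) ` S \<noteq> {}" by blast
  have wR: "w (v E) - w (v F) = w (v R)" if "ses b F E R" for F R
    using v_ses[OF that] by (simp add: w_add)
  obtain x where x: "x \<in> S" "\<And>x'. x' \<in> S \<Longrightarrow> Arg (w (v E) - w x) < Arg (w (v E) - w x') \<or>
      (Arg (w (v E) - w x') = Arg (w (v E) - w x) \<and> cmod (w (v E) - w x') \<le> cmod (w (v E) - w x))"
    using lexicographic_minimum[OF fin ne] by auto
  obtain F R where FR: "x = v F" "ses b F E R" "\<not> is_zero_obj C R" "psi R \<le> psi E"
    using x(1) unfolding S_def by blast
  show thesis
  proof (rule that[OF FR(2-4)])
    fix F' R' assume s: "ses b F' E R'" "\<not> is_zero_obj C R'"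
    show "psi R < psi R' \<or> (psi R' = psi R \<and> cmod (w (v R')) \<le> cmod (w (v R)))"
    proof (cases "psi R' \<le> psi E")
      case True
      then have "v F' \<in> S" using s unfolding S_def by blast
      then show ?thesis using x(2)[of "v F'"] wR[OF s(1)] wR[OF FR(2)] FR(1) unfolding psi_def by simp
    qed (use FR in linarith)
  qed
qed

text \<open>
  Quotients of the minimal quotient \<open>R\<close> are quotients of \<open>E\<close>, so \<open>R\<close> is semistable.  A quotient of the kernel
  \<open>F\<close> of phase at most that of \<open>R\<close> would extend \<open>R\<close> to a larger quotient of \<open>E\<close> of minimal phase.
\<close>

lemma destabilizing_step:
  assumes E: "E \<in> heart b" "\<not> is_zero_obj C E"
  obtains F R where "ses b F E R" "\<not> is_zero_obj C R" "psi R \<le> psi E"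
    "R \<in> semistable W b (b + psi R / pi)"
    "\<And>F' R'. ses b F' F R' \<Longrightarrow> \<not> is_zero_obj C R' \<Longrightarrow> psi R < psi R'"
proof -
  obtain F R where FR: "ses b F E R" "\<not> is_zero_obj C R" "psi R \<le> psi E"
    and min: "\<And>F' R'. ses b F' E R' \<Longrightarrow> \<not> is_zero_obj C R' \<Longrightarrow>
       psi R < psi R' \<or> (psi R' = psi R \<and> cmod (w (v R')) \<le> cmod (w (v R)))"
    using minimal_quotient[OF E] by blast
  have R: "R \<in> heart b" using FR(1) unfolding ses_def by blast
  have "R \<in> semistable W b (b + psi R / pi)"
  proof (rule semistableI[OF R FR(2)])
    fix F' R' assume s: "ses b F' R R'" "\<not> is_zero_obj C R'"
    obtain Y where "ses b Y E R'" using ses_quotient_trans[OF FR(1) s(1)] by blast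
    then show "psi R \<le> psi R'" using min s(2) by fastforce
  qed
  moreover have "psi R < psi R'" if s: "ses b F' F R'" "\<not> is_zero_obj C R'" for F' R'
  proof (rule ccontr)
    assume "\<not> psi R < psi R'"
    then have le: "psi R' \<le> psi R" by simp
    obtain V where V: "ses b F' E V" "ses b R' V R" using ses_sub_trans[OF s(1) FR(1)] by blast
    have R': "R' \<in> heart b" using s(1) unfolding ses_def by blast
    have up: "w (v R') \<in> upper" "w (v R) \<in> upper" using w_upper R R' FR(2) s(2) by auto
    have V0: "\<not> is_zero_obj C V" using ses_nonzero[OF V(2) s(2)] .
    have wV: "w (v V) = w (v R') + w (v R)" using v_ses[OF V(2)] by (simp add: w_add)
    have "psi V \<le> psi R" using Arg_add_le_iff(2)[OF up] le unfolding psi_def wV by simp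
    then have eq: "psi V = psi R" "cmod (w (v V)) \<le> cmod (w (v R))" using min[OF V(1) V0] by auto
    have "psi R' = psi R" using Arg_add_le_iff(1)[OF up] eq(1) le unfolding psi_def wV by simp
    \<comment> \<open>\<open>V\<close> and \<open>R\<close> have charges on the same ray, so that of \<open>R'\<close> is a nonpositive multiple of that of \<open>R\<close>\<close>
    have upV: "w (v V) \<in> upper" unfolding wV using upper_add[OF up] .
    have "\<exists>p q. w (v V) = of_real p * cis (psi R) \<and> w (v R) = of_real q * cis (psi R) \<and> 0 < q \<and> p \<le> q"
      using upper_polar(1,4)[OF up(2)] upper_polar(4)[OF upV] eq unfolding psi_def by metis
    then obtain p q where pq: "w (v V) = of_real p * cis (psi R)" "w (v R) = of_real q * cis (psi R)"
      "0 < q" "p \<le> q" by blast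
    have "w (v R') = w (v V) - w (v R)" using wV by simp
    also have "\<dots> = of_real ((p - q) / q) * w (v R)" using pq(3) unfolding pq(1,2) by (simp add: field_simps)
    finally have "w (v R') = of_real ((p - q) / q) * w (v R)" .
    moreover have "(p - q) / q \<le> 0" using pq(3,4) by (simp add: field_simps)
    ultimately show False using not_upper_scale[OF up(2)] up(1) by metis
  qed
  ultimately show thesis using that FR by blast
qed

text \<open>
  Split off quotients as in \<open>destabilizing_step\<close>.  The process ends since the classes of
  subobjects of phase at least that of \<open>E\<close> are finite in number, and passing to the kernel removes the
  class of \<open>E\<close> itself.  The set of phases records that each of them is bounded below by the
  phase of some quotient, so that the phase split off next is strictly smaller.
\<close>

lemma heart_HN:
  assumes "E \<in> heart b" "\<not> is_zero_obj C E"
  shows "HN_in C (semistable W b)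
    {x. b < x \<and> x \<le> b + 1 \<and> (\<exists>F R. ses b F E R \<and> \<not> is_zero_obj C R \<and> b + psi R / pi \<le> x)} E"
proof -
  define S where "S E = {v F | F R. ses b F E R \<and> \<not> is_zero_obj C F \<and> psi E \<le> psi F}" for E
  have fin: "finite (S E)" if E: "E \<in> heart b" "\<not> is_zero_obj C E" for E
  proof (rule finite_subset[OF _ finite_sub_classes[OF E(1), of "\<bar>Re (w (v E))\<bar>"]], unfold S_def, safe)
    fix F R assume s: "ses b F E R" "\<not> is_zero_obj C F" "psi E \<le> psi F"
    have FR: "F \<in> heart b" "R \<in> heart b" using s(1) unfolding ses_def by auto
    have "Im (w (v F)) \<le> Im (w (v E))" using v_ses[OF s(1)] w_nonneg[OF FR(2)] by (simp add: w_add)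
    then have "Re (w (v F)) \<le> \<bar>Re (w (v E))\<bar>"
      using Re_le_of_Arg_ge[OF w_upper[OF FR(1) s(2)] w_upper[OF E]] s(3) unfolding psi_def by blast
    then show "\<exists>F' R'. v F = v F' \<and> ses b F' E R' \<and> Re (w (v F')) \<le> \<bar>Re (w (v E))\<bar>" using s(1) by blast
  qed
  show ?thesis
    using assms
  proof (induction "card (S E)" arbitrary: E rule: less_induct)
    case less
    obtain F R where FR: "ses b F E R" "\<not> is_zero_obj C R" "psi R \<le> psi E"
      and R: "R \<in> semistable W b (b + psi R / pi)"
      and quot: "\<And>F' R'. ses b F' F R' \<Longrightarrow> \<not> is_zero_obj C R' \<Longrightarrow> psi R < psi R'"
      using destabilizing_step[OF less.prems] by blast
    have Fh: "F \<in> heart b" and Rh: "R \<in> heart b" using FR(1) unfolding ses_def by auto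
    let ?I = "\<lambda>E. {x. b < x \<and> x \<le> b + 1 \<and> (\<exists>F R. ses b F E R \<and> \<not> is_zero_obj C R \<and> b + psi R / pi \<le> x)}"
    have IF: "b + psi R / pi < x" if x: "x \<in> ?I F" for x
    proof -
      obtain F' R' where s: "ses b F' F R'" "\<not> is_zero_obj C R'" "b + psi R' / pi \<le> x" using x by blast
      have "psi R / pi < psi R' / pi" using quot[OF s(1,2)] by (simp add: divide_strict_right_mono)
      then show ?thesis using s(3) by simp
    qed
    have "HN_in C (semistable W b) (?I F) F"
    proof (cases "is_zero_obj C F")
      case True then show ?thesis by (rule HN_in_zero)
    next
      case False
      have "psi R < psi F"
      proof -
        obtain O' where O: "is_zero_obj C O'" using ex_zero_obj by blast
        have "ses b O' F F" unfolding ses_def using tri_zero_left[OF O] heart_zero[OF O] Fh by blast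
        then show ?thesis using quot False by blast
      qed
      then have EF: "psi E \<le> psi F"
        using Arg_add_le_iff(2)[OF w_upper[OF Rh FR(2)] w_upper[OF Fh False]] v_ses[OF FR(1)]
        unfolding psi_def by (simp add: w_add add.commute)
      have "S F \<subset> S E"
      proof
        show "S F \<subseteq> S E"
        proof
          fix x assume "x \<in> S F"
          then obtain F' R' where s: "x = v F'" "ses b F' F R'" "\<not> is_zero_obj C F'" "psi F \<le> psi F'"
            unfolding S_def by blast
          obtain V where "ses b F' E V" using ses_sub_trans[OF s(2) FR(1)] by blast
          then show "x \<in> S E" unfolding S_def using s EF by force
        qed
        have "v E \<notin> S F"
        proof
          assume "v E \<in> S F"
          then obtain F' R' where s: "v E = v F'" "ses b F' F R'" unfolding S_def by blast
          obtain V where V: "ses b F' E V" "ses b R' V R" using ses_sub_trans[OF s(2) FR(1)] by blast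
          have "w (v V) = 0" using v_ses[OF V(1)] s(1) by simp
          moreover have "w (v V) = w (v R') + w (v R)" using v_ses[OF V(2)] by (simp add: w_add)
          moreover have "w (v R) \<in> upper" using w_upper[OF Rh FR(2)] .
          moreover have "w (v R') \<in> upper \<or> w (v R') = 0"
            using w_upper[of R'] v_zero[of R'] s(2) unfolding ses_def by fastforce
          ultimately show False using upper_add[of "w (v R')" "w (v R)"] by (auto simp: upper_def)
        qed
        moreover have "v E \<in> S E"
        proof -
          obtain O' where O: "is_zero_obj C O'" using ex_zero_obj by blast
          have "ses b E E O'" unfolding ses_def using tri_zero_right[OF O] heart_zero[OF O] less.prems(1) by blast
          then show ?thesis unfolding S_def using less.prems(2) by blast
        qed
        ultimately show "S F \<noteq> S E" by blast
      qed
      then have "card (S F) < card (S E)" using fin[OF less.prems] psubset_card_mono by blast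
      then show ?thesis using less.hyps Fh False by blast
    qed
    moreover have "tri C F E R" using FR(1) unfolding ses_def by blast
    ultimately have "HN_in C (semistable W b) (insert (b + psi R / pi) (?I F)) E"
      using HN_in_append[of "semistable W b" "?I F" F E R "b + psi R / pi"] R FR(2) IF by blast
    moreover have "insert (b + psi R / pi) (?I F) \<subseteq> ?I E"
    proof
      fix x assume x: "x \<in> insert (b + psi R / pi) (?I F)"
      have "0 < psi R" "psi R \<le> pi" using psi_bounds[OF Rh FR(2)] by auto
      then have "b < b + psi R / pi" "b + psi R / pi \<le> b + 1" by (simp_all add: field_simps)
      moreover have "b + psi R / pi \<le> x" using x IF by (auto intro: less_imp_le)
      ultimately show "x \<in> ?I E" using x FR by auto
    qed
    ultimately show ?case by (rule HN_in_mono)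
  qed
qed

text \<open>
  The image of a nonzero map would have phase at least \<open>\<theta>1\<close> as a quotient and at most \<open>\<theta>2\<close> as a
  subobject.
\<close>

lemma semistable_Hom_zero:
  assumes \<theta>: "b < \<theta>2" "\<theta>2 < \<theta>1" "\<theta>1 \<le> b + 1"
    and F: "F1 \<in> semistable W b \<theta>1" "F2 \<in> semistable W b \<theta>2"
  shows "Hom C F1 F2 = {0}"
proof -
  have "f = 0" if f: "f \<in> Hom C F1 F2" for f
  proof (rule ccontr)
    assume "f \<noteq> 0"
    moreover have "F1 \<in> heart b" "F2 \<in> heart b" using F unfolding semistable_def by auto
    ultimately obtain K I R where s: "ses b K F1 I" "ses b I F2 R" "\<not> is_zero_obj C I"
      using heart_image f by blast
    have "pi * (\<theta>1 - b) \<le> psi I" using semistable_quotient[OF F(1) _ \<theta>(3) s(1,3)] \<theta> by simp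
    moreover have "psi I \<le> pi * (\<theta>2 - b)" using semistable_sub[OF F(2) \<theta>(1) _ s(2,3)] \<theta> by simp
    ultimately have "pi * (\<theta>1 - b) \<le> pi * (\<theta>2 - b)" by linarith
    then show False using \<theta> by simp
  qed
  then show ?thesis using Hom_zero by blast
qed

lemma semistable_W:
  assumes E: "E \<in> semistable W b \<theta>" "\<not> is_zero_obj C E" and \<theta>: "b < \<theta>" "\<theta> \<le> b + 1"
  shows "\<exists>r>0. W (v E) = of_real r * cis (pi * \<theta>)"
proof -
  have Eh: "E \<in> heart b" using E(1) unfolding semistable_def by blast
  have p: "psi E = pi * (\<theta> - b)" by (rule semistable_psi[OF E \<theta>])
  note up = upper_polar[OF w_upper[OF Eh E(2)]]
  have "W (v E) = cis (pi * b) * w (v E)"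
    unfolding w_def by (simp add: cis_mult flip: mult.assoc)
  also have "w (v E) = of_real (cmod (w (v E))) * cis (pi * (\<theta> - b))" using up(4) p unfolding psi_def by simp
  also have "cis (pi * b) * (of_real (cmod (w (v E))) * cis (pi * (\<theta> - b))) =
      of_real (cmod (w (v E))) * (cis (pi * b) * cis (pi * (\<theta> - b)))" by (simp only: mult.left_commute)
  also have "cis (pi * b) * cis (pi * (\<theta> - b)) = cis (pi * \<theta>)" by (simp add: cis_mult algebra_simps)
  finally show ?thesis using up(1) by blast
qed

text \<open>
  By the support property, \<open>w\<close> and \<open>z\<close> differ on a \<open>P\<close>-semistable object by at most \<open>\<epsilon>/c\<close> times the modulus
  of \<open>z\<close>.
\<close>

lemma stable_Arg:
  assumes A: "A \<in> P \<phi>" "\<not> is_zero_obj C A" and \<phi>: "b < \<phi>" "\<phi> \<le> b + 1"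
    and \<eta>: "0 < \<eta>" "\<eta> < 1 / 2" "2 * \<epsilon> \<le> c * sin (pi * \<eta>)"
  shows "\<bar>psi A - pi * (\<phi> - b)\<bar> \<le> pi * \<eta>"
proof -
  obtain r where r: "0 < r" "c * nrm (v A) \<le> r" "z (v A) = of_real r * cis (pi * (\<phi> - b))"
    using z_stable[OF A] .
  have t: "0 < pi * (\<phi> - b)" "pi * (\<phi> - b) \<le> pi" using \<phi> mult_left_mono[of "\<phi> - b" 1 pi] by auto
  note zu = rcis_upper[OF r(1) t, folded r(3)]
  have "A \<in> heart b" using ph_base[OF A(1)] \<phi> unfolding heart_def by simp
  then have wu: "w (v A) \<in> upper" using w_upper A(2) by blast
  have "nrm (v A) \<le> cmod (z (v A)) / c" using r c_pos by (simp add: field_simps norm_mult)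
  then have "cmod (w (v A) - z (v A)) \<le> \<epsilon> * (cmod (z (v A)) / c)"
    using w_close[of "v A"] mult_left_mono[of _ _ \<epsilon>] \<epsilon>_nonneg order_trans by blast
  then have "cmod (w (v A) - z (v A)) \<le> (\<epsilon> / c) * cmod (z (v A))" by simp
  moreover have "2 * (\<epsilon> / c) \<le> sin (pi * \<eta>)" using \<eta>(3) c_pos by (simp add: field_simps)
  ultimately have "\<bar>Arg (w (v A)) - Arg (z (v A))\<bar> \<le> pi * \<eta>" by (rule Arg_close[OF zu(1) wu _ _ \<eta>(1,2)])
  then show ?thesis unfolding psi_def zu(2) .
qed

text \<open>
  The first \<open>P\<close>-factor of \<open>E\<close> is a subobject and the last one is a quotient.  Semistability of \<open>E\<close> bounds
  their \<open>W\<close>-phases, and these differ from their \<open>P\<close>-phases by at most \<open>\<eta>\<close>.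
\<close>

lemma semistable_close:
  assumes E: "E \<in> semistable W b \<theta>" and \<theta>: "b < \<theta>" "\<theta> \<le> b + 1"
    and \<eta>: "0 < \<eta>" "\<eta> < 1 / 2" "2 * \<epsilon> \<le> c * sin (pi * \<eta>)"
  shows "E \<in> ph {\<theta> - \<eta>..\<theta> + \<eta>}"
proof (cases "is_zero_obj C E")
  case True then show ?thesis by (rule ph_zero)
next
  case False
  have Eh: "E \<in> heart b" using E unfolding semistable_def by blast
  note p = heart_phases[OF Eh False]
  obtain A R where A: "ses b A E R" "A \<in> P (phi_plus C P E)" "\<not> is_zero_obj C A"
    using heart_top_factor[OF Eh False] .
  obtain K B where B: "ses b K E B" "B \<in> P (phi_minus C P E)" "\<not> is_zero_obj C B"
    using heart_bottom_factor[OF Eh False] .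
  have "pi * (phi_plus C P E - b) \<le> pi * (\<theta> - b) + pi * \<eta>"
    using stable_Arg[OF A(2,3) p(3,2) \<eta>] semistable_sub[OF E \<theta> A(1,3)] by linarith
  then have "pi * phi_plus C P E \<le> pi * (\<theta> + \<eta>)" by (simp add: algebra_simps)
  moreover have "pi * (\<theta> - b) - pi * \<eta> \<le> pi * (phi_minus C P E - b)"
    using stable_Arg[OF B(2,3) p(1,4) \<eta>] semistable_quotient[OF E \<theta> B(1,3)] by linarith
  then have "pi * (\<theta> - \<eta>) \<le> pi * phi_minus C P E" by (simp add: algebra_simps)
  ultimately show ?thesis using phi_iff[OF False] by (simp add: ph_interval)
qed

text \<open>
  All \<open>P\<close>-phases of \<open>E\<close> are within \<open>1/3\<close> of \<open>\<theta>\<close>, where the projection \<open>g\<close> to the direction \<open>e\<^sup>i\<^sup>\<pi>\<^sup>\<theta>\<close> is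
  at least half the modulus.
\<close>

lemma semistable_support:
  assumes E: "E \<in> semistable W b \<theta>" and \<theta>: "b < \<theta>" "\<theta> \<le> b + 1"
    and \<eta>: "0 < \<eta>" "\<eta> \<le> 1 / 3" "2 * \<epsilon> \<le> c * sin (pi * \<eta>)" and \<epsilon>4: "4 * \<epsilon> \<le> c"
  shows "c / 4 * nrm (v E) \<le> cmod (W (v E))"
proof -
  define g where "g x = Re (cis (- (pi * \<theta>)) * Z x)" for x
  have "c * nrm (v E) \<le> 2 * g (v E)"
  proof (rule ph_support[OF semistable_close[OF E \<theta> \<eta>(1) _ \<eta>(3)]])
    show "\<eta> < 1 / 2" using \<eta> by simp
    show "g (x + y) = g x + g y" for x y by (simp add: g_def Z_add algebra_simps)
    fix \<phi> A assume \<phi>: "\<phi> \<in> {\<theta> - \<eta>..\<theta> + \<eta>}" and A: "A \<in> P \<phi>" "\<not> is_zero_obj C A"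
    obtain r where r: "0 < r" "r = cmod (Z (v A))" "cis (- (pi * \<theta>)) * Z (v A) = of_real r * cis (pi * (\<phi> - \<theta>))"
      using Z_rotated[OF A] .
    have "\<bar>\<phi> - \<theta>\<bar> \<le> \<eta>" using \<phi> by (simp add: abs_le_iff)
    then have "\<bar>\<phi> - \<theta>\<bar> \<le> 1 / 3" using \<eta>(2) by linarith
    then have "\<bar>pi * (\<phi> - \<theta>)\<bar> \<le> pi / 3" using mult_left_mono[of "\<bar>\<phi> - \<theta>\<bar>" "1/3" pi] by (simp add: abs_mult)
    then have "cos (pi / 3) \<le> cos \<bar>pi * (\<phi> - \<theta>)\<bar>" by (intro cos_monotone_0_pi_le) auto
    then have "1 / 2 \<le> cos (pi * (\<phi> - \<theta>))" by (simp add: cos_60)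
    then have "r * (1 / 2) \<le> r * cos (pi * (\<phi> - \<theta>))" using r(1) by (intro mult_left_mono) auto
    moreover have "g (v A) = r * cos (pi * (\<phi> - \<theta>))" unfolding g_def r(3) by simp
    ultimately show "cmod (Z (v A)) \<le> 2 * g (v A)" using r(2) by simp
  qed simp
  also have "g (v E) \<le> cmod (Z (v E))"
    unfolding g_def using complex_Re_le_cmod[of "cis (- (pi * \<theta>)) * Z (v E)"] by (simp only: norm_mult norm_cis mult_1_left)
  also have "cmod (Z (v E)) \<le> cmod (W (v E)) + \<epsilon> * nrm (v E)"
    using W_close[of "v E"] norm_triangle_ineq3[of "W (v E)" "Z (v E)"] by linarith
  finally have "c * nrm (v E) \<le> 2 * (cmod (W (v E)) + \<epsilon> * nrm (v E))" by simp
  moreover have "4 * \<epsilon> * nrm (v E) \<le> c * nrm (v E)" using \<epsilon>4 nrm_nonneg by (intro mult_right_mono) auto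
  ultimately show ?thesis by (simp add: algebra_simps)
qed

end

context stability
begin

lemma semistable_iso:
  assumes "E \<in> semistable W b \<theta>" "isomorphic C E E'" shows "E' \<in> semistable W b \<theta>"
proof -
  have "ses b F E R" if "ses b F E' R" for F R
    using ses_iso[OF that isomorphic_refl isomorphic_sym[OF assms(2)] isomorphic_refl] .
  then show ?thesis
    using assms(1) heart_iso[OF _ assms(2)] unfolding semistable_def mem_Collect_eq v_iso[OF assms(2)] by blast
qed

lemma semistable_sh_iff:
  assumes W: "\<And>x y. W (x + y) = W x + W y"
  shows "sh C E \<in> semistable W (b + 1) (\<theta> + 1) \<longleftrightarrow> E \<in> semistable W b \<theta>"
proof -
  have W0: "W 0 = 0" using W[of 0 0] by simp
  have "W (- x) = - W x" for x using W[of x "- x"] W0 by (simp add: eq_neg_iff_add_eq_0 add.commute)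
  moreover have "cis (- (pi * (\<theta> + 1))) = - cis (- (pi * \<theta>))"
    by (simp add: complex_eq_iff distrib_left cos_add sin_add)
  ultimately have W_sh: "Im (cis (- (pi * (\<theta> + 1))) * W (v (sh C X))) = Im (cis (- (pi * \<theta>)) * W (v X))" for X
    by (simp add: v_sh)
  have lift: "\<exists>F' R'. isomorphic C F (sh C F') \<and> ses b F' E R'" if "ses (b + 1) F (sh C E) R" for F R
  proof -
    obtain F' R' where i: "isomorphic C F (sh C F')" "isomorphic C R (sh C R')" using sh_ess_surj by meson
    then have "ses (b + 1) (sh C F') (sh C E) (sh C R')" using ses_iso[OF that _ isomorphic_refl] by blast
    then show ?thesis using i ses_sh_iff by blast
  qed
  show ?thesis
  proof
    assume S: "sh C E \<in> semistable W (b + 1) (\<theta> + 1)"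
    have "Im (cis (- (pi * \<theta>)) * W (v F)) \<le> 0" if "ses b F E R" for F R
    proof -
      have "ses (b + 1) (sh C F) (sh C E) (sh C R)" using that by (simp add: ses_sh_iff)
      then have "Im (cis (- (pi * (\<theta> + 1))) * W (v (sh C F))) \<le> 0" using S unfolding semistable_def by blast
      then show ?thesis by (simp only: W_sh)
    qed
    moreover have "Im (cis (- (pi * (\<theta> + 1))) * W (v (sh C E))) = 0" "sh C E \<in> heart (b + 1)"
      using S unfolding semistable_def by blast+
    ultimately show "E \<in> semistable W b \<theta>" unfolding semistable_def mem_Collect_eq W_sh heart_sh_iff by blast
  next
    assume S: "E \<in> semistable W b \<theta>"
    have "Im (cis (- (pi * (\<theta> + 1))) * W (v F)) \<le> 0" if F: "ses (b + 1) F (sh C E) R" for F R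
    proof -
      obtain F' R' where F': "isomorphic C F (sh C F')" "ses b F' E R'" using lift[OF F] by blast
      have "Im (cis (- (pi * \<theta>)) * W (v F')) \<le> 0" using S F'(2) unfolding semistable_def by blast
      then show ?thesis using v_iso[OF F'(1)] W_sh[of F'] by simp
    qed
    moreover have "Im (cis (- (pi * \<theta>)) * W (v E)) = 0" "E \<in> heart b"
      using S unfolding semistable_def by blast+
    ultimately show "sh C E \<in> semistable W (b + 1) (\<theta> + 1)" unfolding semistable_def mem_Collect_eq W_sh heart_sh_iff by blast
  qed
qed

text \<open>
  A zero object could a priori have a subobject \<open>F\<close> with quotient \<open>F[1]\<close>, but \<open>F\<close> and \<open>F[1]\<close> are not both in
  the heart unless they vanish.
\<close>

lemma semistable_zero:
  assumes W: "W 0 = 0" and "is_zero_obj C E" shows "E \<in> semistable W b \<theta>"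
proof -
  have "v F = 0" if s: "ses b F E R" for F R
  proof -
    have iso: "isomorphic C R (sh C F)" using tri_zero_middle s assms(2) unfolding ses_def by blast
    have FR: "F \<in> heart b" "R \<in> heart b" using s unfolding ses_def by auto
    then have R: "R \<in> heart (b + 1)" using heart_iso[OF _ isomorphic_sym[OF iso]] heart_sh_iff by blast
    have "Hom C R R = {0}"
      using R FR(2) unfolding heart_def by (rule ph_Hom_zero) auto
    then have "is_zero_obj C R" by (simp add: is_zero_obj_iff_Hom)
    then show ?thesis using v_tri[of F E R] s v_zero assms(2) unfolding ses_def by simp
  qed
  then show ?thesis unfolding semistable_def using W heart_zero v_zero assms(2) by auto
qed

end

section \<open>The deformed slicing\<close>

lemma HN_in_weaken:
  assumes "HN_in C P I E" "\<And>\<theta>. \<theta> \<in> I \<Longrightarrow> P \<theta> \<subseteq> Q \<theta>" shows "HN_in C Q I E"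
proof -
  obtain m t X A where c: "HN_chain C P E m t X A" "\<forall>i<m. t i \<in> I"
    using assms(1) unfolding HN_in_def by blast
  then have "HN_chain C Q E m t X A" using assms(2) unfolding HN_chain_def by blast
  then show ?thesis using c(2) unfolding HN_in_def by blast
qed

lemma cis_int_pi: "cis (- (pi * of_int n)) = of_real (cos (pi * of_int n))"
  by (simp add: complex_eq_iff sin_npi_int)

context phase_family
begin

lemma ph_empty: "E \<in> ph {} \<longleftrightarrow> is_zero_obj C E"
  using ph_zero[of E "{}"] ph_Hom_zero[of E "{}" E "{}"] is_zero_obj_iff_Hom by auto

lemma split_off_heart:
  assumes E: "E \<in> ph {s<..s + 1 + d}" and d: "0 \<le> d"
  obtains X Y where "tri C X E Y" "X \<in> ph {s + 1<..s + 1 + d}" "Y \<in> heart s"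
proof -
  obtain X Y where XY: "tri C X E Y" "X \<in> ph {s + 1<..}" "Y \<in> ph {..s + 1}"
    using truncation[of "{s + 1<..}" E] by auto
  have "X \<in> ph (- {s + 1 + d<..})"
    using ph_down_sub[of "{s + 1 + d<..}" X E Y "{..s + 1}"] XY E d by (auto simp: ph_interval)
  then have X: "X \<in> ph {s + 1<..s + 1 + d}" using XY ph_interval by simp
  have "sh C X \<in> ph {s<..}" using ph_sh[OF X, of "{s<..}"] by auto
  then have "Y \<in> ph {s<..}" using ph_up_quotient[of "{s<..}" X E Y] XY E by (simp add: ph_interval)
  then have "Y \<in> heart s" using XY by (simp add: heart_iff)
  then show thesis using that X XY by blast
qed

end

context stability
begin

text \<open>
  The hearts \<open>P((a + n, a + n + 1])\<close> for integers \<open>n\<close> cover all phases, and the hypothesis on \<open>W\<close> is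
  the same for each of them, as \<open>e\<^sup>i\<^sup>\<pi>\<^sup>n\<close> is a sign.  A semistable object of phase \<open>\<theta>\<close> is formed in the heart
  whose strip contains \<open>\<theta>\<close>.  An arbitrary object is cut into finitely many pieces in these hearts,
  whose filtrations are glued.
\<close>

theorem exists_deformed_slicing:
  fixes W :: "'l \<Rightarrow> complex"
  assumes W_add: "\<And>x y. W (x + y) = W x + W y"
    and W_Im: "\<And>x. Im (cis (- (pi * a)) * W x) = Im (cis (- (pi * a)) * Z x)"
    and W_close: "\<And>x. cmod (W x - Z x) \<le> \<epsilon> * nrm x"
    and \<epsilon>: "0 \<le> \<epsilon>" "4 * \<epsilon> \<le> c"
    and \<eta>: "0 < \<eta>" "\<eta> \<le> 1 / 3" "2 * \<epsilon> \<le> c * sin (pi * \<eta>)"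
  shows "\<exists>Q. is_slicing C Q \<and>
    (\<forall>\<theta> E. E \<in> Q \<theta> \<longrightarrow> \<not> is_zero_obj C E \<longrightarrow> (\<exists>r>0. W (v E) = of_real r * cis (pi * \<theta>))) \<and>
    (\<forall>\<theta>. Q \<theta> \<subseteq> ph {\<theta> - \<eta>..\<theta> + \<eta>}) \<and>
    (\<forall>\<theta> E. E \<in> Q \<theta> \<longrightarrow> c / 4 * nrm (v E) \<le> cmod (W (v E)))"
proof -
  have D: "deformation C P nrm v Z c W (a + of_int n) \<epsilon>" for n
  proof unfold_locales
    have "cis (- (pi * (a + of_int n))) = of_real (cos (pi * of_int n)) * cis (- (pi * a))"
      unfolding cis_int_pi[symmetric] cis_mult by (simp add: distrib_left add.commute)
    moreover have "Im (of_real r * u) = r * Im u" for r u by simp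
    ultimately have *: "Im (cis (- (pi * (a + of_int n))) * u) = cos (pi * of_int n) * Im (cis (- (pi * a)) * u)" for u
      by (simp only: mult.assoc)
    show "Im (cis (- (pi * (a + of_int n))) * W x) = Im (cis (- (pi * (a + of_int n))) * Z x)" for x
      unfolding * W_Im ..
  qed (use W_add W_close \<epsilon> c_pos in auto)
  define base where "base \<theta> = a + of_int (\<lceil>\<theta> - a\<rceil> - 1)" for \<theta>
  have base: "base \<theta> < \<theta>" "\<theta> \<le> base \<theta> + 1" for \<theta> unfolding base_def by linarith+
  have base_shift: "base (\<theta> + 1) = base \<theta> + 1" for \<theta>
  proof -
    have "\<lceil>\<theta> + 1 - a\<rceil> = \<lceil>\<theta> - a\<rceil> + 1" by (metis add_diff_eq add.commute ceiling_add_one diff_add_eq)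
    then show ?thesis by (simp add: base_def)
  qed
  have D': "deformation C P nrm v Z c W (base \<theta>) \<epsilon>" for \<theta> unfolding base_def by (rule D)
  define Q where "Q \<theta> = semistable W (base \<theta>) \<theta>" for \<theta>
  have W0: "W 0 = 0" using W_add[of 0 0] by simp
  have Q_heart: "\<theta> \<le> a + of_int n + 1 \<Longrightarrow> a + of_int n < \<theta> \<Longrightarrow> Q \<theta> = semistable W (a + of_int n) \<theta>" for \<theta> n
  proof -
    assume "\<theta> \<le> a + of_int n + 1" "a + of_int n < \<theta>"
    then have "\<lceil>\<theta> - a\<rceil> = n + 1" by (intro ceiling_unique) auto
    then show "Q \<theta> = semistable W (a + of_int n) \<theta>" by (simp add: Q_def base_def)
  qed
  have HN: "HN_in C Q {a + of_int n<..} E" if "E \<in> ph {a + of_int n<..a + of_int n + of_nat k}" for n k E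
    using that
  proof (induction k arbitrary: n E)
    case 0
    then show ?case using HN_in_zero by (simp add: ph_empty)
  next
    case (Suc k)
    have "E \<in> ph {a + of_int n<..a + of_int n + 1 + of_nat k}" using Suc.prems by (simp add: add_ac)
    then obtain X Y where XY: "tri C X E Y" "X \<in> ph {a + of_int n + 1<..a + of_int n + 1 + of_nat k}"
      "Y \<in> heart (a + of_int n)"
      using split_off_heart by (metis of_nat_0_le_iff)
    have X: "HN_in C Q {a + of_int (n + 1)<..} X"
      using Suc.IH[of X "n + 1"] XY(2) by (simp add: add_ac)
    have Y: "HN_in C Q {a + of_int n<..a + of_int n + 1} Y"
    proof (cases "is_zero_obj C Y")
      case True then show ?thesis by (rule HN_in_zero)
    next
      case False
      have "HN_in C (semistable W (a + of_int n)) {a + of_int n<..a + of_int n + 1} Y"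
        by (rule HN_in_mono[OF deformation.heart_HN[OF D XY(3) False]]) auto
      then show ?thesis by (rule HN_in_weaken) (use Q_heart in auto)
    qed
    have "HN_in C Q ({a + of_int (n + 1)<..} \<union> {a + of_int n<..a + of_int n + 1}) E"
      by (rule HN_in_glue[OF X Y XY(1)]) auto
    then show ?case by (rule HN_in_mono) auto
  qed
  have "phase_family C Q"
  proof unfold_locales
    show "X \<in> Q \<theta>" if "is_zero_obj C X" for X \<theta> unfolding Q_def by (rule semistable_zero[of W, OF W0 that])
    show "Y \<in> Q \<theta>" if "X \<in> Q \<theta>" "isomorphic C X Y" for X Y \<theta>
      using that unfolding Q_def by (rule semistable_iso)
    show "{E. \<exists>F \<in> Q \<theta>. isomorphic C E (sh C F)} = Q (\<theta> + 1)" for \<theta>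
    proof (intro subset_antisym subsetI)
      fix E assume "E \<in> {E. \<exists>F \<in> Q \<theta>. isomorphic C E (sh C F)}"
      then obtain F where "F \<in> Q \<theta>" "isomorphic C E (sh C F)" by blast
      then show "E \<in> Q (\<theta> + 1)"
        using semistable_iso[OF _ isomorphic_sym] semistable_sh_iff[of W, OF W_add]
        unfolding Q_def base_shift by blast
    next
      fix E assume E: "E \<in> Q (\<theta> + 1)"
      obtain F where F: "isomorphic C E (sh C F)" using sh_ess_surj by blast
      then have "sh C F \<in> semistable W (base \<theta> + 1) (\<theta> + 1)"
        using E semistable_iso unfolding Q_def base_shift by blast
      then have "F \<in> Q \<theta>" unfolding Q_def by (simp add: semistable_sh_iff[of W, OF W_add])
      then show "E \<in> {E. \<exists>F \<in> Q \<theta>. isomorphic C E (sh C F)}" using F by blast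
    qed
    show "Hom C F1 F2 = {0}" if "\<theta>1 > \<theta>2" "F1 \<in> Q \<theta>1" "F2 \<in> Q \<theta>2" for \<theta>1 \<theta>2 F1 F2
    proof (cases "base \<theta>1 = base \<theta>2")
      case True
      then show ?thesis
        using deformation.semistable_Hom_zero[OF D' base(1)[of \<theta>2] \<open>\<theta>1 > \<theta>2\<close>] base(2)[of \<theta>1] that
        unfolding Q_def by simp
    next
      case False
      have "\<lceil>\<theta>2 - a\<rceil> \<le> \<lceil>\<theta>1 - a\<rceil>" using that(1) by (intro ceiling_mono) simp
      moreover have "\<lceil>\<theta>2 - a\<rceil> \<noteq> \<lceil>\<theta>1 - a\<rceil>" using False unfolding base_def by auto
      ultimately have "base \<theta>2 + 1 \<le> base \<theta>1" unfolding base_def by linarith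
      moreover have "F1 \<in> ph {base \<theta>1<..base \<theta>1 + 1}" "F2 \<in> ph {base \<theta>2<..base \<theta>2 + 1}"
        using that unfolding Q_def semistable_def heart_def by auto
      ultimately show ?thesis by (intro ph_Hom_zero) auto
    qed
    show "\<exists>m t. HN_filtration C Q E m t" if E: "\<not> is_zero_obj C E" for E
    proof -
      define n where "n = \<lceil>phi_minus C P E - a\<rceil> - 1"
      define k where "k = nat \<lceil>phi_plus C P E - a - of_int n\<rceil>"
      have "a + of_int n < phi_minus C P E" unfolding n_def by linarith
      moreover have "phi_plus C P E \<le> a + of_int n + of_nat k" unfolding k_def by linarith
      ultimately have "E \<in> ph {a + of_int n<..a + of_int n + of_nat k}" using phi_iff[OF E] by (simp add: ph_interval)
      then show ?thesis using HN_in_imp_filtration[OF HN E] by blast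
    qed
  qed
  then have "is_slicing C Q" by (rule phase_family.slicing)
  moreover have "\<exists>r>0. W (v E) = of_real r * cis (pi * \<theta>)" if "E \<in> Q \<theta>" "\<not> is_zero_obj C E" for E \<theta>
    using deformation.semistable_W[OF D' _ that(2) base] that(1) unfolding Q_def .
  moreover have "Q \<theta> \<subseteq> ph {\<theta> - \<eta>..\<theta> + \<eta>}" for \<theta>
    using deformation.semistable_close[OF D' _ base \<eta>(1) _ \<eta>(3)] \<eta>(2) unfolding Q_def by auto
  moreover have "c / 4 * nrm (v E) \<le> cmod (W (v E))" if "E \<in> Q \<theta>" for E \<theta>
    using deformation.semistable_support[OF D' _ base \<eta> \<epsilon>(2)] that unfolding Q_def .
  ultimately show ?thesis by (intro exI[of _ Q] conjI allI impI)
qed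

end

section \<open>Distance of slicings\<close>

lemma slicing_dist_commute: "slicing_dist C P P' = slicing_dist C P' P"
  unfolding slicing_dist_def by (simp add: abs_minus_commute)

lemma slicing_dist_refl [simp]: "slicing_dist C P P = 0"
proof -
  have "slicing_dist C P P \<le> 0" unfolding slicing_dist_def by (intro SUP_least) simp
  then show ?thesis by simp
qed

lemma phase_difference_le_dist:
  assumes "\<not> is_zero_obj C E"
  shows "ennreal \<bar>phi_plus C P E - phi_plus C P' E\<bar> \<le> slicing_dist C P P'"
    "ennreal \<bar>phi_minus C P E - phi_minus C P' E\<bar> \<le> slicing_dist C P P'"
proof -
  have "max (ennreal \<bar>phi_plus C P E - phi_plus C P' E\<bar>) (ennreal \<bar>phi_minus C P E - phi_minus C P' E\<bar>)
      \<le> slicing_dist C P P'"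
    unfolding slicing_dist_def using assms by (intro SUP_upper) simp
  then show "ennreal \<bar>phi_plus C P E - phi_plus C P' E\<bar> \<le> slicing_dist C P P'"
    "ennreal \<bar>phi_minus C P E - phi_minus C P' E\<bar> \<le> slicing_dist C P P'" by auto
qed

lemma phase_difference_le:
  assumes "slicing_dist C P P' \<le> ennreal e" "0 \<le> e" "\<not> is_zero_obj C E"
  shows "\<bar>phi_plus C P E - phi_plus C P' E\<bar> \<le> e" "\<bar>phi_minus C P E - phi_minus C P' E\<bar> \<le> e"
  using phase_difference_le_dist[OF assms(3), of P P'] assms(1,2)
  by (meson ennreal_le_iff order_trans)+

lemma slicing_dist_leI:
  assumes "\<And>E. \<not> is_zero_obj C E \<Longrightarrow> \<bar>phi_plus C P E - phi_plus C P' E\<bar> \<le> e"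
    "\<And>E. \<not> is_zero_obj C E \<Longrightarrow> \<bar>phi_minus C P E - phi_minus C P' E\<bar> \<le> e"
  shows "slicing_dist C P P' \<le> ennreal e"
  unfolding slicing_dist_def using assms by (intro SUP_least) (simp add: ennreal_leI)

lemma slicing_dist_triangle:
  "slicing_dist C P R \<le> slicing_dist C P S + slicing_dist C S R"
proof -
  have *: "ennreal \<bar>x - z\<bar> \<le> A + B" if "ennreal \<bar>x - y\<bar> \<le> A" "ennreal \<bar>y - z\<bar> \<le> B" for x y z :: real and A B
  proof -
    have "ennreal \<bar>x - z\<bar> \<le> ennreal (\<bar>x - y\<bar> + \<bar>y - z\<bar>)" by (intro ennreal_leI) simp
    also have "\<dots> = ennreal \<bar>x - y\<bar> + ennreal \<bar>y - z\<bar>" by simp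
    also have "\<dots> \<le> A + B" using that by (rule add_mono)
    finally show ?thesis .
  qed
  show ?thesis
    unfolding slicing_dist_def[of C P R]
    by (intro SUP_least max.boundedI) (auto intro!: *[OF phase_difference_le_dist(1) phase_difference_le_dist(1)]
        *[OF phase_difference_le_dist(2) phase_difference_le_dist(2)])
qed

lemma ennreal_less_1_obtain:
  assumes "(x::ennreal) < 1" obtains e where "0 \<le> e" "e < 1" "x = ennreal e"
  using assms by (cases x) auto

lemma sin_pi_mono: assumes "0 \<le> x" "x \<le> y" "y \<le> 1 / 2" shows "sin (pi * x) \<le> sin (pi * y)"
proof (rule sin_monotone_2pi_le)
  have "0 \<le> pi * x" using assms by simp
  then show "- (pi / 2) \<le> pi * x" using pi_gt_zero by linarith
  show "pi * x \<le> pi * y" using assms by simp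
  show "pi * y \<le> pi / 2" using mult_left_mono[OF assms(3), of pi] by simp
qed

locale two_slicings = A: phase_family C P + B: phase_family C Q
  for C :: "('o, 'm::ab_group_add, 'k::field) tricat" and P Q
begin

lemma ph_compare_up:
  assumes "up_closed H" "\<And>\<theta>. \<theta> \<in> I \<Longrightarrow> Q \<theta> \<subseteq> A.ph H" "E \<in> B.ph I" shows "E \<in> A.ph H"
  using assms(3)
proof (induction rule: B.ph_induct)
  case (step X E F \<theta>)
  then show ?case using A.ph_up_ext[OF assms(1) \<open>tri C X E F\<close>] assms(2) by blast
qed (rule A.ph_zero)

lemma ph_compare_down:
  assumes "up_closed H" "\<And>\<theta>. \<theta> \<in> I \<Longrightarrow> Q \<theta> \<subseteq> A.ph (- H)" "E \<in> B.ph I" shows "E \<in> A.ph (- H)"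
  using assms(3)
proof (induction rule: B.ph_induct)
  case (step X E F \<theta>)
  then show ?case using A.ph_down_ext[OF assms(1) \<open>tri C X E F\<close>] assms(2) by blast
qed (rule A.ph_zero)

lemma dual_cut_down:
  assumes "up_closed H" "up_closed K" "B.ph H \<subseteq> A.ph K" shows "A.ph (- K) \<subseteq> B.ph (- H)"
proof
  fix E assume E: "E \<in> A.ph (- K)"
  show "E \<in> B.ph (- H)"
    by (rule B.ph_downI[OF assms(1)]) (use A.ph_orth[OF assms(2) _ E] assms(3) in blast)
qed

lemma dual_cut_up:
  assumes "up_closed H" "up_closed K" "B.ph (- H) \<subseteq> A.ph (- K)" shows "A.ph K \<subseteq> B.ph H"
proof
  fix E assume E: "E \<in> A.ph K"
  show "E \<in> B.ph H"
    by (rule B.ph_upI[OF assms(1)]) (use A.ph_orth[OF assms(2) E] assms(3) in blast)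
qed

text \<open>
  The hypothesis compares the truncations in one direction only; passing to orthogonals gives the
  other one.
\<close>

lemma slicing_dist_le_of_phases:
  assumes Q: "\<And>\<theta>. Q \<theta> \<subseteq> A.ph {\<theta> - e..\<theta> + e}"
  shows "slicing_dist C P Q \<le> ennreal e"
proof (rule slicing_dist_leI)
  have QJ: "Q \<theta> \<subseteq> A.ph J" if "{\<theta> - e..\<theta> + e} \<subseteq> J" for \<theta> J
    by (rule subsetI, rule A.ph_mono[OF subsetD[OF Q] that])
  have up: "B.ph {a..} \<subseteq> A.ph {a - e..}" "B.ph {a<..} \<subseteq> A.ph {a - e<..}" for a
  proof -
    have "E \<in> A.ph {a - e..}" if "E \<in> B.ph {a..}" for E
      by (rule ph_compare_up[OF _ QJ that]) auto
    moreover have "E \<in> A.ph {a - e<..}" if "E \<in> B.ph {a<..}" for E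
      by (rule ph_compare_up[OF _ QJ that]) auto
    ultimately show "B.ph {a..} \<subseteq> A.ph {a - e..}" "B.ph {a<..} \<subseteq> A.ph {a - e<..}" by auto
  qed
  have down: "B.ph {..a} \<subseteq> A.ph {..a + e}" "B.ph {..<a} \<subseteq> A.ph {..<a + e}" for a
  proof -
    have "E \<in> A.ph (- {a + e<..})" if "E \<in> B.ph {..a}" for E
      by (rule ph_compare_down[OF _ QJ that]) auto
    moreover have "E \<in> A.ph (- {a + e..})" if "E \<in> B.ph {..<a}" for E
      by (rule ph_compare_down[OF _ QJ that]) auto
    ultimately show "B.ph {..a} \<subseteq> A.ph {..a + e}" "B.ph {..<a} \<subseteq> A.ph {..<a + e}" by auto
  qed
  have up': "A.ph {a..} \<subseteq> B.ph {a - e..}" for a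
    using dual_cut_up[of "{a - e..}" "{a..}"] down(2)[of "a - e"] by simp
  have down': "A.ph {..a} \<subseteq> B.ph {..a + e}" for a
    using dual_cut_down[of "{a + e<..}" "{a<..}"] up(2)[of "a + e"] by simp
  fix E assume E: "\<not> is_zero_obj C E"
  have "E \<in> A.ph {..phi_plus C Q E + e}" using down(1) B.phi_iff(1)[OF E] by blast
  moreover have "E \<in> B.ph {..phi_plus C P E + e}" using down' A.phi_iff(1)[OF E] by blast
  ultimately show "\<bar>phi_plus C P E - phi_plus C Q E\<bar> \<le> e"
    using A.phi_iff(1)[OF E] B.phi_iff(1)[OF E] by force
  have "E \<in> A.ph {phi_minus C Q E - e..}" using up(1) B.phi_iff(3)[OF E] by blast
  moreover have "E \<in> B.ph {phi_minus C P E - e..}" using up' A.phi_iff(3)[OF E] by blast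
  ultimately show "\<bar>phi_minus C P E - phi_minus C Q E\<bar> \<le> e"
    using A.phi_iff(3)[OF E] B.phi_iff(3)[OF E] by force
qed

end

context stability
begin

lemma Im_integer_rotation: "Im (cis (- (pi * of_int n)) * u) = cos (pi * of_int n) * Im u"
  unfolding cis_int_pi by simp

text \<open>
  The factor \<open>cos (\<pi> n)\<close> is the sign \<open>(-1)\<^sup>n\<close>.
\<close>

lemma Im_pos_interior:
  assumes E: "E \<in> ph {real_of_int n<..<of_int n + 1}" "\<not> is_zero_obj C E"
  shows "0 < cos (pi * of_int n) * Im (Z (v E))"
proof (rule ph_positive[OF E, where h = "\<lambda>x. cos (pi * of_int n) * Im (Z x)"])
  fix \<theta> A assume \<theta>: "\<theta> \<in> {real_of_int n<..<of_int n + 1}" and A: "A \<in> P \<theta>" "\<not> is_zero_obj C A"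
  obtain r where r: "0 < r" "cis (- (pi * of_int n)) * Z (v A) = of_real r * cis (pi * (\<theta> - of_int n))"
    using Z_rotated[OF A] by metis
  have "0 < sin (pi * (\<theta> - of_int n))" using \<theta> by (intro sin_gt_zero) auto
  then have "0 < Im (cis (- (pi * of_int n)) * Z (v A))" unfolding r(2) using r(1) by simp
  then show "0 < cos (pi * of_int n) * Im (Z (v A))" unfolding Im_integer_rotation .
qed (simp only: Z_add plus_complex.simps distrib_left)

lemma Im_nonneg_closed:
  assumes E: "E \<in> ph {real_of_int n..of_int n + 1}"
  shows "0 \<le> cos (pi * of_int n) * Im (Z (v E))"
proof (rule ph_superadditive[OF E, where h = "\<lambda>x. cos (pi * of_int n) * Im (Z x)"])
  fix \<theta> A assume \<theta>: "\<theta> \<in> {real_of_int n..of_int n + 1}" and A: "A \<in> P \<theta>"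
  show "0 \<le> cos (pi * of_int n) * Im (Z (v A))"
  proof (cases "is_zero_obj C A")
    case False
    obtain r where r: "0 < r" "cis (- (pi * of_int n)) * Z (v A) = of_real r * cis (pi * (\<theta> - of_int n))"
      using Z_rotated[OF A False] by metis
    have "0 \<le> sin (pi * (\<theta> - of_int n))"
      using \<theta> mult_left_mono[of "\<theta> - of_int n" 1 pi] by (intro sin_ge_zero) auto
    then have "0 \<le> Im (cis (- (pi * of_int n)) * Z (v A))" unfolding r(2) using r(1) by simp
    then show ?thesis unfolding Im_integer_rotation .
  qed (simp add: v_zero)
qed (simp_all add: Z_add distrib_left)

end

locale two_stabilities = A: stability C P nrm v Z c + B: stability C Q nrm v Y d
  for C :: "('o, 'm::ab_group_add, 'k::field) tricat" and P
    and nrm :: "'l::ab_group_add \<Rightarrow> real" and v Z c Q Y d +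
  assumes Im_eq: "Im (Z x) = Im (Y x)" and dist_less_1: "slicing_dist C P Q < 1"
begin

sublocale two_slicings C P Q by unfold_locales

lemma phases_close:
  assumes "\<not> is_zero_obj C E"
  shows "\<bar>phi_plus C P E - phi_plus C Q E\<bar> < 1" "\<bar>phi_minus C P E - phi_minus C Q E\<bar> < 1"
proof -
  obtain e where e: "0 \<le> e" "e < 1" "slicing_dist C P Q = ennreal e"
    using ennreal_less_1_obtain[OF dist_less_1] .
  then show "\<bar>phi_plus C P E - phi_plus C Q E\<bar> < 1" "\<bar>phi_minus C P E - phi_minus C Q E\<bar> < 1"
    using phase_difference_le[of C P Q e E] assms by force+
qed

lemma ph_close:
  "A.ph {a<..} \<subseteq> B.ph {a - 1<..}" "A.ph {a..} \<subseteq> B.ph {a - 1<..}" "B.ph {a..} \<subseteq> A.ph {a - 1<..}"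
  "B.ph {..a} \<subseteq> A.ph {..<a + 1}"
proof -
  have *: "E \<in> B.ph {a - 1<..}" if "E \<in> A.ph {a..}" for a E
  proof (cases "is_zero_obj C E")
    case False
    then show ?thesis using phases_close[OF False] that A.phi_iff(3)[OF False] B.phi_iff(4)[OF False] by force
  qed (rule B.ph_zero)
  then show "A.ph {a..} \<subseteq> B.ph {a - 1<..}" by blast
  then show "A.ph {a<..} \<subseteq> B.ph {a - 1<..}" 
    using A.ph_mono[of _ "{a<..}" "{a..}"] by (meson atLeast_iff greaterThan_iff less_imp_le subset_iff)
  have "E \<in> A.ph {a - 1<..}" if "E \<in> B.ph {a..}" for a E
  proof (cases "is_zero_obj C E")
    case False
    then show ?thesis using phases_close[OF False] that B.phi_iff(3)[OF False] A.phi_iff(4)[OF False] by force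
  qed (rule A.ph_zero)
  then show "B.ph {a..} \<subseteq> A.ph {a - 1<..}" by blast
  have "E \<in> A.ph {..<a + 1}" if "E \<in> B.ph {..a}" for a E
  proof (cases "is_zero_obj C E")
    case False
    then show ?thesis using phases_close[OF False] that B.phi_iff(1)[OF False] A.phi_iff(2)[OF False] by force
  qed (rule A.ph_zero)
  then show "B.ph {..a} \<subseteq> A.ph {..<a + 1}" by blast
qed

text \<open>
  The lower part \<open>R\<close> of \<open>E\<close> at \<open>n\<close> for \<open>Q\<close> has \<open>Q\<close>-phases in \<open>(n - 1, n]\<close>, since \<open>E\<close> has \<open>Q\<close>-phases above
  \<open>n - 1\<close>; and it has \<open>P\<close>-phases in \<open>(n, n + 1)\<close>.  The sign of the common imaginary part is different
  on these strips, so \<open>R = 0\<close>.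
\<close>

lemma integer_cut_greater: "A.ph {real_of_int n<..} \<subseteq> B.ph {real_of_int n<..}"
proof
  fix E assume E: "E \<in> A.ph {real_of_int n<..}"
  obtain X R where XR: "tri C X E R" "X \<in> B.ph {real_of_int n<..}" "R \<in> B.ph {..real_of_int n}"
    using B.truncation[of "{real_of_int n<..}" E] by auto
  have shX: "sh C X \<in> B.ph {real_of_int n + 1..}" by (rule B.ph_sh[OF XR(2)]) auto
  have "sh C X \<in> A.ph {real_of_int n<..}" using shX ph_close(3)[of "real_of_int n + 1"] by auto
  then have RA: "R \<in> A.ph {real_of_int n<..}" using A.ph_up_quotient[OF _ XR(1) E] by simp
  have "sh C X \<in> B.ph {real_of_int n - 1<..}" using shX by (rule B.ph_mono) auto
  moreover have "E \<in> B.ph {real_of_int n - 1<..}" using E ph_close(1) by blast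
  ultimately have "R \<in> B.ph {real_of_int n - 1<..}" using B.ph_up_quotient[OF _ XR(1)] by simp
  then have "R \<in> B.ph {real_of_int n - 1<..real_of_int n}"
    using XR(3) B.ph_interval(1)[of R "real_of_int n - 1" "real_of_int n"] by blast
  then have RB: "R \<in> B.ph {real_of_int (n - 1)..of_int (n - 1) + 1}" by (rule B.ph_mono) auto
  have "R \<in> A.ph {..<real_of_int n + 1}" using XR(3) ph_close(4) by blast
  then have RA: "R \<in> A.ph {real_of_int n<..<of_int n + 1}" using RA A.ph_interval by simp
  have "is_zero_obj C R"
  proof (rule ccontr)
    assume "\<not> is_zero_obj C R"
    then have "0 < cos (pi * of_int n) * Im (Z (v R))" by (rule A.Im_pos_interior[OF RA])
    moreover have "0 \<le> cos (pi * of_int (n - 1)) * Im (Y (v R))" by (rule B.Im_nonneg_closed[OF RB])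
    moreover have "cos (pi * of_int (n - 1)) = - cos (pi * of_int n)"
      by (simp add: right_diff_distrib cos_diff)
    ultimately show False by (simp add: Im_eq)
  qed
  then show "E \<in> B.ph {real_of_int n<..}"
    using B.ph_iso[OF XR(2) A.tri_iso_of_zero_right[OF XR(1)]] by blast
qed

lemma integer_cut_atLeast: "A.ph {real_of_int n..} \<subseteq> B.ph {real_of_int n..}"
proof
  fix E assume E: "E \<in> A.ph {real_of_int n..}"
  obtain X R where XR: "tri C X E R" "X \<in> B.ph {real_of_int n..}" "R \<in> B.ph {..<real_of_int n}"
    using B.truncation[of "{real_of_int n..}" E] by auto
  have shX: "sh C X \<in> B.ph {real_of_int n + 1..}" by (rule B.ph_sh[OF XR(2)]) auto
  have "sh C X \<in> A.ph {real_of_int n<..}" using shX ph_close(3)[of "real_of_int n + 1"] by auto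
  then have "sh C X \<in> A.ph {real_of_int n..}" by (rule A.ph_mono) auto
  then have RA: "R \<in> A.ph {real_of_int n..}" using A.ph_up_quotient[OF _ XR(1) E] by simp
  have "sh C X \<in> B.ph {real_of_int n - 1<..}" using shX by (rule B.ph_mono) auto
  moreover have "E \<in> B.ph {real_of_int n - 1<..}" using E ph_close(2) by blast
  ultimately have "R \<in> B.ph {real_of_int n - 1<..}" using B.ph_up_quotient[OF _ XR(1)] by simp
  then have RB: "R \<in> B.ph {real_of_int (n - 1)<..<of_int (n - 1) + 1}"
    using XR(3) B.ph_interval(3)[of R "real_of_int n - 1"] by simp
  have "R \<in> B.ph {..real_of_int n}" using XR(3) by (rule B.ph_mono) auto
  then have "R \<in> A.ph {..<real_of_int n + 1}" using ph_close(4) by blast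
  then have "R \<in> A.ph {..real_of_int n + 1}" by (rule A.ph_mono) auto
  then have RA: "R \<in> A.ph {real_of_int n..of_int n + 1}" using RA A.ph_interval by simp
  have "is_zero_obj C R"
  proof (rule ccontr)
    assume "\<not> is_zero_obj C R"
    then have "0 < cos (pi * of_int (n - 1)) * Im (Y (v R))" by (rule B.Im_pos_interior[OF RB])
    moreover have "0 \<le> cos (pi * of_int n) * Im (Z (v R))" by (rule A.Im_nonneg_closed[OF RA])
    moreover have "cos (pi * of_int (n - 1)) = - cos (pi * of_int n)"
      by (simp add: right_diff_distrib cos_diff)
    ultimately show False by (simp add: Im_eq)
  qed
  then show "E \<in> B.ph {real_of_int n..}"
    using B.ph_iso[OF XR(2) A.tri_iso_of_zero_right[OF XR(1)]] by blast
qed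

text \<open>
  On objects with \<open>Q\<close>-phases in \<open>[n + \<rho>, n + 1 - \<rho>]\<close> the support property of \<open>Q\<close> bounds the class, and hence
  \<open>Re Z\<close>, by a multiple \<open>K\<close> of \<open>|Im Y| = |Im Z|\<close>.  If the \<open>P\<close>-phases are within \<open>\<delta>\<close> of an end of the strip,
  then \<open>|Re Z| \<ge> cot (\<pi> \<delta>) |Im Z|\<close>.  The angle \<open>\<delta>\<close> is chosen with \<open>cot (\<pi> \<delta>) = K + 1\<close>.
\<close>

lemma no_extreme_object:
  assumes M: "\<And>x. cmod (Z x) \<le> M * nrm x" "0 \<le> M" and \<rho>: "0 < \<rho>" "\<rho> \<le> 1 / 2"
  obtains \<delta> where "0 < \<delta>" "\<And>n A. A \<in> B.ph {real_of_int n + \<rho>..of_int n + 1 - \<rho>} \<Longrightarrow>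
      A \<in> A.ph {real_of_int n<..of_int n + \<delta>} \<or> A \<in> A.ph {of_int n + 1 - \<delta>..<real_of_int n + 1} \<Longrightarrow>
      is_zero_obj C A"
proof -
  have sin\<rho>: "0 < sin (pi * \<rho>)" using \<rho> by (intro sin_gt_zero) auto
  define K where "K = M / (d * sin (pi * \<rho>))"
  have K: "0 \<le> K" using M(2) B.c_pos sin\<rho> unfolding K_def by simp
  define \<delta> where "\<delta> = arctan (1 / (K + 1)) / pi"
  have pid: "pi * \<delta> = arctan (1 / (K + 1))" by (simp add: \<delta>_def)
  have \<delta>: "0 < \<delta>" using K by (simp add: \<delta>_def)
  have \<delta>2: "pi * \<delta> < pi / 2" "0 < pi * \<delta>"
    using arctan_ubound[of "1 / (K + 1)"] \<delta> by (simp add: pid, simp)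
  have cos: "0 < cos (pi * \<delta>)" using cos_gt_zero[OF \<delta>2(2,1)] .
  have "sin (pi * \<delta>) / cos (pi * \<delta>) = 1 / (K + 1)" using tan_arctan[of "1 / (K + 1)"] by (simp add: pid tan_def)
  then have "(K + 1) * sin (pi * \<delta>) = cos (pi * \<delta>)" using cos K by (simp add: field_simps)
  moreover have "0 < sin (pi * \<delta>)" using \<delta>2 by (intro sin_gt_zero) linarith+
  ultimately have less: "K * sin (pi * \<delta>) < cos (pi * \<delta>)" by (simp add: distrib_right)
  have "is_zero_obj C A"
    if AB: "A \<in> B.ph {real_of_int n + \<rho>..of_int n + 1 - \<rho>}"
      and AA: "A \<in> A.ph {real_of_int n<..of_int n + \<delta>} \<or> A \<in> A.ph {of_int n + 1 - \<delta>..<real_of_int n + 1}"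
    for n A
  proof (rule ccontr)
    assume nz: "\<not> is_zero_obj C A"
    define g where "g x = cos (pi * of_int n) * Im (Y x)" for x
    define q where "q x = cis (- (pi * of_int n)) * Z x" for x
    have gq: "Im (q x) = g x" for x unfolding q_def g_def A.Im_integer_rotation Im_eq ..
    have q_add: "q (x + y) = q x + q y" for x y by (simp only: q_def A.Z_add distrib_left)
    have q0: "q 0 = 0" using q_add[of 0 0] by simp
    have "A \<in> B.ph {real_of_int n<..<of_int n + 1}" using AB by (rule B.ph_mono) (use \<rho> in auto)
    then have gpos: "0 < g (v A)" unfolding g_def using nz by (rule B.Im_pos_interior)
    have "d * nrm (v A) \<le> (1 / sin (pi * \<rho>)) * g (v A)"
    proof (rule B.ph_support[OF AB])
      show "g (x + y) = g x + g y" for x y by (simp add: g_def B.Z_add distrib_left)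
      fix \<theta> F assume \<theta>: "\<theta> \<in> {real_of_int n + \<rho>..of_int n + 1 - \<rho>}" and F: "F \<in> Q \<theta>" "\<not> is_zero_obj C F"
      obtain r where r: "0 < r" "r = cmod (Y (v F))"
        "cis (- (pi * of_int n)) * Y (v F) = of_real r * cis (pi * (\<theta> - of_int n))"
        using B.Z_rotated[OF F] .
      have gF: "g (v F) = r * sin (pi * (\<theta> - of_int n))"
        unfolding g_def A.Im_integer_rotation[symmetric] r(3) by simp
      have "sin (pi * \<rho>) \<le> sin (pi * (\<theta> - of_int n))"
      proof (cases "\<theta> - of_int n \<le> 1 / 2")
        case True
        then show ?thesis using \<theta> \<rho> by (intro sin_pi_mono) auto
      next
        case False
        have "sin (pi * \<rho>) \<le> sin (pi * (1 - (\<theta> - of_int n)))"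
          using \<theta> \<rho> False by (intro sin_pi_mono) auto
        also have "\<dots> = sin (pi * (\<theta> - of_int n))" by (simp add: right_diff_distrib[of pi 1] sin_diff)
        finally show ?thesis .
      qed
      then have "r * sin (pi * \<rho>) \<le> g (v F)" unfolding gF using r(1) by simp
      then show "cmod (Y (v F)) \<le> (1 / sin (pi * \<rho>)) * g (v F)"
        using sin\<rho> r(2) by (simp add: field_simps)
    qed (use sin\<rho> in simp)
    then have "nrm (v A) \<le> g (v A) / (d * sin (pi * \<rho>))"
      using B.c_pos sin\<rho> by (simp add: field_simps)
    then have "M * nrm (v A) \<le> K * g (v A)"
      using mult_left_mono[OF _ M(2)] unfolding K_def by fastforce
    moreover have "\<bar>Re (q (v A))\<bar> \<le> M * nrm (v A)"
      using M(1)[of "v A"] abs_Re_le_cmod[of "q (v A)"] by (simp add: q_def norm_mult)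
    ultimately have Re: "\<bar>Re (q (v A))\<bar> \<le> K * g (v A)" by linarith
    have "cos (pi * \<delta>) * g (v A) \<le> sin (pi * \<delta>) * \<bar>Re (q (v A))\<bar>"
      using AA
    proof
      assume "A \<in> A.ph {real_of_int n<..of_int n + \<delta>}"
      then have "0 \<le> sin (pi * \<delta>) * Re (q (v A)) - cos (pi * \<delta>) * Im (q (v A))"
      proof (rule A.ph_superadditive[where h = "\<lambda>x. sin (pi * \<delta>) * Re (q x) - cos (pi * \<delta>) * Im (q x)"])
        fix \<theta> F assume \<theta>: "\<theta> \<in> {real_of_int n<..of_int n + \<delta>}" and F: "F \<in> P \<theta>"
        show "0 \<le> sin (pi * \<delta>) * Re (q (v F)) - cos (pi * \<delta>) * Im (q (v F))"
        proof (cases "is_zero_obj C F")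
          case False
          obtain r where r: "0 < r" "q (v F) = of_real r * cis (pi * (\<theta> - of_int n))"
            using A.Z_rotated[OF F False] unfolding q_def by metis
          have "sin (pi * \<delta>) * Re (q (v F)) - cos (pi * \<delta>) * Im (q (v F)) = r * sin (pi * \<delta> - pi * (\<theta> - of_int n))"
            unfolding r(2) sin_diff by (simp add: algebra_simps)
          moreover have "0 \<le> sin (pi * \<delta> - pi * (\<theta> - of_int n))"
          proof (rule sin_ge_zero)
            have "pi * (\<theta> - of_int n) \<le> pi * \<delta>" "0 \<le> pi * (\<theta> - of_int n)" using \<theta> by auto
            then show "0 \<le> pi * \<delta> - pi * (\<theta> - of_int n)" "pi * \<delta> - pi * (\<theta> - of_int n) \<le> pi" using \<delta>2 by linarith+
          qed
          ultimately show ?thesis using r(1) by simp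
        qed (simp add: A.v_zero q_def)
      qed (simp_all add: q_add q0 algebra_simps)
      moreover have "sin (pi * \<delta>) * Re (q (v A)) \<le> sin (pi * \<delta>) * \<bar>Re (q (v A))\<bar>"
        using \<open>0 < sin (pi * \<delta>)\<close> by simp
      ultimately show ?thesis by (simp add: gq)
    next
      assume "A \<in> A.ph {of_int n + 1 - \<delta>..<real_of_int n + 1}"
      then have "0 \<le> - sin (pi * \<delta>) * Re (q (v A)) - cos (pi * \<delta>) * Im (q (v A))"
      proof (rule A.ph_superadditive[where h = "\<lambda>x. - sin (pi * \<delta>) * Re (q x) - cos (pi * \<delta>) * Im (q x)"])
        fix \<theta> F assume \<theta>: "\<theta> \<in> {of_int n + 1 - \<delta>..<real_of_int n + 1}" and F: "F \<in> P \<theta>"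
        show "0 \<le> - sin (pi * \<delta>) * Re (q (v F)) - cos (pi * \<delta>) * Im (q (v F))"
        proof (cases "is_zero_obj C F")
          case False
          obtain r where r: "0 < r" "q (v F) = of_real r * cis (pi * (\<theta> - of_int n))"
            using A.Z_rotated[OF F False] unfolding q_def by metis
          have "- sin (pi * \<delta>) * Re (q (v F)) - cos (pi * \<delta>) * Im (q (v F)) =
              r * - sin (pi * \<delta> + pi * (\<theta> - of_int n))"
            unfolding r(2) sin_add by (simp add: algebra_simps)
          also have "- sin (pi * \<delta> + pi * (\<theta> - of_int n)) = sin (pi * \<delta> + pi * (\<theta> - of_int n) - pi)"
            by (simp add: sin_diff)
          finally have "- sin (pi * \<delta>) * Re (q (v F)) - cos (pi * \<delta>) * Im (q (v F)) =
              r * sin (pi * \<delta> + pi * (\<theta> - of_int n) - pi)" .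
          moreover have "0 \<le> sin (pi * \<delta> + pi * (\<theta> - of_int n) - pi)"
          proof (rule sin_ge_zero)
            have "pi * (1 - \<delta>) \<le> pi * (\<theta> - of_int n)" "pi * (\<theta> - of_int n) \<le> pi * 1"
              using \<theta> by (intro mult_left_mono; simp)+
            then show "0 \<le> pi * \<delta> + pi * (\<theta> - of_int n) - pi" "pi * \<delta> + pi * (\<theta> - of_int n) - pi \<le> pi"
              using \<delta>2 right_diff_distrib[of pi 1 \<delta>] by linarith+
          qed
          ultimately show ?thesis using mult_nonneg_nonneg[OF less_imp_le[OF r(1)]] by (simp only:)
        qed (simp add: A.v_zero q_def)
      qed (simp_all add: q_add q0 algebra_simps)
      moreover have "- sin (pi * \<delta>) * Re (q (v A)) \<le> sin (pi * \<delta>) * \<bar>Re (q (v A))\<bar>"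
        using mult_left_mono[OF abs_ge_minus_self[of "Re (q (v A))"], of "sin (pi * \<delta>)"] \<open>0 < sin (pi * \<delta>)\<close> by simp
      ultimately show ?thesis by (simp add: gq)
    qed
    also have "\<dots> \<le> sin (pi * \<delta>) * (K * g (v A))"
      using Re \<open>0 < sin (pi * \<delta>)\<close> by (intro mult_left_mono) auto
    finally have "cos (pi * \<delta>) * g (v A) \<le> K * sin (pi * \<delta>) * g (v A)" by (simp add: mult_ac)
    then show False using gpos less by simp
  qed
  then show thesis using that \<delta> by blast
qed

end

section \<open>Transitivity of the equivalence relation\<close>

text \<open>
  By \<open>integer_cut_greater\<close> and its variants the truncations of \<open>P\<close> and \<open>P''\<close> at integers
  agree.  For \<open>E \<in> P \<theta>\<close> with \<open>n < \<theta> < n + 1\<close> suppose that the largest \<open>P''\<close>-phase exceeds \<open>\<theta> + 1 - \<delta>\<close>.  The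
  corresponding first factor \<open>A\<close> has \<open>P\<close>-phases at most \<open>\<theta> \<le> n + \<delta>\<close>, as a subobject of \<open>E\<close>, and \<open>P''\<close>-phase at
  least \<open>n + 1 - \<delta>\<close>.  Its \<open>P'\<close>-phases differ from both by at most \<open>e < 1\<close>, so they avoid the ends of the
  strip, contradicting \<open>no_extreme_object\<close>.  The lower bound is dual.
\<close>

theorem slicing_dist_less_1_trans:
  assumes A: "stability C P nrm v Z c" and B: "stability C P' nrm v Z' c'" and D: "stability C P'' nrm v Z'' c''"
    and Im: "\<And>x. Im (Z x) = Im (Z' x)" "\<And>x. Im (Z' x) = Im (Z'' x)"
    and dist: "slicing_dist C P P' < 1" "slicing_dist C P' P'' < 1"
    and M: "\<And>x. cmod (Z x) \<le> M * nrm x" "0 \<le> M"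
  shows "slicing_dist C P P'' < 1"
proof -
  interpret AB: two_stabilities C P nrm v Z c P' Z' c'
    by (intro two_stabilities.intro two_stabilities_axioms.intro A B Im dist)
  interpret BD: two_stabilities C P' nrm v Z' c' P'' Z'' c''
    by (intro two_stabilities.intro two_stabilities_axioms.intro B D Im dist)
  interpret BA: two_stabilities C P' nrm v Z' c' P Z c
    by (intro two_stabilities.intro two_stabilities_axioms.intro A B Im[symmetric])
      (use dist slicing_dist_commute in metis)
  interpret DB: two_stabilities C P'' nrm v Z'' c'' P' Z' c'
    by (intro two_stabilities.intro two_stabilities_axioms.intro D B Im[symmetric])
      (use dist slicing_dist_commute in metis)
  interpret DA: two_slicings C P'' P by unfold_locales
  let ?p = "phase_family.ph C P" and ?r = "phase_family.ph C P''"
  have up1: "?p {real_of_int n<..} = ?r {real_of_int n<..}" for n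
    using AB.integer_cut_greater BD.integer_cut_greater DB.integer_cut_greater BA.integer_cut_greater by blast
  have up2: "?p {real_of_int n..} = ?r {real_of_int n..}" for n
    using AB.integer_cut_atLeast BD.integer_cut_atLeast DB.integer_cut_atLeast BA.integer_cut_atLeast by blast
  have down1: "?p {..real_of_int n} = ?r {..real_of_int n}" for n
    using DA.dual_cut_down[of "{real_of_int n<..}" "{real_of_int n<..}"] up1[of n]
      two_slicings.dual_cut_down[of C P P'' "{real_of_int n<..}" "{real_of_int n<..}"]
      two_slicings.intro[OF AB.A.phase_family_axioms BD.B.phase_family_axioms] by auto
  have down2: "?p {..<real_of_int n} = ?r {..<real_of_int n}" for n
    using DA.dual_cut_down[of "{real_of_int n..}" "{real_of_int n..}"] up2[of n]
      two_slicings.dual_cut_down[of C P P'' "{real_of_int n..}" "{real_of_int n..}"]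
      two_slicings.intro[OF AB.A.phase_family_axioms BD.B.phase_family_axioms] by auto
  obtain e1 where e1: "0 \<le> e1" "e1 < 1" "slicing_dist C P P' = ennreal e1"
    using ennreal_less_1_obtain[OF dist(1)] .
  obtain e2 where e2: "0 \<le> e2" "e2 < 1" "slicing_dist C P' P'' = ennreal e2"
    using ennreal_less_1_obtain[OF dist(2)] .
  define e where "e = max e1 e2"
  have e: "0 \<le> e" "e < 1" using e1 e2 by (auto simp: e_def)
  have dist': "slicing_dist C P P' \<le> ennreal e" "slicing_dist C P' P'' \<le> ennreal e"
    using e1 e2 by (auto simp: e_def intro: ennreal_leI)
  define \<rho> where "\<rho> = (1 - e) / 2"
  have e_eq: "e = 1 - 2 * \<rho>" by (simp add: \<rho>_def field_simps)
  have \<rho>: "0 < \<rho>" "\<rho> \<le> 1 / 2" using e by (auto simp: \<rho>_def)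
  obtain \<delta>0 where \<delta>0: "0 < \<delta>0"
    "\<And>n A. A \<in> AB.B.ph {real_of_int n + \<rho>..of_int n + 1 - \<rho>} \<Longrightarrow>
      A \<in> ?p {real_of_int n<..of_int n + \<delta>0} \<or> A \<in> ?p {of_int n + 1 - \<delta>0..<real_of_int n + 1} \<Longrightarrow>
      is_zero_obj C A"
    using AB.no_extreme_object[OF M \<rho>] by blast
  \<comment> \<open>as \<open>e = 1 - 2 \<rho>\<close>, the bound \<open>\<delta> \<le> \<rho>\<close> gives \<open>\<delta> + e \<le> 1 - \<rho>\<close>, which keeps the \<open>P'\<close>-phases away from integers\<close>
  define \<delta> where "\<delta> = min \<delta>0 \<rho>"
  have \<delta>: "0 < \<delta>" "\<delta> \<le> \<rho>" "\<delta> \<le> \<delta>0" using \<delta>0(1) \<rho> by (auto simp: \<delta>_def)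
  have no: "is_zero_obj C A"
    if A: "A \<in> ?p {real_of_int n<..of_int n + \<delta>} \<or> A \<in> ?p {of_int n + 1 - \<delta>..<real_of_int n + 1}"
      and t: "\<not> is_zero_obj C A \<Longrightarrow> phi_plus C P' A \<le> of_int n + 1 - \<rho>"
        "\<not> is_zero_obj C A \<Longrightarrow> of_int n + \<rho> \<le> phi_minus C P' A" for A n
  proof (rule ccontr)
    assume nz: "\<not> is_zero_obj C A"
    have "A \<in> AB.B.ph {real_of_int n + \<rho>..of_int n + 1 - \<rho>}"
      using t[OF nz] AB.B.phi_iff[OF nz] by (simp add: AB.B.ph_interval)
    moreover have "A \<in> ?p {real_of_int n<..of_int n + \<delta>0} \<or> A \<in> ?p {of_int n + 1 - \<delta>0..<real_of_int n + 1}"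
    proof (rule disjE[OF A])
      assume "A \<in> ?p {real_of_int n<..of_int n + \<delta>}"
      then have "A \<in> ?p {real_of_int n<..of_int n + \<delta>0}" by (rule AB.A.ph_mono) (use \<delta> in auto)
      then show ?thesis ..
    next
      assume "A \<in> ?p {of_int n + 1 - \<delta>..<real_of_int n + 1}"
      then have "A \<in> ?p {of_int n + 1 - \<delta>0..<real_of_int n + 1}" by (rule AB.A.ph_mono) (use \<delta> in auto)
      then show ?thesis ..
    qed
    ultimately show False using \<delta>0(2) nz by blast
  qed
  have "P \<theta> \<subseteq> ?r {\<theta> - (1 - \<delta>)..\<theta> + (1 - \<delta>)}" for \<theta>
  proof
    fix E assume E: "E \<in> P \<theta>"
    show "E \<in> ?r {\<theta> - (1 - \<delta>)..\<theta> + (1 - \<delta>)}"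
    proof (cases "is_zero_obj C E \<or> \<theta> \<in> \<int>")
      case True
      then show ?thesis
      proof
        assume "\<theta> \<in> \<int>"
        then obtain n where n: "\<theta> = of_int n" by (auto elim: Ints_cases)
        have "E \<in> ?r {\<theta>..}" "E \<in> ?r {..\<theta>}"
          using AB.A.ph_base[OF E] up2[of n] down1[of n] n by auto
        then have "E \<in> ?r {\<theta>..\<theta>}" by (simp only: BD.B.ph_interval)
        then show ?thesis by (rule BD.B.ph_mono) (use \<delta> \<rho> in auto)
      qed (rule BD.B.ph_zero)
    next
      case False
      then have nz: "\<not> is_zero_obj C E" by blast
      define n where "n = \<lfloor>\<theta>\<rfloor>"
      have "of_int n \<noteq> \<theta>" using False by auto
      then have n: "of_int n < \<theta>" "\<theta> < of_int n + 1" unfolding n_def by linarith+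
      have Ep: "E \<in> ?p {real_of_int n<..}" "E \<in> ?p {..<real_of_int (n + 1)}" "E \<in> ?p {..\<theta>}" "E \<in> ?p {\<theta>..}"
        using AB.A.ph_base[OF E] n by auto
      have Er: "E \<in> ?r {real_of_int n<..}" "E \<in> ?r {..<real_of_int (n + 1)}" using Ep(1,2) up1 down2 by blast+
      have Eh: "real_of_int n < phi_minus C P'' E" "phi_plus C P'' E < of_int n + 1"
        using Er BD.B.phi_iff[OF nz] by auto
      note mp = BD.B.phi_minus_le_plus[OF nz]
      have top: "phi_plus C P'' E \<le> \<theta> + (1 - \<delta>)"
      proof (rule ccontr)
        assume neg: "\<not> phi_plus C P'' E \<le> \<theta> + (1 - \<delta>)"
        obtain A R where AR: "tri C A E R" "A \<in> P'' (phi_plus C P'' E)" "\<not> is_zero_obj C A"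
          "R \<in> ?r {..<phi_plus C P'' E}" using BD.B.top_factor[OF nz] .
        have "R \<in> ?r {..<real_of_int (n + 1)}" by (rule BD.B.ph_mono[OF AR(4)]) (use Eh in auto)
        then have R: "R \<in> ?p {..<real_of_int (n + 1)}" using down2 by blast
        have "A \<in> ?p (- {\<theta><..})"
          by (rule AB.A.ph_down_sub[OF _ AR(1) _ R]) (use Ep n in auto)
        then have A1: "A \<in> ?p {..\<theta>}" by simp
        have "A \<in> ?r {real_of_int n<..}" by (rule BD.B.ph_base[OF AR(2)]) (use Eh mp in auto)
        then have A2: "A \<in> ?p {real_of_int n<..}" using up1 by blast
        have th: "\<theta> \<le> of_int n + \<delta>" using neg Eh by linarith
        have "A \<in> ?p {real_of_int n<..\<theta>}" using A1 A2 AB.A.ph_interval by blast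
        then have A3: "A \<in> ?p {real_of_int n<..of_int n + \<delta>}" by (rule AB.A.ph_mono) (use th in auto)
        have rA: "A \<in> ?r {phi_plus C P'' E..}" by (rule BD.B.ph_base[OF AR(2)]) auto
        have "phi_plus C P' A \<le> of_int n + 1 - \<rho>"
          using phase_difference_le(1)[OF dist'(1) e(1) AR(3)] iffD1[OF AB.A.phi_iff(1)[OF AR(3)] A1] th \<delta>(2)
          unfolding e_eq abs_le_iff by linarith
        moreover have "of_int n + \<rho> \<le> phi_minus C P' A"
          using phase_difference_le(2)[OF dist'(2) e(1) AR(3)] iffD1[OF BD.B.phi_iff(3)[OF AR(3)] rA] neg n \<delta>(2)
          unfolding e_eq abs_le_iff by linarith
        ultimately show False using no[of A n] A3 AR(3) by blast
      qed
      have bot: "\<theta> - (1 - \<delta>) \<le> phi_minus C P'' E"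
      proof (rule ccontr)
        assume neg: "\<not> \<theta> - (1 - \<delta>) \<le> phi_minus C P'' E"
        obtain K F where KF: "tri C K E F" "F \<in> P'' (phi_minus C P'' E)" "\<not> is_zero_obj C F"
          "K \<in> ?r {phi_minus C P'' E<..}" using BD.B.bottom_factor[OF nz] .
        have "K \<in> ?r {real_of_int n<..}" by (rule BD.B.ph_mono[OF KF(4)]) (use Eh in auto)
        then have K: "K \<in> ?p {real_of_int n<..}" using up1 by blast
        have "sh C K \<in> ?p {\<theta>..}" by (rule AB.A.ph_sh[OF K]) (use n in auto)
        then have F1: "F \<in> ?p {\<theta>..}" using AB.A.ph_up_quotient[OF _ KF(1)] Ep by simp
        have "F \<in> ?r {..<real_of_int (n + 1)}" by (rule BD.B.ph_base[OF KF(2)]) (use Eh mp in auto)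
        then have F2: "F \<in> ?p {..<real_of_int (n + 1)}" using down2 by blast
        have th: "of_int n + 1 - \<delta> \<le> \<theta>" using neg Eh by linarith
        have "F \<in> ?p {\<theta>..<real_of_int (n + 1)}" using F1 F2 AB.A.ph_interval by blast
        then have F3: "F \<in> ?p {of_int n + 1 - \<delta>..<real_of_int n + 1}" by (rule AB.A.ph_mono) (use th in auto)
        have rF: "F \<in> ?r {..phi_minus C P'' E}" by (rule BD.B.ph_base[OF KF(2)]) auto
        have "phi_plus C P' F \<le> of_int n + 1 - \<rho>"
          using phase_difference_le(1)[OF dist'(2) e(1) KF(3)] iffD1[OF BD.B.phi_iff(1)[OF KF(3)] rF] neg n \<delta>(2)
          unfolding e_eq abs_le_iff by linarith
        moreover have "of_int n + \<rho> \<le> phi_minus C P' F"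
          using phase_difference_le(2)[OF dist'(1) e(1) KF(3)] iffD1[OF AB.A.phi_iff(3)[OF KF(3)] F1] th \<delta>(2)
          unfolding e_eq abs_le_iff by linarith
        ultimately show False using no[of F n] F3 KF(3) by blast
      qed
      show ?thesis using top bot BD.B.phi_iff[OF nz] BD.B.ph_interval(2) by blast
    qed
  qed
  then have "slicing_dist C P'' P \<le> ennreal (1 - \<delta>)" by (rule DA.slicing_dist_le_of_phases)
  also have "\<dots> < 1" using \<delta> by (simp add: ennreal_less_one_iff)
  finally show ?thesis by (simp add: slicing_dist_commute)
qed

section \<open>The lattice and its real tensor product\<close>

context triangulated_category
begin

text \<open>
  In the quotient by the null subgroup, the class of \<open>Y\<close> is that of the sum of \<open>X\<close> and \<open>Z\<close>, since the
  difference is one of the generators of this subgroup.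
\<close>

lemma class_additive:
  fixes lam :: "('o \<Rightarrow>\<^sub>0 int) set \<Rightarrow> 'l::ab_group_add"
  assumes lam: "lam \<in> hom (K_group C) type_group" and t: "tri C X Y Z"
  shows "lam (K_class C Y) = lam (K_class C X) + lam (K_class C Z)"
proof -
  let ?G = "free_Abelian_group (UNIV :: 'o set)" and ?N = "K_null C"
  interpret G: comm_group ?G by (rule abelian_free_Abelian_group)
  have sub: "subgroup ?N ?G" unfolding K_null_def by (rule G.generate_is_subgroup) auto
  then interpret N: normal ?N ?G by (rule G.subgroup_imp_normal)
  have "frag_of Y - frag_of X - frag_of Z \<in> ?N"
    unfolding K_null_def using t unfolding K_relations_def tri_def by (intro generate.incl) blast
  then have "frag_of Y \<in> ?N #>\<^bsub>?G\<^esub> (frag_of X + frag_of Z)"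
    unfolding r_coset_def by (auto intro!: bexI[of _ "frag_of Y - frag_of X - frag_of Z"])
  then have "?N #>\<^bsub>?G\<^esub> (frag_of X + frag_of Z) = K_class C Y"
    unfolding K_class_def by (rule G.repr_independence[OF _ _ sub]) simp
  moreover have "K_class C X <#>\<^bsub>?G\<^esub> K_class C Z = ?N #>\<^bsub>?G\<^esub> (frag_of X + frag_of Z)"
    unfolding K_class_def using N.rcos_sum[of "frag_of X" "frag_of Z"] by simp
  moreover have "K_class C E \<in> carrier (K_group C)" for E
    unfolding K_group_def K_class_def FactGroup_def RCOSETS_def by auto
  ultimately show ?thesis
    using hom_mult[OF lam, of "K_class C X" "K_class C Z"]
    by (simp add: K_group_def FactGroup_def type_group_def)
qed

end

lemma Hom_Z_iff: "f \<in> Hom_Z \<longleftrightarrow> (\<forall>x y. f (x + y) = f x + f y)"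
  by (simp add: Hom_Z_def Modules.additive_def)

lemma Hom_ZD: "f \<in> Hom_Z \<Longrightarrow> f (x + y) = f x + f y"
  by (simp add: Hom_Z_iff)

lemma tensor_one_add: "tensor_one (x + y) = tensor_one x + tensor_one y"
proof (transfer, unfold tensor_rel_def)
  fix x y :: 'a
  show "Poly_Mapping.single (x + y) 1 - (Poly_Mapping.single x 1 + Poly_Mapping.single y 1) \<in> tensor_null"
    using tensor_null.rel[of x y 1] by (simp add: diff_diff_eq)
qed

lemma scaleR_tensor_one: "r *\<^sub>R tensor_one x = abs_real_tensor (Poly_Mapping.single x r)"
  by (simp add: tensor_one.abs_eq scaleR_real_tensor.abs_eq pm_scale_single)

lemma real_tensor_expansion:
  "abs_real_tensor p = (\<Sum>x\<in>Poly_Mapping.keys p. Poly_Mapping.lookup p x *\<^sub>R tensor_one x)"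
proof -
  have p: "p = (\<Sum>x\<in>Poly_Mapping.keys p. Poly_Mapping.single x (Poly_Mapping.lookup p x))"
    by (rule poly_mapping_eqI)
      (auto simp: lookup_sum lookup_single when_def sum.delta in_keys_iff if_distrib cong: if_cong)
  have "abs_real_tensor (sum f A) = (\<Sum>x\<in>A. abs_real_tensor (f x))" if "finite A" for f and A :: "'a set"
    using that by induction (simp_all add: plus_real_tensor.abs_eq[symmetric] zero_real_tensor_def)
  from this[OF finite_keys[of p], of "\<lambda>x. Poly_Mapping.single x (Poly_Mapping.lookup p x)"] p
  show ?thesis by (simp add: scaleR_tensor_one)
qed

lemma real_tensor_cases: obtains p where "t = abs_real_tensor p"
proof -
  have "\<exists>p. t = abs_real_tensor p" by (induct t rule: real_tensor.abs_induct) blast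
  then show ?thesis using that by blast
qed

lemma linear_tensor_ext:
  fixes L L' :: "'l::ab_group_add real_tensor \<Rightarrow> 'v::real_vector"
  assumes "linear L" "linear L'" "\<And>x. L (tensor_one x) = L' (tensor_one x)" shows "L = L'"
proof
  fix t :: "'l real_tensor"
  obtain p where "t = abs_real_tensor p" by (rule real_tensor_cases)
  then show "L t = L' t"
    by (simp add: real_tensor_expansion assms(3) linear_sum[OF assms(1)] linear_sum[OF assms(2)]
        linear_cmul[OF assms(1)] linear_cmul[OF assms(2)])
qed

text \<open>
  Extend \<open>Z\<close> linearly to finitely supported functions; additivity of \<open>Z\<close> makes this extension
  vanish on the relations of the tensor product.
\<close>

lemma linear_tensor_exists:
  fixes Z :: "'l::ab_group_add \<Rightarrow> complex"
  assumes Z: "Z \<in> Hom_Z" shows "\<exists>L. linear L \<and> (\<forall>x. L (tensor_one x) = Z x)"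
proof -
  define ext where "ext p = (\<Sum>x\<in>Poly_Mapping.keys p. Poly_Mapping.lookup p x *\<^sub>R Z x)" for p :: "'l \<Rightarrow>\<^sub>0 real"
  have ext_superset: "ext p = (\<Sum>x\<in>A. Poly_Mapping.lookup p x *\<^sub>R Z x)"
    if "finite A" "Poly_Mapping.keys p \<subseteq> A" for p A
    unfolding ext_def using that by (intro sum.mono_neutral_left) (auto simp: in_keys_iff)
  have ext_add: "ext (p + q) = ext p + ext q" for p q
  proof -
    let ?A = "Poly_Mapping.keys p \<union> Poly_Mapping.keys q"
    have "finite ?A" by simp
    then show ?thesis
      using ext_superset[of ?A p] ext_superset[of ?A q] ext_superset[of ?A "p + q"] keys_add[of p q]
      by (simp add: lookup_add scaleR_add_left sum.distrib)
  qed
  have ext_scale: "ext (pm_scale r p) = r *\<^sub>R ext p" for r p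
  proof -
    have "Poly_Mapping.keys (pm_scale r p) \<subseteq> Poly_Mapping.keys p" by (auto simp: in_keys_iff lookup_pm_scale)
    then show ?thesis
      using ext_superset[of "Poly_Mapping.keys p" "pm_scale r p"]
      by (simp add: lookup_pm_scale ext_def scaleR_right.sum)
  qed
  have ext_diff: "ext (p - q) = ext p - ext q" for p q
    using ext_add[of "p - q" q] by simp
  have ext_single: "ext (Poly_Mapping.single x r) = r *\<^sub>R Z x" for x r
    using ext_superset[of "{x}" "Poly_Mapping.single x r"] by simp
  have null: "ext p = 0" if "p \<in> tensor_null" for p
    using that
  proof (induction rule: tensor_null.induct)
    case (rel x y r)
    then show ?case by (simp add: ext_diff ext_single Hom_ZD[OF Z] scaleR_add_right)
  next
    case (add p q)
    then show ?case by (simp add: ext_add)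
  qed (simp add: ext_def)
  have resp: "ext p = ext q" if "tensor_rel p q" for p q
    using null[of "p - q"] that by (simp add: tensor_rel_def ext_diff)
  define L where "L t = ext (rep_real_tensor t)" for t
  have L: "L (abs_real_tensor p) = ext p" for p
    unfolding L_def using resp[of "rep_real_tensor (abs_real_tensor p)" p]
    by (metis Quotient_real_tensor Quotient_rep_abs tensor_rel_refl)
  have "linear L"
  proof (rule linearI)
    show "L (s + t) = L s + L t" for s t
      by (rule real_tensor_cases[of s], rule real_tensor_cases[of t]) (simp add: plus_real_tensor.abs_eq L ext_add)
    show "L (r *\<^sub>R t) = r *\<^sub>R L t" for r t
      by (rule real_tensor_cases[of t]) (simp add: scaleR_real_tensor.abs_eq L ext_scale)
  qed
  moreover have "L (tensor_one x) = Z x" for x by (simp add: tensor_one.abs_eq L ext_single)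
  ultimately show ?thesis by blast
qed

lemma real_extension:
  assumes "Z \<in> Hom_Z" shows "linear (real_extension Z)" "real_extension Z (tensor_one x) = Z x"
proof -
  have "\<exists>!L. linear L \<and> (\<forall>x. L (tensor_one x) = Z x)"
    using linear_tensor_exists[OF assms] linear_tensor_ext by (metis (no_types, lifting))
  from theI'[OF this, folded real_extension_def]
  show "linear (real_extension Z)" "real_extension Z (tensor_one x) = Z x" by auto
qed

text \<open>
  Coordinates \<open>k i\<close> for a basis \<open>b i\<close>.  The last assumption says that the basis generates the
  lattice, in the form of an induction principle over differences, which avoids integer multiples
  in an arbitrary abelian group.
\<close>

locale lattice_basis =
  fixes n :: nat and k :: "nat \<Rightarrow> 'l::ab_group_add \<Rightarrow> int" and b :: "nat \<Rightarrow> 'l"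
  assumes k_add: "k i (x + y) = k i x + k i y"
    and k_inj: "(\<And>i. i < n \<Longrightarrow> k i x = k i y) \<Longrightarrow> x = y"
    and k_b: "i < n \<Longrightarrow> j < n \<Longrightarrow> k i (b j) = (if i = j then 1 else 0)"
    and generation: "0 \<in> S \<Longrightarrow> (\<And>x y. x \<in> S \<Longrightarrow> y \<in> S \<Longrightarrow> x - y \<in> S) \<Longrightarrow> (\<And>i. i < n \<Longrightarrow> b i \<in> S) \<Longrightarrow> x \<in> S"

lemma finite_rank_lattice_basis:
  assumes "finite_rank_lattice TYPE('l::ab_group_add)"
  obtains n and k :: "nat \<Rightarrow> 'l::ab_group_add \<Rightarrow> int" and b where "lattice_basis n k b"
proof -
  obtain n :: nat and h where h: "h \<in> iso (type_group :: 'l::ab_group_add monoid) (free_Abelian_group {..<n})"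
    using assms unfolding finite_rank_lattice_def Group.is_iso_def by blast
  have h_add: "h (x + y) = h x + h y" for x y
    using h unfolding iso_def hom_def by (auto simp: type_group_def)
  have bij: "bij_betw h UNIV {c. Poly_Mapping.keys c \<subseteq> {..<n}}"
    using h unfolding iso_def by (simp add: type_group_def free_Abelian_group_def)
  have inj: "h x = h y \<Longrightarrow> x = y" for x y using bij unfolding bij_betw_def inj_def by blast
  have keys: "Poly_Mapping.keys (h x) \<subseteq> {..<n}" for x using bij unfolding bij_betw_def by blast
  have surj: "\<exists>x. h x = c" if "Poly_Mapping.keys c \<subseteq> {..<n}" for c
    using that bij unfolding bij_betw_def by (metis (no_types, lifting) imageE mem_Collect_eq)
  have h_zero: "h 0 = 0" using h_add[of 0 0] by simp
  have h_diff: "h (x - y) = h x - h y" for x y using h_add[of "x - y" y] by simp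
  define b where "b i = (SOME x. h x = frag_of i)" for i
  have hb: "h (b i) = frag_of i" if "i < n" for i
    unfolding b_def by (rule someI_ex[OF surj]) (use that in simp)
  have "lattice_basis n (\<lambda>i x. Poly_Mapping.lookup (h x) i) b"
  proof
    show "x = y" if "\<And>i. i < n \<Longrightarrow> Poly_Mapping.lookup (h x) i = Poly_Mapping.lookup (h y) i" for x y
    proof (rule inj, rule poly_mapping_eqI)
      fix i show "Poly_Mapping.lookup (h x) i = Poly_Mapping.lookup (h y) i"
      proof (cases "i < n")
        case False
        then have "i \<notin> Poly_Mapping.keys (h x)" "i \<notin> Poly_Mapping.keys (h y)" using keys by auto
        then show ?thesis by (simp add: in_keys_iff)
      qed (rule that)
    qed
    show "x \<in> S" if S: "0 \<in> S" "\<And>x y. x \<in> S \<Longrightarrow> y \<in> S \<Longrightarrow> x - y \<in> S" "\<And>i. i < n \<Longrightarrow> b i \<in> S" for S x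
    proof -
      have "\<forall>x. h x = c \<longrightarrow> x \<in> S" if "Poly_Mapping.keys c \<subseteq> {..<n}" for c
        using that
      proof (induction c rule: free_Abelian_group_induct[consumes 1])
        case 1
        then show ?case using inj[of _ 0] h_zero S(1) by metis
      next
        case (2 c d)
        obtain x y where xy: "h x = c" "h y = d" using surj 2 by meson
        then have "x - y \<in> S" using 2 S(2) by blast
        moreover have "z = x - y" if "h z = c - d" for z using inj[of z "x - y"] that xy h_diff by simp
        ultimately show ?case by blast
      next
        case (3 a)
        have "z = b a" if "h z = frag_of a" for z using inj[of z "b a"] hb[of a] 3 that by simp
        moreover have "b a \<in> S" using S(3)[of a] 3 by simp
        ultimately show ?case by metis
      qed
      then show ?thesis using keys by blast
    qed
  qed (simp_all add: h_add lookup_add hb lookup_single when_def eq_commute)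
  then show thesis by (rule that)
qed

text \<open>
  Compactness in finite dimension, for the product topology: the sphere is a closed
  subset of a product of balls and points.
\<close>

lemma compact_l1_sphere:
  "compact {a :: nat \<Rightarrow> 'b::euclidean_space. (\<forall>i\<ge>n. a i = 0) \<and> (\<Sum>i<n. norm (a i)) = 1}"
proof -
  define B where "B i = (if i < n then cball 0 1 else {0::'b})" for i
  have "compactin (product_topology (\<lambda>_. euclidean) UNIV) (PiE UNIV B)"
    unfolding compactin_PiE by (simp add: B_def)
  then have c: "compact (PiE UNIV B)" by (simp add: euclidean_product_topology)
  have cont: "continuous_on UNIV (\<lambda>a :: nat \<Rightarrow> 'b. \<Sum>i<n. norm (a i))"
    by (intro continuous_intros continuous_on_product_coordinates)
  have cl: "closed {a :: nat \<Rightarrow> 'b. (\<Sum>i<n. norm (a i)) = 1}"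
    by (rule closed_Collect_eq[OF cont continuous_on_const])
  have "{a :: nat \<Rightarrow> 'b. (\<forall>i\<ge>n. a i = 0) \<and> (\<Sum>i<n. norm (a i)) = 1} =
      PiE UNIV B \<inter> {a. (\<Sum>i<n. norm (a i)) = 1}"
  proof -
    have "norm (a i) \<le> 1" if "i < n" "(\<Sum>i<n. norm (a i)) = 1" for a :: "nat \<Rightarrow> 'b" and i
      using member_le_sum[of i "{..<n}" "\<lambda>i. norm (a i)"] that by simp
    then show ?thesis by (auto simp: B_def PiE_iff extensional_def not_less split: if_splits)
  qed
  then show ?thesis using c cl compact_Int_closed by metis
qed

context lattice_basis
begin

lemma additive_expansion:
  fixes f :: "'l \<Rightarrow> 'v::real_vector"
  assumes f: "\<And>x y. f (x + y) = f x + f y"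
  shows "f x = (\<Sum>i<n. of_int (k i x) *\<^sub>R f (b i))"
proof -
  define g where "g x = (\<Sum>i<n. of_int (k i x) *\<^sub>R f (b i))" for x
  have g: "g (x + y) = g x + g y" for x y by (simp add: g_def k_add scaleR_add_left sum.distrib)
  have z: "f 0 = 0" "g 0 = 0" using f[of 0 0] g[of 0 0] by simp_all
  have d: "f (x - y) = f x - f y" "g (x - y) = g x - g y" for x y
    using f[of "x - y" y] g[of "x - y" y] by simp_all
  have "x \<in> {x. f x = g x}"
  proof (rule generation)
    fix j assume j: "j < n"
    have "g (b j) = (\<Sum>i<n. if i = j then f (b i) else 0)"
      unfolding g_def using j by (intro sum.cong) (auto simp: k_b)
    then show "b j \<in> {x. f x = g x}" using j by simp
  qed (simp_all add: z d)
  then show ?thesis by (simp add: g_def)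
qed

definition nrm :: "'l \<Rightarrow> real" where "nrm x = (\<Sum>i<n. \<bar>of_int (k i x)\<bar>)"

lemma k_zero [simp]: "k i 0 = 0" using k_add[of i 0 0] by simp

lemma k_uminus: "k i (- x) = - k i x" using k_add[of i x "- x"] by simp

sublocale lattice_seminorm nrm
proof
  show "nrm 0 = 0" by (simp add: nrm_def)
  show "0 \<le> nrm x" for x by (simp add: nrm_def sum_nonneg)
  show "nrm (x + y) \<le> nrm x + nrm y" for x y
    unfolding nrm_def sum.distrib[symmetric] by (intro sum_mono) (simp add: k_add)
  show "nrm (- x) = nrm x" for x by (simp add: nrm_def k_uminus)
  show "finite {x. nrm x \<le> r}" for r
  proof -
    define F where "F x = (\<lambda>i\<in>{..<n}. k i x)" for x
    have "inj F"
    proof (rule injI, rule k_inj)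
      fix x y i assume "F x = F y" "i < n"
      then show "k i x = k i y" unfolding F_def by (metis lessThan_iff restrict_apply')
    qed
    moreover have "F ` {x. nrm x \<le> r} \<subseteq> PiE {..<n} (\<lambda>_. {- \<lceil>r\<rceil>..\<lceil>r\<rceil>})"
    proof (rule image_subsetI)
      fix x assume "x \<in> {x. nrm x \<le> r}"
      then have x: "nrm x \<le> r" by simp
      have "- \<lceil>r\<rceil> \<le> k i x \<and> k i x \<le> \<lceil>r\<rceil>" if "i < n" for i
      proof -
        have "\<bar>real_of_int (k i x)\<bar> \<le> r"
          using member_le_sum[of i "{..<n}" "\<lambda>i. \<bar>real_of_int (k i x)\<bar>"] that x by (simp add: nrm_def)
        then show ?thesis by linarith
      qed
      then show "F x \<in> PiE {..<n} (\<lambda>_. {- \<lceil>r\<rceil>..\<lceil>r\<rceil>})" by (simp add: F_def PiE_iff)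
    qed
    moreover have "finite (PiE {..<n} (\<lambda>_. {- \<lceil>r\<rceil>..\<lceil>r\<rceil>}))" by (intro finite_PiE) auto
    ultimately show ?thesis by (meson finite_subset finite_imageD inj_on_subset subset_UNIV)
  qed
qed

lemma additive_bound:
  fixes f :: "'l \<Rightarrow> complex"
  assumes f: "\<And>x y. f (x + y) = f x + f y"
  shows "cmod (f x) \<le> (\<Sum>i<n. cmod (f (b i))) * nrm x"
proof -
  have "cmod (f x) \<le> (\<Sum>i<n. cmod (of_int (k i x) *\<^sub>R f (b i)))"
    unfolding additive_expansion[of f, OF f, of x] by (rule norm_sum)
  also have "\<dots> \<le> (\<Sum>i<n. cmod (f (b i)) * nrm x)"
  proof (rule sum_mono)
    fix i assume "i \<in> {..<n}"
    then have "\<bar>real_of_int (k i x)\<bar> \<le> nrm x"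
      using member_le_sum[of i "{..<n}" "\<lambda>i. \<bar>real_of_int (k i x)\<bar>"] by (simp add: nrm_def)
    then show "cmod (of_int (k i x) *\<^sub>R f (b i)) \<le> cmod (f (b i)) * nrm x"
      using mult_right_mono[of "\<bar>real_of_int (k i x)\<bar>" "nrm x" "cmod (f (b i))"]
      by (simp only: norm_scaleR mult.commute[of "cmod (f (b i))"]) simp
  qed
  finally show ?thesis by (simp add: sum_distrib_right)
qed

definition coord :: "nat \<Rightarrow> 'l real_tensor \<Rightarrow> real" where
  "coord i t = Re (real_extension (\<lambda>x. of_int (k i x)) t)"

lemma coord: "linear (coord i)" "coord i (tensor_one x) = of_int (k i x)"
proof -
  have Z: "(\<lambda>x. complex_of_int (k i x)) \<in> Hom_Z" by (simp add: Hom_Z_iff k_add)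
  have "linear (Re \<circ> real_extension (\<lambda>x. complex_of_int (k i x)))"
    by (intro linear_compose real_extension(1)[OF Z]) (simp add: linearI)
  then show "linear (coord i)" by (simp add: coord_def o_def flip: coord_def)
  show "coord i (tensor_one x) = of_int (k i x)" by (simp add: coord_def real_extension(2)[OF Z])
qed

text \<open>
  The inverse of the coordinate map.
\<close>

definition vec :: "(nat \<Rightarrow> real) \<Rightarrow> 'l real_tensor" where
  "vec a = (\<Sum>i<n. a i *\<^sub>R tensor_one (b i))"

lemma vec_coord: "vec (\<lambda>i. coord i t) = t"
proof -
  have "linear (\<lambda>t. vec (\<lambda>i. coord i t))"
    by (rule linearI) (simp_all add: vec_def linear_add[OF coord(1)] linear_cmul[OF coord(1)]
        scaleR_add_left sum.distrib scaleR_right.sum)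
  moreover have "vec (\<lambda>i. coord i (tensor_one x)) = tensor_one x" for x
    unfolding vec_def coord by (rule additive_expansion[symmetric, OF tensor_one_add])
  ultimately have "(\<lambda>t. vec (\<lambda>i. coord i t)) = (\<lambda>t. t)"
    using linear_tensor_ext[of _ "\<lambda>t. t"] linear_id[unfolded id_def] by blast
  then show ?thesis by (rule fun_cong)
qed

lemma coord_vec: assumes "j < n" shows "coord j (vec a) = a j"
proof -
  have "coord j (vec a) = (\<Sum>i<n. if i = j then a i else 0)"
    unfolding vec_def linear_sum[OF coord(1)] using assms
    by (intro sum.cong) (auto simp: linear_cmul[OF coord(1)] coord(2) k_b)
  then show ?thesis using assms by simp
qed

end

section \<open>Support constants and norms\<close>

context lattice_basis
begin

text \<open>
  On the compact set of unit vectors with \<open>Q \<ge> 0\<close> the continuous function \<open>|L|\<close> has no zero, as \<open>Q\<close> is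
  negative on the kernel of \<open>L\<close>; so it is bounded below there, and both sides are homogeneous.
\<close>

lemma quadratic_bound:
  fixes Q :: "'l real_tensor \<Rightarrow> real" and L :: "'l real_tensor \<Rightarrow> complex"
  assumes Q: "is_quadratic_form Q" and L: "linear L" and neg: "\<And>t. L t = 0 \<Longrightarrow> t \<noteq> 0 \<Longrightarrow> Q t < 0"
  shows "\<exists>c>0. \<forall>t. 0 \<le> Q t \<longrightarrow> c * (\<Sum>i<n. \<bar>coord i t\<bar>) \<le> cmod (L t)"
proof -
  obtain B where B: "\<And>t. linear (B t)" "\<And>u. linear (\<lambda>t. B t u)" "\<And>t. Q t = B t t"
    using Q unfolding is_quadratic_form_def by blast
  have Q_vec: "Q (vec a) = (\<Sum>i<n. \<Sum>j<n. a i * (a j * B (tensor_one (b i)) (tensor_one (b j))))" for a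
  proof -
    have "Q (vec a) = (\<Sum>i<n. a i * B (tensor_one (b i)) (vec a))"
      unfolding B(3) by (subst vec_def, subst linear_sum[OF B(2)]) (simp add: linear_cmul[OF B(2)])
    moreover have "B (tensor_one (b i)) (vec a) = (\<Sum>j<n. a j * B (tensor_one (b i)) (tensor_one (b j)))" for i
      by (subst vec_def, subst linear_sum[OF B(1)]) (simp add: linear_cmul[OF B(1)])
    ultimately show ?thesis by (simp add: sum_distrib_left)
  qed
  have L_vec: "L (vec a) = (\<Sum>i<n. a i *\<^sub>R L (tensor_one (b i)))" for a
    unfolding vec_def by (simp add: linear_sum[OF L] linear_cmul[OF L])
  define S where "S = {a :: nat \<Rightarrow> real. (\<forall>i\<ge>n. a i = 0) \<and> (\<Sum>i<n. norm (a i)) = 1} \<inter> {a. 0 \<le> Q (vec a)}"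
  have "continuous_on UNIV (\<lambda>a. Q (vec a))"
    unfolding Q_vec by (intro continuous_intros continuous_on_product_coordinates)
  then have "closed {a. 0 \<le> Q (vec a)}" by (intro closed_Collect_le continuous_on_const)
  then have S: "compact S" unfolding S_def by (intro compact_Int_closed compact_l1_sphere)
  have cont: "continuous_on S (\<lambda>a. cmod (L (vec a)))"
    unfolding L_vec by (intro continuous_intros continuous_on_subset[OF continuous_on_product_coordinates]) auto
  have "\<exists>c>0. \<forall>a\<in>S. c \<le> cmod (L (vec a))"
  proof (cases "S = {}")
    case False
    then obtain a where a: "a \<in> S" "\<And>a'. a' \<in> S \<Longrightarrow> cmod (L (vec a)) \<le> cmod (L (vec a'))"
      using continuous_attains_inf[OF S _ cont] by blast
    have "L (vec a) \<noteq> 0"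
    proof
      assume "L (vec a) = 0"
      moreover have "vec a \<noteq> 0"
      proof
        assume v: "vec a = 0"
        have "a i = 0" if "i < n" for i using coord_vec[OF that, of a] v linear_0[OF coord(1)] by simp
        then show False using a(1) unfolding S_def by simp
      qed
      ultimately show False using neg[of "vec a"] a(1) unfolding S_def by simp
    qed
    then show ?thesis using a by (intro exI[of _ "cmod (L (vec a))"]) auto
  qed (auto intro: exI[of _ 1])
  then obtain c where c: "0 < c" "\<And>a. a \<in> S \<Longrightarrow> c \<le> cmod (L (vec a))" by blast
  have "c * (\<Sum>i<n. \<bar>coord i t\<bar>) \<le> cmod (L t)" if t: "0 \<le> Q t" for t
  proof (cases "(\<Sum>i<n. \<bar>coord i t\<bar>) = 0")
    case False
    define s where "s = (\<Sum>i<n. \<bar>coord i t\<bar>)"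
    have "0 \<le> s" unfolding s_def by (intro sum_nonneg) simp
    then have s: "0 < s" using False by (simp add: s_def[symmetric])
    define a where "a i = (if i < n then coord i t / s else 0)" for i
    have va: "vec a = (1 / s) *\<^sub>R t"
    proof -
      have "vec a = (1 / s) *\<^sub>R vec (\<lambda>i. coord i t)"
        unfolding vec_def scaleR_right.sum by (intro sum.cong) (auto simp: a_def)
      then show ?thesis by (simp add: vec_coord)
    qed
    have "Q (vec a) = (1 / s) * ((1 / s) * Q t)"
      unfolding va B(3) by (simp add: linear_cmul[OF B(1)] linear_cmul[OF B(2)])
    then have "0 \<le> Q (vec a)" using t s by simp
    moreover have "(\<Sum>i<n. norm (a i)) = 1"
    proof -
      have "(\<Sum>i<n. norm (a i)) = (\<Sum>i<n. \<bar>coord i t\<bar> / s)" using s by (intro sum.cong) (auto simp: a_def)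
      then show ?thesis using s by (simp add: s_def flip: sum_divide_distrib)
    qed
    ultimately have "a \<in> S" unfolding S_def by (simp add: a_def)
    then have "c \<le> cmod (L (vec a))" by (rule c(2))
    also have "L (vec a) = (1 / s) *\<^sub>R L t" unfolding va by (rule linear_cmul[OF L])
    finally show ?thesis using s by (simp add: s_def[symmetric] field_simps)
  qed simp
  then show ?thesis using c(1) by blast
qed

text \<open>
  Conversely, a support constant \<open>c\<close> gives the quadratic form \<open>|Z|\<^sup>2 / c\<^sup>2\<close> minus the sum of the
  squares of the coordinates.
\<close>

lemma support_quadratic_form:
  fixes Z :: "'l \<Rightarrow> complex"
  assumes Z: "Z \<in> Hom_Z" and c: "0 < c"
  obtains Q :: "'l real_tensor \<Rightarrow> real" where "is_quadratic_form Q"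
    "\<And>t. real_extension Z t = 0 \<Longrightarrow> t \<noteq> 0 \<Longrightarrow> Q t < 0"
    "\<And>x. c * nrm x \<le> cmod (Z x) \<Longrightarrow> 0 \<le> Q (tensor_one x)"
proof -
  let ?L = "real_extension Z"
  note L = real_extension[OF Z]
  define B where "B t u = (1 / c)\<^sup>2 * Re (?L t * cnj (?L u)) - (\<Sum>i<n. coord i t * coord i u)" for t u
  have lin: "linear (B t)" for t
    unfolding B_def
    by (rule linearI) (simp_all add: linear_add[OF L(1)] linear_cmul[OF L(1)] linear_add[OF coord(1)]
        linear_cmul[OF coord(1)] algebra_simps sum.distrib sum_distrib_left)
  have sym: "B t u = B u t" for t u unfolding B_def by (simp add: mult.commute add.commute)
  show thesis
  proof (rule that[of "\<lambda>t. B t t"])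
    show "is_quadratic_form (\<lambda>t. B t t)"
      unfolding is_quadratic_form_def
      by (intro exI[of _ B] conjI allI) (use lin sym in \<open>auto simp: sym[of _ "_ :: 'l real_tensor"]\<close>)
    show "B t t < 0" if "?L t = 0" "t \<noteq> 0" for t
    proof -
      have "\<exists>i<n. coord i t \<noteq> 0"
      proof (rule ccontr)
        assume "\<not> (\<exists>i<n. coord i t \<noteq> 0)"
        then have "vec (\<lambda>i. coord i t) = 0" unfolding vec_def by simp
        then show False using that(2) by (simp add: vec_coord)
      qed
      then have "0 < (\<Sum>i<n. coord i t * coord i t)"
        by (auto intro!: sum_pos2 simp: zero_less_mult_iff)
      then show ?thesis using that(1) by (simp add: B_def)
    qed
    show "0 \<le> B (tensor_one x) (tensor_one x)" if x: "c * nrm x \<le> cmod (Z x)" for x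
    proof -
      have "(\<Sum>i<n. real_of_int (k i x) * real_of_int (k i x)) \<le> (\<Sum>i<n. \<bar>real_of_int (k i x)\<bar> * nrm x)"
      proof (rule sum_mono)
        fix i assume "i \<in> {..<n}"
        then have "\<bar>real_of_int (k i x)\<bar> \<le> nrm x"
          using member_le_sum[of i "{..<n}" "\<lambda>i. \<bar>real_of_int (k i x)\<bar>"] by (simp add: nrm_def)
        then show "real_of_int (k i x) * real_of_int (k i x) \<le> \<bar>real_of_int (k i x)\<bar> * nrm x"
          using mult_left_mono[of "\<bar>real_of_int (k i x)\<bar>" "nrm x" "\<bar>real_of_int (k i x)\<bar>"] by simp
      qed
      also have "\<dots> = (nrm x)\<^sup>2" by (simp add: power2_eq_square nrm_def flip: sum_distrib_right)
      also have "\<dots> \<le> (cmod (Z x) / c)\<^sup>2"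
        using x c nrm_nonneg[of x] by (intro power_mono) (simp_all add: field_simps)
      also have "\<dots> = (1 / c)\<^sup>2 * Re (Z x * cnj (Z x))"
        by (simp add: power_divide cmod_power2 flip: power2_eq_square)
      finally show ?thesis by (simp add: B_def L(2) coord(2))
    qed
  qed
qed

definition of_values :: "(nat \<Rightarrow> complex) \<Rightarrow> 'l \<Rightarrow> complex" where
  "of_values a x = (\<Sum>i<n. of_int (k i x) * a i)"

lemma of_values_Hom_Z: "of_values a \<in> Hom_Z"
  by (simp add: Hom_Z_iff of_values_def k_add ring_distribs sum.distrib)

lemma of_values_b: assumes "j < n" shows "of_values a (b j) = a j"
proof -
  have "of_values a (b j) = (\<Sum>i<n. if i = j then a i else 0)"
    unfolding of_values_def using assms by (intro sum.cong) (auto simp: k_b)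
  then show ?thesis using assms by simp
qed

lemma of_values_values: assumes "Z \<in> Hom_Z" shows "of_values (\<lambda>i. Z (b i)) = Z"
proof
  fix x
  show "of_values (\<lambda>i. Z (b i)) x = Z x"
    unfolding additive_expansion[of Z, OF Hom_ZD[OF assms], of x]
    by (simp add: of_values_def scaleR_conv_of_real)
qed

text \<open>
  Equivalence of norms on a finite-dimensional space: \<open>N\<close> is Lipschitz in the values on the basis, so it
  has a positive minimum on their unit sphere.
\<close>

lemma norm_Hom_equivalent:
  fixes N :: "('l \<Rightarrow> complex) \<Rightarrow> real"
  assumes N: "is_norm_Hom N"
  obtains K K' where "0 < K" "0 < K'" "\<And>Z. Z \<in> Hom_Z \<Longrightarrow> N Z \<le> K * (\<Sum>i<n. cmod (Z (b i)))"
    "\<And>Z. Z \<in> Hom_Z \<Longrightarrow> (\<Sum>i<n. cmod (Z (b i))) \<le> K' * N Z"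
proof -
  have N0: "0 \<le> N Z" "N Z = 0 \<longleftrightarrow> Z = (\<lambda>_. 0)" "N (\<lambda>x. r *\<^sub>R Z x) = \<bar>r\<bar> * N Z" if "Z \<in> Hom_Z" for Z r
    using N that unfolding is_norm_Hom_def by blast+
  have Nadd: "N (\<lambda>x. Z x + W x) \<le> N Z + N W" if "Z \<in> Hom_Z" "W \<in> Hom_Z" for Z W
    using N that unfolding is_norm_Hom_def by blast
  define e where "e w i = (\<lambda>x. of_int (k i x) * w)" for w :: complex and i
  have e: "e w i \<in> Hom_Z" for w i by (simp add: e_def Hom_Z_iff k_add ring_distribs)
  have zero: "(\<lambda>_. 0) \<in> (Hom_Z :: ('l \<Rightarrow> complex) set)" by (simp add: Hom_Z_iff)
  have Nsum: "N (\<lambda>x. \<Sum>i\<in>A. f i x) \<le> (\<Sum>i\<in>A. N (f i))" if "finite A" "\<And>i. f i \<in> Hom_Z" for A and f :: "nat \<Rightarrow> 'l \<Rightarrow> complex"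
    using that(1)
  proof induction
    case empty then show ?case using N0(2)[OF zero] by simp
  next
    case (insert j A)
    have "(\<lambda>x. \<Sum>i\<in>A. f i x) \<in> Hom_Z" using that(2) by (simp add: Hom_Z_iff sum.distrib)
    then show ?case using Nadd[OF that(2)[of j]] insert by fastforce
  qed
  have Ne: "N (e w i) \<le> (N (e 1 i) + N (e \<i> i)) * cmod w" for w i
  proof -
    have "e w i = (\<lambda>x. Re w *\<^sub>R e 1 i x + Im w *\<^sub>R e \<i> i x)"
      by (auto simp: e_def complex_eq_iff)
    moreover have "(\<lambda>x. r *\<^sub>R e u i x) \<in> Hom_Z" for r u
      by (simp add: e_def Hom_Z_iff k_add ring_distribs scaleR_add_right)
    ultimately have "N (e w i) \<le> \<bar>Re w\<bar> * N (e 1 i) + \<bar>Im w\<bar> * N (e \<i> i)"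
      using Nadd N0(3)[OF e] by metis
    also have "\<dots> \<le> cmod w * N (e 1 i) + cmod w * N (e \<i> i)"
      using N0(1)[OF e] abs_Re_le_cmod[of w] abs_Im_le_cmod[of w] by (intro add_mono mult_right_mono) auto
    finally show ?thesis by (simp add: algebra_simps)
  qed
  define K where "K = 1 + (\<Sum>i<n. N (e 1 i) + N (e \<i> i))"
  have "0 \<le> N (e 1 i) + N (e \<i> i)" for i using N0(1)[OF e] by (simp add: add_nonneg_nonneg)
  then have K: "0 < K" "\<And>i. i < n \<Longrightarrow> N (e 1 i) + N (e \<i> i) \<le> K"
    unfolding K_def using sum_nonneg[of "{..<n}" "\<lambda>i. N (e 1 i) + N (e \<i> i)"]
      member_le_sum[of _ "{..<n}" "\<lambda>i. N (e 1 i) + N (e \<i> i)"] by force+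
  have upper: "N (of_values a) \<le> K * (\<Sum>i<n. cmod (a i))" for a
  proof -
    have "N (of_values a) \<le> (\<Sum>i<n. N (e (a i) i))"
      using Nsum[of "{..<n}" "\<lambda>i. e (a i) i"] e by (simp add: of_values_def[abs_def] e_def)
    also have "\<dots> \<le> (\<Sum>i<n. K * cmod (a i))"
      using Ne K(2) by (intro sum_mono) (meson lessThan_iff mult_right_mono norm_ge_zero order_trans)
    finally show ?thesis by (simp add: sum_distrib_left)
  qed
  define S where "S = {a :: nat \<Rightarrow> complex. (\<forall>i\<ge>n. a i = 0) \<and> (\<Sum>i<n. norm (a i)) = 1}"
  have S: "compact S" unfolding S_def by (rule compact_l1_sphere)
  have Ndiff: "norm (N (of_values a') - N (of_values a)) \<le> K * (\<Sum>i<n. cmod (a' i - a i))" for a a'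
  proof -
    have *: "N (of_values a') - N (of_values a) \<le> K * (\<Sum>i<n. cmod (a' i - a i))" for a a'
    proof -
      have "of_values a' = (\<lambda>x. of_values (\<lambda>i. a' i - a i) x + of_values a x)"
        by (auto simp: of_values_def right_diff_distrib sum_subtractf)
      then have "N (of_values a') \<le> N (of_values (\<lambda>i. a' i - a i)) + N (of_values a)"
        using Nadd[OF of_values_Hom_Z of_values_Hom_Z] by metis
      then show ?thesis using upper[of "\<lambda>i. a' i - a i"] by linarith
    qed
    show ?thesis using *[of a' a] *[of a a'] by (simp add: norm_minus_commute abs_le_iff)
  qed
  have cont: "continuous_on S (\<lambda>a. N (of_values a))"
    unfolding continuous_on_def
  proof
    fix a assume "a \<in> S"
    have "((\<lambda>a'. a' i) \<longlongrightarrow> a i) (at a within S)" for i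
      using continuous_on_subset[OF continuous_on_product_coordinates, of S] \<open>a \<in> S\<close>
      unfolding continuous_on_def by blast
    then have "((\<lambda>a'. K * (\<Sum>i<n. cmod (a' i - a i))) \<longlongrightarrow> K * (\<Sum>i<n. cmod (a i - a i))) (at a within S)"
      by (intro tendsto_intros)
    then have "((\<lambda>a'. K * (\<Sum>i<n. cmod (a' i - a i))) \<longlongrightarrow> 0) (at a within S)" by simp
    then have "((\<lambda>a'. N (of_values a') - N (of_values a)) \<longlongrightarrow> 0) (at a within S)"
      by (rule Lim_null_comparison[rotated]) (simp add: Ndiff del: real_norm_def)
    then show "((\<lambda>a'. N (of_values a')) \<longlongrightarrow> N (of_values a)) (at a within S)" by (rule LIM_zero_cancel)
  qed
  have "\<exists>m>0. \<forall>a\<in>S. m \<le> N (of_values a)"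
  proof (cases "S = {}")
    case False
    then obtain a where a: "a \<in> S" "\<And>a'. a' \<in> S \<Longrightarrow> N (of_values a) \<le> N (of_values a')"
      using continuous_attains_inf[OF S _ cont] by blast
    have "N (of_values a) \<noteq> 0"
    proof
      assume "N (of_values a) = 0"
      then have "of_values a = (\<lambda>_. 0)" using N0(2)[OF of_values_Hom_Z] by blast
      then have "a i = 0" if "i < n" for i using of_values_b[OF that, of a] by simp
      then show False using a(1) unfolding S_def by simp
    qed
    then show ?thesis using a N0(1)[OF of_values_Hom_Z, of a] by (intro exI[of _ "N (of_values a)"]) auto
  qed (auto intro: exI[of _ 1])
  then obtain m where m: "0 < m" "\<And>a. a \<in> S \<Longrightarrow> m \<le> N (of_values a)" by blast
  have lower: "(\<Sum>i<n. cmod (Z (b i))) \<le> (1 / m) * N Z" if Z: "Z \<in> Hom_Z" for Z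
  proof (cases "(\<Sum>i<n. cmod (Z (b i))) = 0")
    case True then show ?thesis using N0(1)[OF Z] m(1) by simp
  next
    case False
    define s where "s = (\<Sum>i<n. cmod (Z (b i)))"
    have "0 \<le> s" unfolding s_def by (intro sum_nonneg) simp
    then have s: "0 < s" using False by (simp add: s_def[symmetric])
    define a where "a i = (if i < n then (1 / s) *\<^sub>R Z (b i) else 0)" for i
    have "(\<Sum>i<n. cmod (a i)) = (\<Sum>i<n. cmod (Z (b i)) / s)" using s by (intro sum.cong) (auto simp: a_def)
    also have "\<dots> = 1" using s by (simp add: s_def flip: sum_divide_distrib)
    finally have "a \<in> S" unfolding S_def by (simp add: a_def)
    then have "m \<le> N (of_values a)" by (rule m(2))
    also have "of_values a = (\<lambda>x. (1 / s) *\<^sub>R of_values (\<lambda>i. Z (b i)) x)"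
      unfolding of_values_def scaleR_right.sum by (rule ext, intro sum.cong) (auto simp: a_def)
    also have "N \<dots> = \<bar>1 / s\<bar> * N Z" unfolding of_values_values[OF Z] by (rule N0(3)[OF Z])
    finally have "m * s \<le> N Z" using s by (simp add: field_simps)
    then show ?thesis using m(1) by (simp add: s_def[symmetric] field_simps)
  qed
  show thesis
  proof (rule that[OF K(1)])
    show "0 < 1 / m" using m(1) by simp
    show "N Z \<le> K * (\<Sum>i<n. cmod (Z (b i)))" if "Z \<in> Hom_Z" for Z
      using upper[of "\<lambda>i. Z (b i)"] of_values_values[OF that] by simp
  qed (rule lower)
qed

end

locale stability_space = triangulated_category C + lattice_basis n k b
  for C :: "('o, 'm::ab_group_add, 'k::field) tricat" and n and k :: "nat \<Rightarrow> 'l::ab_group_add \<Rightarrow> int" and b +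
  fixes lam :: "('o \<Rightarrow>\<^sub>0 int) set \<Rightarrow> 'l" and N :: "('l \<Rightarrow> complex) \<Rightarrow> real"
  assumes lam_hom: "lam \<in> hom (K_group C) type_group" and norm: "is_norm_Hom N"
begin

abbreviation v :: "'o \<Rightarrow> 'l" where "v E \<equiv> lam (K_class C E)"

lemma stability_of_Stab:
  assumes \<sigma>: "\<sigma> \<in> Stab C lam" obtains c where "stability C (fst \<sigma>) nrm v (snd \<sigma>) c"
proof -
  let ?P = "fst \<sigma>" and ?Z = "snd \<sigma>"
  have s: "is_slicing C ?P" "?Z \<in> Hom_Z" "support_property C lam \<sigma>"
    and phase: "\<And>\<theta> E. E \<in> ?P \<theta> \<Longrightarrow> \<not> is_zero_obj C E \<Longrightarrow>
        \<exists>r>0. ?Z (v E) = of_real r * exp (\<i> * of_real (pi * \<theta>))"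
    using \<sigma>[unfolded Stab_def mem_Collect_eq] by blast+
  have P: "phase_family C ?P" by (rule phase_family_of_slicing[OF triangulated_category_axioms s(1)])
  obtain Q :: "'l real_tensor \<Rightarrow> real" where Q': "is_quadratic_form Q \<and>
      (\<forall>t. real_extension ?Z t = 0 \<longrightarrow> t \<noteq> 0 \<longrightarrow> Q t < 0) \<and>
      (\<forall>\<theta>. \<forall>E \<in> ?P \<theta>. \<not> is_zero_obj C E \<longrightarrow> 0 \<le> Q (tensor_one (v E)))"
    using s(3) unfolding support_property_def by (rule exE)
  have Q: "is_quadratic_form Q"
    "\<And>t. real_extension ?Z t = 0 \<Longrightarrow> t \<noteq> 0 \<Longrightarrow> Q t < 0"
    "\<And>\<theta> E. E \<in> ?P \<theta> \<Longrightarrow> \<not> is_zero_obj C E \<Longrightarrow> 0 \<le> Q (tensor_one (v E))"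
    using Q' by simp_all
  obtain c where c: "0 < c" "\<And>t. 0 \<le> Q t \<Longrightarrow> c * (\<Sum>i<n. \<bar>coord i t\<bar>) \<le> cmod (real_extension ?Z t)"
    using quadratic_bound[OF Q(1) real_extension(1)[OF s(2)] Q(2)] by blast
  have "stability C ?P nrm v ?Z c"
  proof (rule stability.intro[OF P lattice_seminorm_axioms stability_axioms.intro])
    show "v Y = v X + v W" if "tri C X Y W" for X Y W by (rule class_additive[OF lam_hom that])
    show "?Z (x + y) = ?Z x + ?Z y" for x y by (rule Hom_ZD[OF s(2)])
    show "\<exists>r>0. ?Z (v E) = of_real r * cis (pi * \<theta>)" if "E \<in> ?P \<theta>" "\<not> is_zero_obj C E" for E \<theta>
      using phase[OF that] by (simp add: cis_conv_exp)
    show "c * nrm (v E) \<le> cmod (?Z (v E))" if E: "E \<in> ?P \<theta>" for E \<theta>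
    proof (cases "is_zero_obj C E")
      case True
      have "v E = v E + v E" using class_additive[OF lam_hom tri_zero_left[OF True, of E]] .
      then show ?thesis by simp
    next
      case False
      then show ?thesis using c(2)[OF Q(3)[OF E False]] by (simp add: coord(2) nrm_def real_extension(2)[OF s(2)])
    qed
  qed (rule c(1))
  then show thesis by (rule that)
qed

lemma StabI:
  assumes P: "is_slicing C P" and Z: "Z \<in> Hom_Z"
    and phase: "\<And>\<theta> E. E \<in> P \<theta> \<Longrightarrow> \<not> is_zero_obj C E \<Longrightarrow> \<exists>r>0. Z (v E) = of_real r * cis (pi * \<theta>)"
    and c: "0 < c" "\<And>\<theta> E. E \<in> P \<theta> \<Longrightarrow> c * nrm (v E) \<le> cmod (Z (v E))"
  shows "(P, Z) \<in> Stab C lam"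
proof -
  obtain Q :: "'l real_tensor \<Rightarrow> real" where "is_quadratic_form Q"
    "\<And>t. real_extension Z t = 0 \<Longrightarrow> t \<noteq> 0 \<Longrightarrow> Q t < 0"
    "\<And>x. c * nrm x \<le> cmod (Z x) \<Longrightarrow> 0 \<le> Q (tensor_one x)"
    using support_quadratic_form[OF Z c(1)] by blast
  then have "support_property C lam (P, Z)"
    unfolding support_property_def using c(2) by (intro exI[of _ Q]) auto
  then show ?thesis unfolding Stab_def using P Z phase by (simp add: cis_conv_exp)
qed

end

section \<open>The forgetful map\<close>

lemma ennreal_pos_obtain_real:
  assumes "(0::ennreal) < e" obtains r where "0 < r" "ennreal r \<le> e"
proof (cases e)
  case (real r) then show ?thesis using that[of r] assms by auto
next
  case top then show ?thesis using that[of 1] by simp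
qed

context stability_space
begin

lemma Stab_Hom_Z: "\<sigma> \<in> Stab C lam \<Longrightarrow> snd \<sigma> \<in> Hom_Z"
  by (simp add: Stab_def)

lemma Hom_Z_diff: "Z \<in> Hom_Z \<Longrightarrow> W \<in> Hom_Z \<Longrightarrow> (\<lambda>x. Z x - W x :: complex) \<in> Hom_Z"
  by (simp add: Hom_Z_iff)

lemma Im_Hom_Z: "Z \<in> Hom_Z \<Longrightarrow> (\<lambda>x. Im (Z x)) \<in> Hom_Z"
  by (simp add: Hom_Z_iff)

lemma N_add: "Z \<in> Hom_Z \<Longrightarrow> W \<in> Hom_Z \<Longrightarrow> N (\<lambda>x. Z x + W x) \<le> N Z + N W"
  using norm unfolding is_norm_Hom_def by blast

lemma N_triangle:
  assumes "Z \<in> Hom_Z" "W \<in> Hom_Z" "Y \<in> Hom_Z"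
  shows "N (\<lambda>x. Z x - Y x) \<le> N (\<lambda>x. Z x - W x) + N (\<lambda>x. W x - Y x)"
proof -
  have "N (\<lambda>x. (Z x - W x) + (W x - Y x)) \<le> N (\<lambda>x. Z x - W x) + N (\<lambda>x. W x - Y x)"
    by (rule N_add[OF Hom_Z_diff[OF assms(1,2)] Hom_Z_diff[OF assms(2,3)]])
  then show ?thesis by simp
qed

lemma N_nonneg: "Z \<in> Hom_Z \<Longrightarrow> 0 \<le> N Z"
  using norm unfolding is_norm_Hom_def by blast

lemma stab_dist_less_iff:
  "stab_dist C N \<sigma> \<tau> < ennreal e \<longleftrightarrow>
    slicing_dist C (fst \<sigma>) (fst \<tau>) < ennreal e \<and> ennreal (N (\<lambda>x. snd \<sigma> x - snd \<tau> x)) < ennreal e"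
  by (simp add: stab_dist_def)

lemma equiv_Stab: "equiv (Stab C lam) (stab_equiv C lam)"
proof (rule equivI)
  show "stab_equiv C lam \<subseteq> Stab C lam \<times> Stab C lam" by (auto simp: stab_equiv_def)
  show "refl_on (Stab C lam) (stab_equiv C lam)"
    by (rule refl_onI) (simp add: stab_equiv_def)
  show "sym (stab_equiv C lam)"
    by (rule symI) (simp add: stab_equiv_def slicing_dist_commute)
  show "trans (stab_equiv C lam)"
  proof (rule transI)
    fix \<sigma> \<tau> \<upsilon> assume "(\<sigma>, \<tau>) \<in> stab_equiv C lam" "(\<tau>, \<upsilon>) \<in> stab_equiv C lam"
    then have S: "\<sigma> \<in> Stab C lam" "\<tau> \<in> Stab C lam" "\<upsilon> \<in> Stab C lam"
      and I: "\<And>x. Im (snd \<sigma> x) = Im (snd \<tau> x)" "\<And>x. Im (snd \<tau> x) = Im (snd \<upsilon> x)"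
      and d: "slicing_dist C (fst \<sigma>) (fst \<tau>) < 1" "slicing_dist C (fst \<tau>) (fst \<upsilon>) < 1"
      by (simp_all add: stab_equiv_def)
    obtain c1 where A: "stability C (fst \<sigma>) nrm v (snd \<sigma>) c1" using stability_of_Stab[OF S(1)] .
    obtain c2 where B: "stability C (fst \<tau>) nrm v (snd \<tau>) c2" using stability_of_Stab[OF S(2)] .
    obtain c3 where D: "stability C (fst \<upsilon>) nrm v (snd \<upsilon>) c3" using stability_of_Stab[OF S(3)] .
    have "slicing_dist C (fst \<sigma>) (fst \<upsilon>) < 1"
      by (rule slicing_dist_less_1_trans[OF A B D I d, of "\<Sum>i<n. cmod (snd \<sigma> (b i))"])
        (auto intro: additive_bound[OF Hom_ZD[OF Stab_Hom_Z[OF S(1)]]] sum_nonneg)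
    then show "(\<sigma>, \<upsilon>) \<in> stab_equiv C lam" using S I by (simp add: stab_equiv_def)
  qed
qed

definition cls :: "('o, 'l) prestab \<Rightarrow> ('o, 'l) prestab set" where
  "cls \<sigma> = stab_equiv C lam `` {\<sigma>}"

lemma cls_eq_iff: "\<sigma> \<in> Stab C lam \<Longrightarrow> \<tau> \<in> Stab C lam \<Longrightarrow> cls \<sigma> = cls \<tau> \<longleftrightarrow> (\<sigma>, \<tau>) \<in> stab_equiv C lam"
  unfolding cls_def by (rule eq_equiv_class_iff[OF equiv_Stab])

lemma Forg_cls: assumes "\<sigma> \<in> Stab C lam" shows "Forg (cls \<sigma>) = (\<lambda>x. Im (snd \<sigma> x))"
proof -
  have "\<sigma> \<in> cls \<sigma>" unfolding cls_def using equiv_class_self[OF equiv_Stab assms] .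
  moreover have "(\<lambda>x. Im (snd \<tau> x)) = (\<lambda>x. Im (snd \<sigma> x))" if "\<tau> \<in> cls \<sigma>" for \<tau>
    using that unfolding cls_def Image_singleton_iff by (simp add: stab_equiv_def)
  ultimately have "(\<lambda>\<tau> x. Im (snd \<tau> x)) ` cls \<sigma> = {\<lambda>x. Im (snd \<sigma> x)}" by blast
  then show ?thesis unfolding Forg_def by simp
qed

text \<open>
  The deformed charge \<open>W\<close> has the real part of \<open>Z\<close> and the imaginary part \<open>B\<close>.  The direction that does not
  change is the real one, so \<open>exists_deformed_slicing\<close> applies with \<open>a = 1/2\<close>.
\<close>

lemma deform_imaginary_part:
  assumes \<sigma>: "\<sigma> \<in> Stab C lam" and e: "0 < e"
  obtains d where "0 < d" "\<And>B :: 'l \<Rightarrow> real. B \<in> Hom_Z \<Longrightarrow> (\<And>i. i < n \<Longrightarrow> \<bar>B (b i) - Im (snd \<sigma> (b i))\<bar> < d) \<Longrightarrow>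
    \<exists>\<tau>\<in>Stab C lam. (\<lambda>x. Im (snd \<tau> x)) = B \<and> stab_dist C N \<sigma> \<tau> < ennreal e"
proof -
  let ?P = "fst \<sigma>" and ?Z = "snd \<sigma>"
  obtain c where st: "stability C ?P nrm v ?Z c" using stability_of_Stab[OF \<sigma>] .
  have c: "0 < c" using st by (rule stability.c_pos)
  have P: "phase_family C ?P" using st by (rule stability.axioms(1))
  obtain K K' where K: "0 < K" "\<And>Z. Z \<in> Hom_Z \<Longrightarrow> N Z \<le> K * (\<Sum>i<n. cmod (Z (b i)))"
    using norm_Hom_equivalent[OF norm] by metis
  define \<eta> where "\<eta> = min (1 / 3) (e / 2)"
  have \<eta>: "0 < \<eta>" "\<eta> \<le> 1 / 3" "\<eta> < e" using e by (auto simp: \<eta>_def)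
  have sin: "0 < sin (pi * \<eta>)" using \<eta> by (intro sin_gt_zero) (auto intro: mult_left_mono[of \<eta> 1 pi, simplified] simp: less_le_trans)
  define \<epsilon> where "\<epsilon> = min (c / 4) (c * sin (pi * \<eta>) / 2)"
  have \<epsilon>: "0 < \<epsilon>" "4 * \<epsilon> \<le> c" "2 * \<epsilon> \<le> c * sin (pi * \<eta>)" using c sin by (auto simp: \<epsilon>_def)
  \<comment> \<open>the summand 1 covers rank 0\<close>
  define d where "d = min \<epsilon> (e / K) / (real n + 1)"
  have "0 < min \<epsilon> (e / K)" using \<epsilon> e K by simp
  then have d: "0 < d" "real n * d < \<epsilon>" "real n * d < e / K"
  proof -
    assume m: "0 < min \<epsilon> (e / K)"
    show "0 < d" unfolding d_def using m by simp
    then have "real n * d < (real n + 1) * d" by simp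
    also have "\<dots> = min \<epsilon> (e / K)" unfolding d_def by simp
    finally have "real n * d < min \<epsilon> (e / K)" .
    then show "real n * d < \<epsilon>" "real n * d < e / K" by auto
  qed
  show thesis
  proof (rule that[OF d(1)])
    fix B :: "'l \<Rightarrow> real"
    assume B: "B \<in> Hom_Z" "\<And>i. i < n \<Longrightarrow> \<bar>B (b i) - Im (?Z (b i))\<bar> < d"
    note Z_add = Hom_ZD[OF Stab_Hom_Z[OF \<sigma>]]
    define W where "W x = Complex (Re (?Z x)) (B x)" for x
    have W: "W \<in> Hom_Z" by (simp add: Hom_Z_iff W_def Z_add Hom_ZD[OF B(1)] complex_eq_iff)
    have diff: "(\<lambda>x. W x - ?Z x) \<in> Hom_Z" using Hom_Z_diff[OF W Stab_Hom_Z[OF \<sigma>]] .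
    have "(\<Sum>i<n. cmod (W (b i) - ?Z (b i))) \<le> (\<Sum>i<n. d)"
    proof (rule sum_mono)
      fix i assume "i \<in> {..<n}"
      then have "\<bar>B (b i) - Im (?Z (b i))\<bar> < d" using B(2) by simp
      then show "cmod (W (b i) - ?Z (b i)) \<le> d" by (simp add: W_def cmod_def)
    qed
    then have sum: "(\<Sum>i<n. cmod (W (b i) - ?Z (b i))) \<le> real n * d" by simp
    have close: "cmod (W x - ?Z x) \<le> \<epsilon> * nrm x" for x
    proof -
      have "cmod (W x - ?Z x) \<le> (\<Sum>i<n. cmod (W (b i) - ?Z (b i))) * nrm x"
        using additive_bound[OF Hom_ZD[OF diff], of x] .
      also have "\<dots> \<le> \<epsilon> * nrm x" using sum d(2) nrm_nonneg by (intro mult_right_mono) auto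
      finally show ?thesis .
    qed
    have rot: "Im (cis (- (pi * (1 / 2))) * u) = - Re u" for u by simp
    obtain Q where Q: "is_slicing C Q"
      "\<And>\<theta> E. E \<in> Q \<theta> \<Longrightarrow> \<not> is_zero_obj C E \<Longrightarrow> \<exists>r>0. W (v E) = of_real r * cis (pi * \<theta>)"
      "\<And>\<theta>. Q \<theta> \<subseteq> phase_family.ph C ?P {\<theta> - \<eta>..\<theta> + \<eta>}"
      "\<And>\<theta> E. E \<in> Q \<theta> \<Longrightarrow> c / 4 * nrm (v E) \<le> cmod (W (v E))"
    proof -
      have "\<exists>Q. is_slicing C Q \<and>
        (\<forall>\<theta> E. E \<in> Q \<theta> \<longrightarrow> \<not> is_zero_obj C E \<longrightarrow> (\<exists>r>0. W (v E) = of_real r * cis (pi * \<theta>))) \<and>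
        (\<forall>\<theta>. Q \<theta> \<subseteq> phase_family.ph C ?P {\<theta> - \<eta>..\<theta> + \<eta>}) \<and>
        (\<forall>\<theta> E. E \<in> Q \<theta> \<longrightarrow> c / 4 * nrm (v E) \<le> cmod (W (v E)))"
        by (rule stability.exists_deformed_slicing[OF st Hom_ZD[OF W], of "1 / 2", OF _ close])
          (use \<epsilon> \<eta> in \<open>auto simp: rot W_def simp del: cis_minus_pi_half\<close>)
      then show thesis using that by (elim exE conjE) simp
    qed
    have "(Q, W) \<in> Stab C lam" by (rule StabI[OF Q(1) W Q(2) _ Q(4)]) (use c in simp_all)
    moreover have "(\<lambda>x. Im (snd (Q, W) x)) = B" by (simp add: W_def)
    moreover have "stab_dist C N \<sigma> (Q, W) < ennreal e"
      unfolding stab_dist_less_iff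
    proof
      have "slicing_dist C ?P Q \<le> ennreal \<eta>"
        by (rule two_slicings.slicing_dist_le_of_phases[OF two_slicings.intro[OF P
              phase_family_of_slicing[OF triangulated_category_axioms Q(1)]] Q(3)])
      also have "\<dots> < ennreal e" using \<eta> e by (simp add: ennreal_less_iff)
      finally show "slicing_dist C ?P (fst (Q, W)) < ennreal e" by simp
      have "N (\<lambda>x. ?Z x - W x) \<le> K * (\<Sum>i<n. cmod (?Z (b i) - W (b i)))"
        by (rule K(2)[OF Hom_Z_diff[OF Stab_Hom_Z[OF \<sigma>] W]])
      also have "\<dots> \<le> K * (real n * d)" using sum K(1) by (simp add: norm_minus_commute)
      also have "\<dots> < e" using d(3) K(1) by (simp add: field_simps)
      finally show "ennreal (N (\<lambda>x. ?Z x - snd (Q, W) x)) < ennreal e" using e by (simp add: ennreal_lessI)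
    qed
    ultimately show "\<exists>\<tau>\<in>Stab C lam. (\<lambda>x. Im (snd \<tau> x)) = B \<and> stab_dist C N \<sigma> \<tau> < ennreal e" by blast
  qed
qed

lemma Im_difference_bound:
  "\<exists>K>0. \<forall>\<sigma>\<in>Stab C lam. \<forall>\<tau>\<in>Stab C lam. \<forall>x.
    \<bar>Im (snd \<sigma> x) - Im (snd \<tau> x)\<bar> \<le> K * N (\<lambda>x. snd \<sigma> x - snd \<tau> x) * nrm x"
proof -
  obtain K K' where K: "0 < K'" "\<And>Z. Z \<in> Hom_Z \<Longrightarrow> (\<Sum>i<n. cmod (Z (b i))) \<le> K' * N Z"
    using norm_Hom_equivalent[OF norm] by metis
  have "\<bar>Im (snd \<sigma> x) - Im (snd \<tau> x)\<bar> \<le> K' * N (\<lambda>x. snd \<sigma> x - snd \<tau> x) * nrm x"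
    if S: "\<sigma> \<in> Stab C lam" "\<tau> \<in> Stab C lam" for \<sigma> \<tau> x
  proof -
    have diff: "(\<lambda>x. snd \<sigma> x - snd \<tau> x) \<in> Hom_Z" using Hom_Z_diff Stab_Hom_Z S by blast
    have "\<bar>Im (snd \<sigma> x) - Im (snd \<tau> x)\<bar> \<le> cmod (snd \<sigma> x - snd \<tau> x)"
      using abs_Im_le_cmod[of "snd \<sigma> x - snd \<tau> x"] by simp
    also have "\<dots> \<le> (\<Sum>i<n. cmod (snd \<sigma> (b i) - snd \<tau> (b i))) * nrm x"
      using additive_bound[OF Hom_ZD[OF diff], of x] .
    also have "\<dots> \<le> K' * N (\<lambda>x. snd \<sigma> x - snd \<tau> x) * nrm x"
      using K(2)[OF diff] nrm_nonneg by (intro mult_right_mono)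
    finally show ?thesis .
  qed
  then show ?thesis using K(1) by blast
qed

lemma continuous_Im: "continuous_map (Stab_topology C lam N) Hom_Z_topology (\<lambda>\<sigma> x. Im (snd \<sigma> x))"
proof -
  obtain K where K: "0 < K" "\<And>\<sigma> \<tau> x. \<sigma> \<in> Stab C lam \<Longrightarrow> \<tau> \<in> Stab C lam \<Longrightarrow>
    \<bar>Im (snd \<sigma> x) - Im (snd \<tau> x)\<bar> \<le> K * N (\<lambda>x. snd \<sigma> x - snd \<tau> x) * nrm x"
    using Im_difference_bound by blast
  have coordinate: "continuous_map (Stab_topology C lam N) euclidean (\<lambda>\<sigma>. Im (snd \<sigma> x))" for x
    unfolding continuous_map_def topspace_Stab_topology
  proof (intro conjI allI impI)
    fix U :: "real set" assume "openin euclidean U"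
    then have U: "open U" by simp
    show "openin (Stab_topology C lam N) {\<sigma> \<in> Stab C lam. Im (snd \<sigma> x) \<in> U}"
      unfolding openin_Stab_topology
    proof (intro conjI ballI)
      fix \<sigma> assume "\<sigma> \<in> {\<sigma> \<in> Stab C lam. Im (snd \<sigma> x) \<in> U}"
      then have \<sigma>: "\<sigma> \<in> Stab C lam" "Im (snd \<sigma> x) \<in> U" by auto
      obtain r where r: "0 < r" "\<And>y. dist y (Im (snd \<sigma> x)) < r \<Longrightarrow> y \<in> U"
        using U \<sigma>(2) unfolding open_dist by metis
      define e where "e = r / (K * (nrm x + 1))"
      have pos: "0 < K * (nrm x + 1)" using K(1) nrm_nonneg[of x] by (simp add: add_nonneg_pos)
      then have e: "0 < e" using r(1) by (simp add: e_def)
      show "\<exists>e>0. \<forall>\<tau>\<in>Stab C lam. stab_dist C N \<sigma> \<tau> < e \<longrightarrow> \<tau> \<in> {\<sigma> \<in> Stab C lam. Im (snd \<sigma> x) \<in> U}"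
      proof (intro exI[of _ "ennreal e"] conjI ballI impI)
        fix \<tau> assume \<tau>: "\<tau> \<in> Stab C lam" "stab_dist C N \<sigma> \<tau> < ennreal e"
        have N0: "0 \<le> N (\<lambda>x. snd \<sigma> x - snd \<tau> x)"
          using N_nonneg Hom_Z_diff Stab_Hom_Z \<sigma>(1) \<tau>(1) by blast
        have Ne: "N (\<lambda>x. snd \<sigma> x - snd \<tau> x) < e"
          using \<tau>(2) N0 by (simp add: stab_dist_less_iff ennreal_less_iff)
        have "\<bar>Im (snd \<sigma> x) - Im (snd \<tau> x)\<bar> \<le> K * N (\<lambda>x. snd \<sigma> x - snd \<tau> x) * nrm x" by (rule K(2)[OF \<sigma>(1) \<tau>(1)])
        also have "\<dots> \<le> K * N (\<lambda>x. snd \<sigma> x - snd \<tau> x) * (nrm x + 1)"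
          using K(1) N0 by (intro mult_left_mono) auto
        also have "\<dots> = N (\<lambda>x. snd \<sigma> x - snd \<tau> x) * (K * (nrm x + 1))" by simp
        also have "\<dots> < e * (K * (nrm x + 1))" using Ne pos by (intro mult_strict_right_mono)
        also have "\<dots> = r" unfolding e_def by (rule nonzero_eq_divide_eq[THEN iffD1, OF _ refl]) (use pos in linarith)
        finally have "dist (Im (snd \<tau> x)) (Im (snd \<sigma> x)) < r" by (simp add: dist_real_def abs_minus_commute)
        then show "\<tau> \<in> {\<sigma> \<in> Stab C lam. Im (snd \<sigma> x) \<in> U}" using r(2) \<tau>(1) by simp
      qed (use e in simp)
    qed auto
  qed simp
  have "continuous_map (Stab_topology C lam N) euclidean (\<lambda>\<sigma> x. Im (snd \<sigma> x))"
    unfolding euclidean_product_topology[symmetric] continuous_map_componentwise_UNIV using coordinate by blast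
  then show ?thesis
    unfolding Hom_Z_topology_def
    by (rule continuous_map_into_subtopology) (auto simp: topspace_Stab_topology intro: Im_Hom_Z Stab_Hom_Z)
qed

lemma open_Im:
  assumes U: "openin (Stab_topology C lam N) U"
  shows "openin Hom_Z_topology ((\<lambda>\<sigma> x. Im (snd \<sigma> x)) ` U)"
proof (subst openin_subopen, rule ballI)
  fix B assume "B \<in> (\<lambda>\<sigma> x. Im (snd \<sigma> x)) ` U"
  then obtain \<sigma> where \<sigma>: "\<sigma> \<in> U" "B = (\<lambda>x. Im (snd \<sigma> x))" by blast
  have S: "\<sigma> \<in> Stab C lam" using U \<sigma>(1) unfolding openin_Stab_topology by blast
  obtain e' where e': "0 < e'" "\<And>\<tau>. \<tau> \<in> Stab C lam \<Longrightarrow> stab_dist C N \<sigma> \<tau> < e' \<Longrightarrow> \<tau> \<in> U"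
    using U \<sigma>(1) unfolding openin_Stab_topology by meson
  obtain e where e: "0 < e" "ennreal e \<le> e'" using ennreal_pos_obtain_real[OF e'(1)] .
  obtain d where d: "0 < d" "\<And>B :: 'l \<Rightarrow> real. B \<in> Hom_Z \<Longrightarrow> (\<And>i. i < n \<Longrightarrow> \<bar>B (b i) - Im (snd \<sigma> (b i))\<bar> < d) \<Longrightarrow>
    \<exists>\<tau>\<in>Stab C lam. (\<lambda>x. Im (snd \<tau> x)) = B \<and> stab_dist C N \<sigma> \<tau> < ennreal e"
    using deform_imaginary_part[OF S e(1)] by blast
  define T where "T = (\<Inter>i<n. {B :: 'l \<Rightarrow> real. \<bar>B (b i) - Im (snd \<sigma> (b i))\<bar> < d})"
  have "open {B :: 'l \<Rightarrow> real. \<bar>B (b i) - Im (snd \<sigma> (b i))\<bar> < d}" for i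
    by (intro open_Collect_less continuous_intros continuous_on_product_coordinates)
  then have "open T" unfolding T_def by (intro open_INT) auto
  then have "openin Hom_Z_topology (Hom_Z \<inter> T)" unfolding Hom_Z_topology_def by (rule openin_open_Int)
  moreover have "B \<in> Hom_Z \<inter> T" using \<sigma>(2) Im_Hom_Z[OF Stab_Hom_Z[OF S]] d(1) by (simp add: T_def)
  moreover have "Hom_Z \<inter> T \<subseteq> (\<lambda>\<sigma> x. Im (snd \<sigma> x)) ` U"
  proof
    fix B' assume B': "B' \<in> Hom_Z \<inter> T"
    then obtain \<tau> where \<tau>: "\<tau> \<in> Stab C lam" "(\<lambda>x. Im (snd \<tau> x)) = B'" "stab_dist C N \<sigma> \<tau> < ennreal e"
      using d(2)[of B'] by (auto simp: T_def)
    then have "\<tau> \<in> U" using e'(2) e(2) by (meson less_le_trans)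
    then show "B' \<in> (\<lambda>\<sigma> x. Im (snd \<sigma> x)) ` U" using \<tau>(2) by blast
  qed
  ultimately show "\<exists>T. openin Hom_Z_topology T \<and> B \<in> T \<and> T \<subseteq> (\<lambda>\<sigma> x. Im (snd \<sigma> x)) ` U" by blast
qed

text \<open>
  Let \<open>\<sigma> \<sim> \<tau> \<in> U\<close>.  If \<open>\<sigma>'\<close> is close to \<open>\<sigma>\<close>, deform \<open>\<tau>\<close> to some \<open>\<upsilon> \<in> U\<close> with the imaginary part of
  \<open>\<sigma>'\<close>.  The slicings of \<open>\<sigma>'\<close> and \<open>\<upsilon>\<close> have a distance below 1 by the triangle inequality via \<open>\<sigma>\<close> and \<open>\<tau>\<close>,
  since the distance of \<open>\<sigma>\<close> and \<open>\<tau>\<close> leaves a positive gap.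
\<close>

lemma open_saturation:
  assumes U: "openin (Stab_topology C lam N) U"
  shows "openin (Stab_topology C lam N) {\<sigma> \<in> Stab C lam. cls \<sigma> \<in> cls ` U}"
  unfolding openin_Stab_topology
proof (intro conjI ballI)
  fix \<sigma> assume "\<sigma> \<in> {\<sigma> \<in> Stab C lam. cls \<sigma> \<in> cls ` U}"
  then obtain \<tau> where \<sigma>: "\<sigma> \<in> Stab C lam" and \<tau>: "\<tau> \<in> U" "cls \<sigma> = cls \<tau>" by blast
  have \<tau>S: "\<tau> \<in> Stab C lam" using U \<tau>(1) unfolding openin_Stab_topology by blast
  have eq: "(\<sigma>, \<tau>) \<in> stab_equiv C lam" using cls_eq_iff[OF \<sigma> \<tau>S] \<tau>(2) by blast
  then have Im: "\<And>x. Im (snd \<sigma> x) = Im (snd \<tau> x)" and "slicing_dist C (fst \<sigma>) (fst \<tau>) < 1"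
    by (simp_all add: stab_equiv_def)
  then obtain r where r: "0 \<le> r" "r < 1" "slicing_dist C (fst \<sigma>) (fst \<tau>) = ennreal r"
    using ennreal_less_1_obtain by metis
  \<comment> \<open>two steps of size \<open>g\<close> still leave the distance below 1\<close>
  define g where "g = (1 - r) / 3"
  have g: "0 < g" "g + r + g < 1" using r by (simp_all add: g_def field_simps)
  obtain e' where e': "0 < e'" "\<And>\<upsilon>. \<upsilon> \<in> Stab C lam \<Longrightarrow> stab_dist C N \<tau> \<upsilon> < e' \<Longrightarrow> \<upsilon> \<in> U"
    using U \<tau>(1) unfolding openin_Stab_topology by meson
  obtain e0 where e0: "0 < e0" "ennreal e0 \<le> e'" using ennreal_pos_obtain_real[OF e'(1)] .
  define e1 where "e1 = min e0 g"
  have e1: "0 < e1" using e0 g by (simp add: e1_def)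
  obtain d where d: "0 < d" "\<And>B :: 'l \<Rightarrow> real. B \<in> Hom_Z \<Longrightarrow> (\<And>i. i < n \<Longrightarrow> \<bar>B (b i) - Im (snd \<tau> (b i))\<bar> < d) \<Longrightarrow>
    \<exists>\<upsilon>\<in>Stab C lam. (\<lambda>x. Im (snd \<upsilon> x)) = B \<and> stab_dist C N \<tau> \<upsilon> < ennreal e1"
    using deform_imaginary_part[OF \<tau>S e1] by blast
  define T where "T = (\<Inter>i<n. {B :: 'l \<Rightarrow> real. \<bar>B (b i) - Im (snd \<tau> (b i))\<bar> < d})"
  have "open {B :: 'l \<Rightarrow> real. \<bar>B (b i) - Im (snd \<tau> (b i))\<bar> < d}" for i
    by (intro open_Collect_less continuous_intros continuous_on_product_coordinates)
  then have "open T" unfolding T_def by (intro open_INT) auto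
  then have "openin Hom_Z_topology (Hom_Z \<inter> T)" unfolding Hom_Z_topology_def by (rule openin_open_Int)
  then have "openin (Stab_topology C lam N) {\<sigma> \<in> topspace (Stab_topology C lam N). (\<lambda>x. Im (snd \<sigma> x)) \<in> Hom_Z \<inter> T}"
    using continuous_Im unfolding continuous_map_def by blast
  moreover have "\<sigma> \<in> {\<sigma> \<in> topspace (Stab_topology C lam N). (\<lambda>x. Im (snd \<sigma> x)) \<in> Hom_Z \<inter> T}"
    using \<sigma> Im d(1) Im_Hom_Z[OF Stab_Hom_Z[OF \<sigma>]] by (simp add: topspace_Stab_topology T_def)
  ultimately obtain e2 where e2: "0 < e2" "\<And>\<sigma>'. \<sigma>' \<in> Stab C lam \<Longrightarrow> stab_dist C N \<sigma> \<sigma>' < e2 \<Longrightarrow>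
      (\<lambda>x. Im (snd \<sigma>' x)) \<in> Hom_Z \<inter> T"
    unfolding openin_Stab_topology by (smt (verit, best) mem_Collect_eq)
  show "\<exists>e>0. \<forall>\<sigma>'\<in>Stab C lam. stab_dist C N \<sigma> \<sigma>' < e \<longrightarrow> \<sigma>' \<in> {\<sigma> \<in> Stab C lam. cls \<sigma> \<in> cls ` U}"
  proof (intro exI[of _ "min e2 (ennreal g)"] conjI ballI impI)
    fix \<sigma>' assume \<sigma>': "\<sigma>' \<in> Stab C lam" "stab_dist C N \<sigma> \<sigma>' < min e2 (ennreal g)"
    have "(\<lambda>x. Im (snd \<sigma>' x)) \<in> Hom_Z \<inter> T" using e2(2)[OF \<sigma>'(1)] \<sigma>'(2) by simp
    then obtain \<upsilon> where \<upsilon>: "\<upsilon> \<in> Stab C lam" "(\<lambda>x. Im (snd \<upsilon> x)) = (\<lambda>x. Im (snd \<sigma>' x))"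
      "stab_dist C N \<tau> \<upsilon> < ennreal e1"
      using d(2)[of "\<lambda>x. Im (snd \<sigma>' x)"] by (auto simp: T_def)
    have "ennreal e1 \<le> e'" using e0(2) by (simp add: e1_def) (meson ennreal_leI min.cobounded1 order_trans)
    then have \<upsilon>U: "\<upsilon> \<in> U" using e'(2)[OF \<upsilon>(1)] \<upsilon>(3) by (meson less_le_trans)
    have "slicing_dist C (fst \<sigma>') (fst \<upsilon>) \<le>
        slicing_dist C (fst \<sigma>') (fst \<sigma>) + (slicing_dist C (fst \<sigma>) (fst \<tau>) + slicing_dist C (fst \<tau>) (fst \<upsilon>))"
      by (meson slicing_dist_triangle add_left_mono order_trans)
    also have "\<dots> \<le> ennreal g + (ennreal r + ennreal g)"
    proof (intro add_mono)
      show "slicing_dist C (fst \<sigma>') (fst \<sigma>) \<le> ennreal g"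
        using \<sigma>'(2) by (simp add: slicing_dist_commute[of _ "fst \<sigma>'"] stab_dist_less_iff less_imp_le)
      show "slicing_dist C (fst \<sigma>) (fst \<tau>) \<le> ennreal r" using r by simp
      have "ennreal e1 \<le> ennreal g" by (rule ennreal_leI) (simp add: e1_def)
      then show "slicing_dist C (fst \<tau>) (fst \<upsilon>) \<le> ennreal g"
        using \<upsilon>(3) unfolding stab_dist_less_iff by (meson less_imp_le less_le_trans)
    qed
    also have "\<dots> = ennreal (g + r + g)" using g(1) r(1) by (simp add: ennreal_plus[symmetric] ac_simps del: ennreal_plus)
    also have "\<dots> < 1" unfolding ennreal_less_one_iff by (rule g(2))
    finally have "(\<sigma>', \<upsilon>) \<in> stab_equiv C lam"
      using \<sigma>'(1) \<upsilon>(1,2) by (simp add: stab_equiv_def fun_eq_iff)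
    then have "cls \<sigma>' = cls \<upsilon>" using cls_eq_iff[OF \<sigma>'(1) \<upsilon>(1)] by blast
    then show "\<sigma>' \<in> {\<sigma> \<in> Stab C lam. cls \<sigma> \<in> cls ` U}" using \<sigma>'(1) \<upsilon>U by blast
  qed (use e2 g in simp)
qed auto

lemma stab_dist_triangle:
  assumes "\<sigma> \<in> Stab C lam" "\<tau> \<in> Stab C lam" "\<upsilon> \<in> Stab C lam"
  shows "stab_dist C N \<sigma> \<upsilon> \<le> stab_dist C N \<sigma> \<tau> + stab_dist C N \<tau> \<upsilon>"
proof -
  note H = assms[THEN Stab_Hom_Z]
  have "ennreal (N (\<lambda>x. snd \<sigma> x - snd \<upsilon> x)) \<le>
      ennreal (N (\<lambda>x. snd \<sigma> x - snd \<tau> x)) + ennreal (N (\<lambda>x. snd \<tau> x - snd \<upsilon> x))"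
    using N_triangle[OF H] N_nonneg[OF Hom_Z_diff[OF H(1,2)]] N_nonneg[OF Hom_Z_diff[OF H(2,3)]]
    by (simp add: ennreal_leI flip: ennreal_plus)
  moreover have "max a a' \<le> max x x' + max y y'" if "a \<le> x + y" "a' \<le> x' + y'" for a a' x x' y y' :: ennreal
    using that by (meson add_mono max.boundedI max.cobounded1 max.cobounded2 order_trans)
  ultimately show ?thesis unfolding stab_dist_def using slicing_dist_triangle by blast
qed

lemma open_ball:
  assumes \<sigma>: "\<sigma> \<in> Stab C lam"
  shows "openin (Stab_topology C lam N) {\<tau> \<in> Stab C lam. stab_dist C N \<sigma> \<tau> < ennreal r}"
  unfolding openin_Stab_topology
proof (intro conjI ballI)
  fix \<tau> assume "\<tau> \<in> {\<tau> \<in> Stab C lam. stab_dist C N \<sigma> \<tau> < ennreal r}"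
  then have \<tau>: "\<tau> \<in> Stab C lam" "stab_dist C N \<sigma> \<tau> < ennreal r" by auto
  then obtain s where s: "0 \<le> s" "s < r" "stab_dist C N \<sigma> \<tau> = ennreal s"
    by (cases "stab_dist C N \<sigma> \<tau>") (auto simp: ennreal_less_iff)
  show "\<exists>e>0. \<forall>\<upsilon>\<in>Stab C lam. stab_dist C N \<tau> \<upsilon> < e \<longrightarrow> \<upsilon> \<in> {\<tau> \<in> Stab C lam. stab_dist C N \<sigma> \<tau> < ennreal r}"
  proof (intro exI[of _ "ennreal (r - s)"] conjI ballI impI)
    fix \<upsilon> assume \<upsilon>: "\<upsilon> \<in> Stab C lam" "stab_dist C N \<tau> \<upsilon> < ennreal (r - s)"
    have "stab_dist C N \<sigma> \<upsilon> \<le> stab_dist C N \<sigma> \<tau> + stab_dist C N \<tau> \<upsilon>"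
      using stab_dist_triangle \<sigma> \<tau>(1) \<upsilon>(1) by blast
    also have "\<dots> < ennreal s + ennreal (r - s)"
      unfolding s(3) using \<upsilon>(2) by (simp add: ennreal_add_left_cancel_less)
    also have "\<dots> = ennreal r" using s by (simp flip: ennreal_plus)
    finally show "\<upsilon> \<in> {\<tau> \<in> Stab C lam. stab_dist C N \<sigma> \<tau> < ennreal r}" using \<upsilon>(1) by simp
  qed (use s in simp)
qed auto

lemma Sb_topology_cls: "Sb_topology C lam N = quotient_topology (Stab_topology C lam N) cls"
  unfolding Sb_topology_def cls_def ..

lemma Forg_open_image:
  assumes V: "openin (Sb_topology C lam N) V" shows "openin Hom_Z_topology (Forg ` V)"
proof -
  have V': "V \<subseteq> cls ` Stab C lam" "openin (Stab_topology C lam N) {\<sigma> \<in> Stab C lam. cls \<sigma> \<in> V}"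
    using V unfolding Sb_topology_cls openin_quotient_topology topspace_Stab_topology by auto
  have "Forg ` V = (\<lambda>\<sigma> x. Im (snd \<sigma> x)) ` {\<sigma> \<in> Stab C lam. cls \<sigma> \<in> V}"
  proof
    show "Forg ` V \<subseteq> (\<lambda>\<sigma> x. Im (snd \<sigma> x)) ` {\<sigma> \<in> Stab C lam. cls \<sigma> \<in> V}"
      using V'(1) Forg_cls by fastforce
    show "(\<lambda>\<sigma> x. Im (snd \<sigma> x)) ` {\<sigma> \<in> Stab C lam. cls \<sigma> \<in> V} \<subseteq> Forg ` V"
    proof (rule image_subsetI)
      fix \<sigma> assume \<sigma>: "\<sigma> \<in> {\<sigma> \<in> Stab C lam. cls \<sigma> \<in> V}"
      then have "Forg (cls \<sigma>) \<in> Forg ` V" by blast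
      then show "(\<lambda>x. Im (snd \<sigma> x)) \<in> Forg ` V" using Forg_cls[of \<sigma>] \<sigma> by simp
    qed
  qed
  then show ?thesis using open_Im[OF V'(2)] by simp
qed

lemma Forg_continuous: "continuous_map (Sb_topology C lam N) Hom_Z_topology Forg"
proof -
  have "continuous_map (Stab_topology C lam N) Hom_Z_topology (Forg \<circ> cls)"
    by (rule continuous_map_eq[OF continuous_Im]) (simp add: topspace_Stab_topology Forg_cls)
  then show ?thesis
    unfolding Sb_topology_cls
    using continuous_compose_quotient_map[OF quotient_map_quotient_topology] by blast
qed

theorem Forg_local_homeomorphism: "local_homeomorphism (Sb_topology C lam N) Hom_Z_topology Forg"
  unfolding local_homeomorphism_def
proof
  let ?X = "Sb_topology C lam N"
  fix x assume "x \<in> topspace ?X"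
  then obtain \<sigma> where \<sigma>: "\<sigma> \<in> Stab C lam" "x = cls \<sigma>"
    unfolding Sb_topology_cls topspace_quotient_topology topspace_Stab_topology by blast
  define B where "B = {\<tau> \<in> Stab C lam. stab_dist C N \<sigma> \<tau> < ennreal (1 / 2)}"
  define U where "U = cls ` B"
  have B: "openin (Stab_topology C lam N) B" unfolding B_def by (rule open_ball[OF \<sigma>(1)])
  have BS: "B \<subseteq> Stab C lam" by (auto simp: B_def)
  have "stab_dist C N \<sigma> \<sigma> = 0"
    using norm unfolding is_norm_Hom_def stab_dist_def by (simp add: Hom_Z_iff)
  moreover have "0 < ennreal (1 / 2)" unfolding ennreal_less_zero_iff by simp
  ultimately have "\<sigma> \<in> B" unfolding B_def mem_Collect_eq using \<sigma>(1) by metis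
  then have xU: "x \<in> U" using \<sigma>(2) by (simp add: U_def)
  have U: "openin ?X U"
    unfolding Sb_topology_cls openin_quotient_topology topspace_Stab_topology U_def
    using open_saturation[OF B] BS by blast
  have inj: "inj_on Forg U"
  proof (rule inj_onI)
    fix y z assume "y \<in> U" "z \<in> U" and eq: "Forg y = Forg z"
    then obtain \<tau> \<upsilon> where *: "\<tau> \<in> B" "\<upsilon> \<in> B" "y = cls \<tau>" "z = cls \<upsilon>" unfolding U_def by blast
    then have S: "\<tau> \<in> Stab C lam" "\<upsilon> \<in> Stab C lam" using BS by auto
    have d: "slicing_dist C (fst \<sigma>) (fst \<tau>) < ennreal (1 / 2)" "slicing_dist C (fst \<sigma>) (fst \<upsilon>) < ennreal (1 / 2)"
      using *(1,2) unfolding B_def stab_dist_less_iff by auto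
    have "slicing_dist C (fst \<tau>) (fst \<upsilon>) \<le> slicing_dist C (fst \<tau>) (fst \<sigma>) + slicing_dist C (fst \<sigma>) (fst \<upsilon>)"
      by (rule slicing_dist_triangle)
    also have "\<dots> < ennreal (1 / 2) + ennreal (1 / 2)"
      using add_strict_mono[OF d] by (simp only: slicing_dist_commute[of C "fst \<tau>" "fst \<sigma>"])
    also have "\<dots> = ennreal (1 / 2 + 1 / 2)" by (rule ennreal_plus[symmetric]) simp_all
    also have "\<dots> = 1" by simp
    finally have "(\<tau>, \<upsilon>) \<in> stab_equiv C lam"
      using eq S unfolding *(3,4) Forg_cls[OF S(1)] Forg_cls[OF S(2)] by (simp add: stab_equiv_def fun_eq_iff)
    then show "y = z" using cls_eq_iff[OF S] *(3,4) by blast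
  qed
  have FU: "openin Hom_Z_topology (Forg ` U)" by (rule Forg_open_image[OF U])
  have "homeomorphic_map (subtopology ?X U) (subtopology Hom_Z_topology (Forg ` U)) Forg"
  proof (rule bijective_open_imp_homeomorphic_map)
    have tU: "topspace (subtopology ?X U) = U" "topspace (subtopology Hom_Z_topology (Forg ` U)) = Forg ` U"
      using openin_subset[OF U] openin_subset[OF FU] by auto
    show "continuous_map (subtopology ?X U) (subtopology Hom_Z_topology (Forg ` U)) Forg"
      using continuous_map_from_subtopology[OF Forg_continuous]
      by (rule continuous_map_into_subtopology) (use tU in auto)
    show "open_map (subtopology ?X U) (subtopology Hom_Z_topology (Forg ` U)) Forg"
      unfolding open_map_def
    proof (intro allI impI)
      fix V assume "openin (subtopology ?X U) V"
      then have V: "openin ?X V" "V \<subseteq> U" using openin_open_subtopology[OF U] by auto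
      then show "openin (subtopology Hom_Z_topology (Forg ` U)) (Forg ` V)"
        using openin_open_subtopology[OF FU] Forg_open_image[OF V(1)] by blast
    qed
    show "Forg ` topspace (subtopology ?X U) = topspace (subtopology Hom_Z_topology (Forg ` U))"
      unfolding tU ..
    show "inj_on Forg (topspace (subtopology ?X U))" unfolding tU by (rule inj)
  qed
  then show "\<exists>U. x \<in> U \<and> openin ?X U \<and> openin Hom_Z_topology (Forg ` U) \<and>
      homeomorphic_map (subtopology ?X U) (subtopology Hom_Z_topology (Forg ` U)) Forg"
    using xU U FU by blast
qed

end

theorem proposition1p6:
  fixes C :: "('o, 'm::ab_group_add, 'k::field) tricat"
    and lam :: "('o \<Rightarrow>\<^sub>0 int) set \<Rightarrow> 'l::ab_group_add"
    and N :: "('l \<Rightarrow> complex) \<Rightarrow> real"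
  assumes "triangulated_category C"
    and "finite_rank_lattice TYPE('l)"
    and "lam \<in> epi (K_group C) type_group"
    and "is_norm_Hom N"
  shows "local_homeomorphism (Sb_topology C lam N) Hom_Z_topology Forg"
proof -
  obtain n and k :: "nat \<Rightarrow> 'l \<Rightarrow> int" and b where basis: "lattice_basis n k b"
    using finite_rank_lattice_basis[OF assms(2)] .
  have "lam \<in> hom (K_group C) type_group" using assms(3) by (simp add: epi_def)
  then interpret stability_space C n k b lam N
    by (intro stability_space.intro stability_space_axioms.intro assms(1,4) basis)
  show ?thesis by (rule Forg_local_homeomorphism)
qed

end
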